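(* Let $Z=(Z^+,Z^-)$ be the Filippov vector field given by $Z^+=(X^+,Y^+)$ for $y>0$ and $Z^-=(X^-,Y^-)$ for $y<0$, where $Z^{+}$ and $Z^{-}$ are analytic on a neighborhood of the origin of $\mathbb{R}^2$. Assume that $Z$ has a $(2k^+,2k^-)$-monodromic tangential singularity at the origin, for positive integers $k^+$ and $k^-$. Let $\delta=\mathrm{sign}(X^+(0,0))$ and define $$a^{\pm}=\frac{1}{(2k^{\pm}-1)!\,|X^{\pm}(0,0)|}\frac{\partial^{2k^{\pm}-1}Y^{\pm}}{\partial x^{2k^{\pm}-1}}(0,0),$$ $$f^{\pm}(x)=\frac{\pm \delta Y^{\pm}(x,0)-a^{\pm}x^{2k^{\pm}-1} X^{\pm}(x,0)}{x^{2k^{\pm}} X^{\pm}(x,0)},\qquad g^{\pm}(x,y)=\frac{\pm X^{\pm}(x,0)Y^{\pm}(x,y) \mp X^{\pm}(x,y)Y^{\pm}(x,0)}{y\, \delta X^{\pm}(x,y)X^{\pm}(x,0)}.$$ Then $f^{\pm}$ and $g^{\pm}$ are analytic in a neighborhood of $x=y=0$ (after extension across their removable singularities at $x=0$, resp. $y=0$). Define functions $y_i^{\pm}$, $i\ge1$, in a neighborhood of $x=0$ recursively by $y_1^{\pm}(x)=a^{\pm}x^{2k^{\pm}-1}+x^{2k^{\pm}}f^{\pm}(x)$; for $2\leq i\leq 2k^{\pm}$, $$y_i^{\pm}(x)=(\pm\delta)^{i-1}\left(a^{\pm}\frac{(2k^{\pm}-1)!}{(2k^{\pm}-i)!}x^{2k^{\pm}-i}+\sum_{l=0}^{i-1}\binom{i-1}{l}\frac{(2k^{\pm})!}{(2k^{\pm}-l)!}x^{2k^{\pm}-l}(f^{\pm})^{(i-1-l)}(x)\right)+G_i^{\pm}(x);$$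 and for $i>2k^{\pm}$, $$y_i^{\pm}(x)=(\pm\delta)^{i-1}\left(\binom{i-1}{2k^{\pm}}(2k^{\pm})!\,(f^{\pm})^{(i-1-2k^{\pm})}(x)+\sum_{l=0}^{2k^{\pm}-1}\binom{i-1}{l}\frac{(2k^{\pm})!}{(2k^{\pm}-l)!}x^{2k^{\pm}-l}(f^{\pm})^{(i-1-l)}(x)\right)+G_i^{\pm}(x);$$ where in both cases $$G_i^{\pm}(x)=\sum_{l=1}^{i-1}\sum_{j=1}^{l}j\binom{i-1}{l}(\pm\delta)^{i-l-1}B_{l,j}\big(y_1^{\pm}(x),\dots,y_{l-j+1}^{\pm}(x)\big)\frac{\partial^{j+i-l-2}g^{\pm}}{\partial x^{i-l-1}\partial y^{j-1}}(x,0).$$ Set $$\mu_i^{\pm}=\frac{1}{i!}\sum_{j=1}^{i}(\mp\delta)^j\binom{i}{j}(y_j^{\pm})^{(i-j)}(0).$$ Then the coefficients $\alpha_n^{\pm}$ of the power series $\varphi^{\pm}(x)=\sum_{n\ge1}\alpha_n^{\pm}x^n$ of the half-return maps are given recursively by $\alpha_1^{\pm}=-1$ and, for $n\ge2$, $$\alpha_n^{\pm}=\frac{p^{\pm}_{n,k^{\pm}}(\alpha_1^{\pm},\ldots,\alpha_{n-1}^{\pm})-\mu^{\pm}_{n+2k^{\pm}-1}}{2k^{\pm}\mu^{\pm}_{2k^{\pm}}},$$ where $$p^{\pm}_{n,k^{\pm}}(\alpha_1,\ldots,\alpha_{n-1})=\mu^{\pm}_{2k^{\pm}}\hat B_{n+2k^{\pm}-1,2k^{\pm}}(\alpha_1,\ldots,\alpha_{n-1},0)+\sum_{i=2k^{\pm}+1}^{n+2k^{\pm}-1}\mu_i^{\pm}\hat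 B_{n+2k^{\pm}-1,i}(\alpha_1,\ldots,\alpha_{n+2k^{\pm}-i}).$$
   Context: All formulas with $\pm$ are two separate statements, one with all upper signs and one with all lower signs. The origin is a $(2k^+,2k^-)$-monodromic tangential singularity of $Z$ (discontinuity line $\Sigma=\{y=0\}$) when it is an invisible contact of multiplicity $2k^{+}$ of $Z^+$ with $\Sigma$, an invisible contact of multiplicity $2k^-$ of $Z^-$ with $\Sigma$, and a first-return map on $\Sigma$ is defined around it; concretely: C1. $X^{\pm}(0,0)\neq0$, $Y^{\pm}(0,0)=0$, $\frac{\partial^i Y^{\pm}}{\partial x^i}(0,0)=0$ for $i=1,\ldots,2k^{\pm}-2$, and $\frac{\partial^{2k^{\pm}-1} Y^{\pm}}{\partial x^{2k^{\pm}-1}}(0,0)\neq0$; C2. $X^+(0,0)\frac{\partial^{2k^{+}-1} Y^{+}}{\partial x^{2k^{+}-1}}(0,0)<0$ and $X^-(0,0)\frac{\partial^{2k^{-}-1} Y^{-}}{\partial x^{2k^{-}-1}}(0,0)>0$; C3. $X^+(0,0)X^-(0,0)<0$. Thus $\delta=\mathrm{sign}(X^+(0,0))=-\mathrm{sign}(X^-(0,0))$. Half-return maps: for $x\neq 0$ close to $0$, the orbit of $Z^{+}$ through $(x,0)$ restricted to $\{y\ge 0\}$ (resp. of $Z^-$ restricted to $\{y\le0\}$), followed forward or backward in time (whichever direction enters $\{y>0\}$, resp. $\{y<0\}$), meets $\Sigma$ again for the first time at $(\varphi^{+}(x),0)$ (resp. $(\varphi^{-}(x),0)$); $\varphi^{\pm}(0)=0$.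 The maps $\varphi^{\pm}$ are analytic involutions near $0$. Partial and ordinary Bell polynomials, for integers $p\ge q\ge1$: $$B_{p,q}(x_1,\ldots,x_{p-q+1})=\sum\frac{p!}{b_1!\cdots b_{p-q+1}!}\prod_{j=1}^{p-q+1}\left(\frac{x_j}{j!}\right)^{b_j},\qquad \hat B_{p,q}(x_1,\ldots,x_{p-q+1})=\sum\frac{q!}{b_1!\cdots b_{p-q+1}!}\prod_{j=1}^{p-q+1}x_j^{b_j},$$ the sums running over all tuples of nonnegative integers $(b_1,\ldots,b_{p-q+1})$ with $\sum_j jb_j=p$ and $\sum_j b_j=q$. Equivalently $\hat B_{p,q}(x_1,\ldots,x_{p-q+1})=\frac{q!}{p!}B_{p,q}(1!x_1,\ldots,(p-q+1)!x_{p-q+1})$. *)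

theory Defs
  imports "HOL-Analysis.Analysis"
begin

definition real_analytic_on :: "(real \<Rightarrow> real) \<Rightarrow> real set \<Rightarrow> bool"
  where "real_analytic_on h S \<longleftrightarrow> (\<forall>a\<in>S. \<exists>F. (\<lambda>x. h (a + x)) has_fps_expansion F)"

definition real_analytic2_on :: "(real \<Rightarrow> real \<Rightarrow> real) \<Rightarrow> (real \<times> real) set \<Rightarrow> bool"
  where "real_analytic2_on h S \<longleftrightarrow>
    (\<forall>(a, b)\<in>S. \<exists>c. \<exists>r>0. \<forall>x y. \<bar>x\<bar> < r \<longrightarrow> \<bar>y\<bar> < r \<longrightarrow>
       ((\<lambda>(i, j). c i j * x ^ i * y ^ j) has_sum h (a + x) (b + y)) (UNIV :: (nat \<times> nat) set))"

text \<open>\<open>pd m n h x y\<close> is the partial derivative of \<open>h\<close>, \<open>m\<close> times in the first and \<open>n\<close> times in the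
  second variable, at \<open>(x, y)\<close>.\<close>

definition pd :: "nat \<Rightarrow> nat \<Rightarrow> (real \<Rightarrow> real \<Rightarrow> real) \<Rightarrow> real \<Rightarrow> real \<Rightarrow> real"
  where "pd m n h x y = (deriv ^^ m) (\<lambda>u. (deriv ^^ n) (h u) y) x"

text \<open>The argument \<open>x\<close> is a sequence of which only \<open>x 1, \<dots>, x (p - q + 1)\<close> are used; the tuples
  of exponents are functions that are \<open>undefined\<close> outside the index set.\<close>

definition bell_index :: "nat \<Rightarrow> nat \<Rightarrow> (nat \<Rightarrow> nat) set"
  where "bell_index p q = {b \<in> {1..p - q + 1} \<rightarrow>\<^sub>E UNIV.
    (\<Sum>j=1..p - q + 1. j * b j) = p \<and> (\<Sum>j=1..p - q + 1. b j) = q}"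

definition bell :: "nat \<Rightarrow> nat \<Rightarrow> (nat \<Rightarrow> real) \<Rightarrow> real"
  where "bell p q x = (\<Sum>b\<in>bell_index p q.
    fact p / (\<Prod>j=1..p - q + 1. fact (b j)) * (\<Prod>j=1..p - q + 1. (x j / fact j) ^ b j))"

definition ordinary_bell :: "nat \<Rightarrow> nat \<Rightarrow> (nat \<Rightarrow> real) \<Rightarrow> real"
  where "ordinary_bell p q x = (\<Sum>b\<in>bell_index p q.
    fact q / (\<Prod>j=1..p - q + 1. fact (b j)) * (\<Prod>j=1..p - q + 1. x j ^ b j))"

lemma finite_bell_index: "finite (bell_index p q)"
proof (rule finite_subset)
  show "bell_index p q \<subseteq> {1..p - q + 1} \<rightarrow>\<^sub>E {..q}"
  proof
    fix b assume b: "b \<in> bell_index p q"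
    have "b j \<le> q" if "j \<in> {1..p - q + 1}" for j
    proof -
      have "b j \<le> (\<Sum>j=1..p - q + 1. b j)"
        using that by (intro member_le_sum) auto
      then show ?thesis using b by (simp add: bell_index_def)
    qed
    then show "b \<in> {1..p - q + 1} \<rightarrow>\<^sub>E {..q}"
      using b by (auto simp: bell_index_def PiE_iff)
  qed
qed (intro finite_PiE, auto)

lemma bell_cong:
  assumes "\<And>j. 1 \<le> j \<Longrightarrow> j \<le> p - q + 1 \<Longrightarrow> x j = x' j"
  shows "bell p q x = bell p q x'"
  unfolding bell_def
  by (intro sum.cong refl arg_cong2[where f = "(*)"] prod.cong) (simp add: assms)

text \<open>The vector field \<open>Z\<^sup>+ = (X\<^sup>+, Y\<^sup>+)\<close> is \<open>(X Plus, Y Plus)\<close> and \<open>Z\<^sup>- = (X\<^sup>-, Y\<^sup>-)\<close> is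
  \<open>(X Minus, Y Minus)\<close>; in formulas, the sign \<open>\<plusminus>\<close> is \<open>sg \<sigma>\<close>. The number \<open>k \<sigma>\<close> is half of the
  contact multiplicity of the side \<open>\<sigma>\<close>.\<close>

datatype side = Plus | Minus

fun sg :: "side \<Rightarrow> real" where
  "sg Plus = 1"
| "sg Minus = - 1"

type_synonym planar = "side \<Rightarrow> real \<Rightarrow> real \<Rightarrow> real"

definition monodromic_tangential :: "planar \<Rightarrow> planar \<Rightarrow> (side \<Rightarrow> nat) \<Rightarrow> bool"
  where "monodromic_tangential X Y k \<longleftrightarrow>
    (\<forall>\<sigma>. X \<sigma> 0 0 \<noteq> 0 \<and> Y \<sigma> 0 0 = 0 \<and>
         (\<forall>i\<in>{1..2 * k \<sigma> - 2}. pd i 0 (Y \<sigma>) 0 0 = 0) \<and>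
         pd (2 * k \<sigma> - 1) 0 (Y \<sigma>) 0 0 \<noteq> 0) \<and>
    X Plus 0 0 * pd (2 * k Plus - 1) 0 (Y Plus) 0 0 < 0 \<and>
    X Minus 0 0 * pd (2 * k Minus - 1) 0 (Y Minus) 0 0 > 0 \<and>
    X Plus 0 0 * X Minus 0 0 < 0"

text \<open>\<open>returns_at \<sigma> U P Q x x'\<close>: inside \<open>U\<close>, the orbit of the vector field \<open>(P, Q)\<close> through
  \<open>(x, 0)\<close>, followed forward (\<open>T > 0\<close>) or backward (\<open>T < 0\<close>) in time, enters the open half-plane of
  the side \<open>\<sigma>\<close> and meets the line \<open>y = 0\<close> again for the first time at \<open>(x', 0)\<close>.\<close>

definition returns_at ::
    "side \<Rightarrow> (real \<times> real) set \<Rightarrow> (real \<Rightarrow> real \<Rightarrow> real) \<Rightarrow> (real \<Rightarrow> real \<Rightarrow> real) \<Rightarrow> real \<Rightarrow> real \<Rightarrow> bool"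
  where "returns_at \<sigma> U P Q x x' \<longleftrightarrow>
    (\<exists>T u v. T \<noteq> 0 \<and> u 0 = x \<and> v 0 = 0 \<and> u T = x' \<and> v T = 0 \<and>
      (\<forall>t\<in>closed_segment 0 T. (u t, v t) \<in> U \<and>
         (u has_real_derivative P (u t) (v t)) (at t within closed_segment 0 T) \<and>
         (v has_real_derivative Q (u t) (v t)) (at t within closed_segment 0 T)) \<and>
      (\<forall>t\<in>open_segment 0 T. sg \<sigma> * v t > 0))"

definition half_return_map ::
    "side \<Rightarrow> (real \<times> real) set \<Rightarrow> (real \<Rightarrow> real \<Rightarrow> real) \<Rightarrow> (real \<Rightarrow> real \<Rightarrow> real) \<Rightarrow> (real \<Rightarrow> real) \<Rightarrow> bool"
  where "half_return_map \<sigma> U P Q \<phi> \<longleftrightarrow>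
    \<phi> 0 = 0 \<and> (\<forall>\<^sub>F x in at 0. returns_at \<sigma> U P Q x (\<phi> x))"

definition delta :: "planar \<Rightarrow> real"
  where "delta X = sgn (X Plus 0 0)"

definition a_coeff :: "planar \<Rightarrow> planar \<Rightarrow> (side \<Rightarrow> nat) \<Rightarrow> side \<Rightarrow> real"
  where "a_coeff X Y k \<sigma> =
    1 / (fact (2 * k \<sigma> - 1) * \<bar>X \<sigma> 0 0\<bar>) * pd (2 * k \<sigma> - 1) 0 (Y \<sigma>) 0 0"

definition f_quot :: "planar \<Rightarrow> planar \<Rightarrow> (side \<Rightarrow> nat) \<Rightarrow> side \<Rightarrow> real \<Rightarrow> real"
  where "f_quot X Y k \<sigma> x =
    (sg \<sigma> * delta X * Y \<sigma> x 0 - a_coeff X Y k \<sigma> * x ^ (2 * k \<sigma> - 1) * X \<sigma> x 0)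
      / (x ^ (2 * k \<sigma>) * X \<sigma> x 0)"

definition g_quot :: "planar \<Rightarrow> planar \<Rightarrow> side \<Rightarrow> real \<Rightarrow> real \<Rightarrow> real"
  where "g_quot X Y \<sigma> x y =
    (sg \<sigma> * X \<sigma> x 0 * Y \<sigma> x y - sg \<sigma> * X \<sigma> x y * Y \<sigma> x 0)
      / (y * delta X * X \<sigma> x y * X \<sigma> x 0)"

text \<open>The quotients above have removable singularities at \<open>x = 0\<close> and at \<open>y = 0\<close>, respectively;
  the missing values are the limits.\<close>

definition f_fun :: "planar \<Rightarrow> planar \<Rightarrow> (side \<Rightarrow> nat) \<Rightarrow> side \<Rightarrow> real \<Rightarrow> real"
  where "f_fun X Y k \<sigma> x = (if x = 0 then Lim (at 0) (f_quot X Y k \<sigma>) else f_quot X Y k \<sigma> x)"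

definition g_fun :: "planar \<Rightarrow> planar \<Rightarrow> side \<Rightarrow> real \<Rightarrow> real \<Rightarrow> real"
  where "g_fun X Y \<sigma> x y = (if y = 0 then Lim (at 0) (g_quot X Y \<sigma> x) else g_quot X Y \<sigma> x y)"

text \<open>In \<open>G_sum\<close> the argument \<open>w\<close> stands for the values at \<open>x\<close> of the functions \<open>y\<^sub>1, \<dots>, y\<^sub>i\<^sub>-\<^sub>1\<close>.\<close>

definition G_sum :: "planar \<Rightarrow> planar \<Rightarrow> side \<Rightarrow> (nat \<Rightarrow> real) \<Rightarrow> nat \<Rightarrow> real \<Rightarrow> real"
  where "G_sum X Y \<sigma> w i x =
    (\<Sum>l=1..i - 1. \<Sum>j=1..l.
       real j * real ((i - 1) choose l) * (sg \<sigma> * delta X) ^ (i - l - 1) * bell l j w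
         * pd (i - l - 1) (j - 1) (g_fun X Y \<sigma>) x 0)"

lemma G_sum_cong [fundef_cong]:
  assumes "X = X'" "Y = Y'" "\<sigma> = \<sigma>'" "i = i'" "x = x'"
    and "\<And>m. 1 \<le> m \<Longrightarrow> m < i' \<Longrightarrow> w m = w' m"
  shows "G_sum X Y \<sigma> w i x = G_sum X' Y' \<sigma>' w' i' x'"
proof -
  have "bell l j w = bell l j w'" if "l \<in> {1..i' - 1}" "j \<in> {1..l}" for l j
    by (rule bell_cong, rule assms(6)) (use that in auto)
  then show ?thesis
    unfolding G_sum_def assms(1-5) by (intro sum.cong refl) simp
qed

text \<open>The value at index \<open>0\<close> is irrelevant.\<close>

function y_fun :: "planar \<Rightarrow> planar \<Rightarrow> (side \<Rightarrow> nat) \<Rightarrow> side \<Rightarrow> nat \<Rightarrow> real \<Rightarrow> real"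
  where "y_fun X Y k \<sigma> i x =
    (let a = a_coeff X Y k \<sigma>; f = f_fun X Y k \<sigma>; K = 2 * k \<sigma> in
     if i = 0 then 0
     else if i = 1 then a * x ^ (K - 1) + x ^ K * f x
     else if i \<le> K then
       (sg \<sigma> * delta X) ^ (i - 1) *
         (a * (fact (K - 1) / fact (K - i)) * x ^ (K - i)
          + (\<Sum>l=0..i - 1. real ((i - 1) choose l) * (fact K / fact (K - l)) * x ^ (K - l)
               * (deriv ^^ (i - 1 - l)) f x))
       + G_sum X Y \<sigma> (\<lambda>m. y_fun X Y k \<sigma> m x) i x
     else
       (sg \<sigma> * delta X) ^ (i - 1) *
         (real ((i - 1) choose K) * fact K * (deriv ^^ (i - 1 - K)) f x
          + (\<Sum>l=0..K - 1. real ((i - 1) choose l) * (fact K / fact (K - l)) * x ^ (K - l)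
               * (deriv ^^ (i - 1 - l)) f x))
       + G_sum X Y \<sigma> (\<lambda>m. y_fun X Y k \<sigma> m x) i x)"
  by pat_completeness auto
termination
  by (relation "Wellfounded.measure (\<lambda>(X, Y, k, \<sigma>, i, x). i)") auto

declare y_fun.simps [simp del]

definition mu :: "planar \<Rightarrow> planar \<Rightarrow> (side \<Rightarrow> nat) \<Rightarrow> side \<Rightarrow> nat \<Rightarrow> real"
  where "mu X Y k \<sigma> i =
    1 / fact i * (\<Sum>j=1..i. (- sg \<sigma> * delta X) ^ j * real (i choose j)
                      * (deriv ^^ (i - j)) (y_fun X Y k \<sigma> j) 0)"

definition p_poly :: "(nat \<Rightarrow> real) \<Rightarrow> nat \<Rightarrow> nat \<Rightarrow> (nat \<Rightarrow> real) \<Rightarrow> real"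
  where "p_poly \<mu> n k \<alpha> =
    \<mu> (2 * k) * ordinary_bell (n + 2 * k - 1) (2 * k) (\<alpha>(n := 0))
    + (\<Sum>i=2 * k + 1..n + 2 * k - 1. \<mu> i * ordinary_bell (n + 2 * k - 1) i \<alpha>)"

end

theory Submission imports Defs "HOL-Complex_Analysis.Complex_Analysis" begin

text \<open>Fix a side \<open>\<sigma>\<close> and put \<open>\<epsilon> = sg \<sigma> * \<delta>\<close>, the sign of \<open>X\<^sup>\<sigma>(0, 0)\<close>, and \<open>\<eta> = \<epsilon> Y / X\<close>, so that
  \<open>\<eta> = a x^(2k-1) + x^(2k) f + y g\<close>. The orbits of \<open>(X, Y)\<close> are those of the derivation
  \<open>E = \<epsilon> \<partial>\<^sub>x + \<eta> \<partial>\<^sub>y\<close>, and \<open>y\<^sub>i\<close> is \<open>E^i y\<close> restricted to \<open>y = 0\<close>. Let \<open>H\<close> be the analytic first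
  integral with \<open>H(0, y) = y\<close>, that is, the height at which the orbit through \<open>(x, y)\<close> crosses the line
  \<open>x = 0\<close>. By the Lie series, \<open>W(x) = H(x, 0) = \<Sum> (- \<epsilon> x)^j / j! y\<^sub>j(x)\<close>, so \<open>\<mu>\<^sub>i\<close> are the Taylor
  coefficients of \<open>W\<close>, and \<open>W\<close> has order \<open>2k\<close> at \<open>0\<close>. Since \<open>H\<close> is constant along orbits, an orbit
  from \<open>(x, 0)\<close> with \<open>x\<close> small stays near the origin as long as it remains on the side \<open>\<sigma>\<close>, and
  \<open>W(\<phi>(x)) = W(x)\<close> with \<open>\<phi>(x) \<noteq> x\<close>. No existence or uniqueness theorem for differential
  equations is needed. Writing \<open>W = c \<psi>^(2k)\<close> gives \<open>\<phi> = \<psi>^(-1) \<circ> (- \<psi>)\<close>, hence the analyticity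
  of \<open>\<phi>\<close>, and comparing coefficients in \<open>W \<circ> \<phi> = W\<close> gives the recursion.\<close>

unbundle no vec_syntax and fps_syntax

section \<open>Derivations of formal power series in two variables\<close>

text \<open>The hypothesis on \<open>\<phi>\<close> supplies, for each small x, just some orbit arc
  of unspecified length, so neither the continuity of \<open>\<phi>\<close> at 0 nor the nearness of
  the arc to the origin is known in advance. Both come from a sign: by C2 the leading coefficient of
  W has the sign \<open>sg \<sigma>\<close>, so in a small box of the half-plane of \<sigma> the
  quantity \<open>sg \<sigma> * H\<close> is at least a positive multiple of x^(2k) plus |y| / 2,
  and a small value of it forces x and y to be small. The Lie series is never summed. The convergent
  H is obtained from E H = 0 by a majorant, and the Lie series serves only coefficientwise, as a
  formal identity for the restriction of H to y = 0. Likewise the recursion for \<open>y_fun\<close>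
  is compared with the iterates of E inside the ring of double power series. Its Bell polynomials
  arise because sending \<Phi> to the sum of E^l \<Phi> t^l / l!, restricted to y = 0, is
  multiplicative, so that all E^l (y^j) are read off from powers of one series.\<close>

lemma derivation_funpow_mult:
  fixes D :: "'a::comm_ring_1 \<Rightarrow> 'a"
  assumes add: "\<And>a b. D (a + b) = D a + D b" and mult: "\<And>a b. D (a * b) = D a * b + a * D b"
  shows "(D ^^ n) (a * b) = (\<Sum>l\<le>n. of_nat (n choose l) * (D ^^ l) a * (D ^^ (n - l)) b)"
proof (induction n arbitrary: a b)
  case 0
  then show ?case by simp
next
  case (Suc n)
  have D_add: "(D ^^ n) (u + v) = (D ^^ n) u + (D ^^ n) v" for u v n
    by (induction n arbitrary: u v) (simp_all add: add)
  let ?s = "\<lambda>l. (D ^^ l) a * (D ^^ (Suc n - l)) b"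
  have "(D ^^ Suc n) (a * b) = (D ^^ n) (D a * b) + (D ^^ n) (a * D b)"
    by (simp add: funpow_swap1 mult D_add)
  also have "\<dots> = (\<Sum>l\<le>n. of_nat (n choose l) * ?s (Suc l)) + (\<Sum>l\<le>n. of_nat (n choose l) * ?s l)"
    unfolding Suc.IH
    by (intro arg_cong2[where f = "(+)"] sum.cong refl)
       (simp_all add: funpow_swap1 Suc_diff_le mult.assoc)
  also have "(\<Sum>l\<le>n. of_nat (n choose l) * ?s l) = (\<Sum>l\<le>Suc n. of_nat (n choose l) * ?s l)"
    by (simp add: binomial_eq_0)
  also have "\<dots> = ?s 0 + (\<Sum>l\<le>n. of_nat (n choose Suc l) * ?s (Suc l))"
    by (subst sum.atMost_Suc_shift) simp
  also have "(\<Sum>l\<le>n. of_nat (n choose l) * ?s (Suc l)) + (?s 0 + (\<Sum>l\<le>n. of_nat (n choose Suc l) * ?s (Suc l)))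
      = ?s 0 + (\<Sum>l\<le>n. of_nat (Suc n choose Suc l) * ?s (Suc l))"
    by (simp add: sum.distrib algebra_simps)
  also have "\<dots> = (\<Sum>l\<le>Suc n. of_nat (Suc n choose l) * ?s l)"
    by (subst sum.atMost_Suc_shift) simp
  finally show ?case by (simp add: mult.assoc)
qed

text \<open>The derivative in the inner variable, taken coefficientwise; \<open>fps_deriv\<close> on
  double series is the derivative in the outer variable.\<close>

definition fps_deriv_inner :: "'a::comm_ring_1 fps fps \<Rightarrow> 'a fps fps"
  where "fps_deriv_inner \<Phi> = Abs_fps (\<lambda>j. fps_deriv (\<Phi> $ j))"

lemma fps_deriv_inner_nth [simp]: "fps_deriv_inner \<Phi> $ j = fps_deriv (\<Phi> $ j)"
  by (simp add: fps_deriv_inner_def)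

lemma fps_deriv_inner_const [simp]: "fps_deriv_inner (fps_const a) = fps_const (fps_deriv a)"
  by (rule fps_ext) simp

lemma fps_deriv_inner_X_power [simp]: "fps_deriv_inner (fps_X ^ j) = 0"
  by (rule fps_ext) (simp add: fps_X_power_nth)

lemma fps_deriv_inner_X [simp]: "fps_deriv_inner fps_X = 0"
  using fps_deriv_inner_X_power[of 1] by simp

lemma fps_deriv_inner_add [simp]: "fps_deriv_inner (\<Phi> + \<Psi>) = fps_deriv_inner \<Phi> + fps_deriv_inner \<Psi>"
  by (simp add: fps_eq_iff)

lemma fps_deriv_inner_mult [simp]:
  "fps_deriv_inner (\<Phi> * \<Psi>) = fps_deriv_inner \<Phi> * \<Psi> + \<Phi> * fps_deriv_inner \<Psi>"
  by (rule fps_ext) (simp add: fps_mult_nth fps_deriv_sum sum.distrib add.commute)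

text \<open>Double power series are read with the outer variable \<open>y\<close> and the inner variable \<open>x\<close>.\<close>

definition vfield :: "real \<Rightarrow> real fps fps \<Rightarrow> real fps fps \<Rightarrow> real fps fps"
  where "vfield e \<eta> \<Phi> = fps_const (fps_const e) * fps_deriv_inner \<Phi> + \<eta> * fps_deriv \<Phi>"

context
  fixes e :: real and \<eta> :: "real fps fps"
begin

abbreviation "E \<equiv> vfield e \<eta>"

lemma vfield_add: "E (\<Phi> + \<Psi>) = E \<Phi> + E \<Psi>"
  by (simp add: vfield_def algebra_simps)

lemma vfield_mult: "E (\<Phi> * \<Psi>) = E \<Phi> * \<Psi> + \<Phi> * E \<Psi>"
  by (simp add: vfield_def algebra_simps)

lemma vfield_0 [simp]: "E 0 = 0"
  by (simp add: vfield_def fps_eq_iff)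

lemma vfield_funpow_0 [simp]: "(E ^^ n) 0 = 0"
  by (induction n) simp_all

lemma vfield_funpow_add: "(E ^^ n) (\<Phi> + \<Psi>) = (E ^^ n) \<Phi> + (E ^^ n) \<Psi>"
  by (induction n) (simp_all add: vfield_add)

lemma vfield_funpow_sum: "(E ^^ n) (\<Sum>i\<in>I. \<Phi> i) = (\<Sum>i\<in>I. (E ^^ n) (\<Phi> i))"
  by (induction I rule: infinite_finite_induct) (simp_all add: vfield_funpow_add)

lemmas vfield_funpow_mult = derivation_funpow_mult[of E, OF vfield_add vfield_mult]

lemma vfield_const: "E (fps_const a) = fps_const (fps_const e * fps_deriv a)"
  by (simp add: vfield_def)

lemma vfield_funpow_const:
  "(E ^^ n) (fps_const a) = fps_const (fps_const (e ^ n) * (fps_deriv ^^ n) a)"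
  by (induction n) (simp_all add: vfield_const mult.assoc[symmetric])

lemma vfield_funpow_1: "(E ^^ n) 1 = (if n = 0 then 1 else 0)"
proof (cases n)
  case (Suc m)
  have "E 1 = 0" using vfield_const[of 1] by simp
  then show ?thesis by (simp add: Suc funpow_swap1)
qed simp

lemma vfield_X_power: "E (fps_X ^ j) = \<eta> * (of_nat j * fps_X ^ (j - 1))"
  by (simp add: vfield_def fps_deriv_power')

lemma vfield_X: "E fps_X = \<eta>"
  using vfield_X_power[of 1] by simp

text \<open>Since E (y^j) = j \<eta> y^(j - 1), one application of E lowers the order in y by at
  most one. The cofactor \<open>\<Psi>\<close> is arbitrary because it changes at each step.\<close>

lemma vfield_order: "l < j \<Longrightarrow> (E ^^ l) (fps_X ^ j * \<Psi>) $ 0 = 0"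
proof (induction l arbitrary: j \<Psi>)
  case 0
  then show ?case by simp
next
  case (Suc l)
  then obtain i where j: "j = Suc i" by (cases j) auto
  have "E (fps_X ^ j * \<Psi>) = fps_X ^ i * (of_nat j * \<eta> * \<Psi> + fps_X * E \<Psi>)"
    unfolding vfield_mult vfield_X_power j by (simp add: distrib_left mult_ac)
  then have "(E ^^ Suc l) (fps_X ^ j * \<Psi>) = (E ^^ l) (fps_X ^ i * (of_nat j * \<eta> * \<Psi> + fps_X * E \<Psi>))"
    by (simp only: funpow_Suc_right o_apply)
  also have "\<dots> $ 0 = 0"
    by (rule Suc.IH) (use Suc.prems j in simp)
  finally show ?case .
qed

text \<open>Expansion of \<open>\<Phi>\<close> in the time t of the flow of E started on y = 0: the
  outer variable is t, the inner one is x. For \<Phi> = y its coefficients are y_l / l!.\<close>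

definition taylor :: "real fps fps \<Rightarrow> real fps fps"
  where "taylor \<Phi> = Abs_fps (\<lambda>l. fps_const (1 / fact l) * (E ^^ l) \<Phi> $ 0)"

lemma taylor_1: "taylor 1 = 1"
  by (rule fps_ext) (simp add: taylor_def vfield_funpow_1)

text \<open>The Leibniz rule for E^n divided by n!: pulling back along a flow is
  multiplicative.\<close>

lemma taylor_mult: "taylor (\<Phi> * \<Psi>) = taylor \<Phi> * taylor \<Psi>"
proof (rule fps_ext)
  fix n
  have "fps_const (1 / fact n) * (of_nat (n choose l) * (E ^^ l) \<Phi> $ 0 * (E ^^ (n - l)) \<Psi> $ 0)
      = (fps_const (1 / fact l) * (E ^^ l) \<Phi> $ 0) * (fps_const (1 / fact (n - l)) * (E ^^ (n - l)) \<Psi> $ 0)"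
    if "l \<le> n" for l
  proof -
    have "fps_const (1 / fact n) * of_nat (n choose l)
        = fps_const (1 / fact l) * (fps_const (1 / fact (n - l)) :: real fps)"
      using that by (simp add: binomial_fact flip: fps_of_nat)
    then have "fps_const (1 / fact n) * of_nat (n choose l) * (a * b)
        = fps_const (1 / fact l) * (fps_const (1 / fact (n - l))) * (a * b)" for a b :: "real fps"
      by (rule arg_cong)
    from this[of "(E ^^ l) \<Phi> $ 0" "(E ^^ (n - l)) \<Psi> $ 0"] show ?thesis
      by (simp only: mult_ac)
  qed
  note key = this
  have "taylor (\<Phi> * \<Psi>) $ n = (\<Sum>l\<le>n. fps_const (1 / fact n)
      * (of_nat (n choose l) * (E ^^ l) \<Phi> $ 0 * (E ^^ (n - l)) \<Psi> $ 0))"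
    by (simp add: taylor_def vfield_funpow_mult fps_sum_nth sum_distrib_left)
  also have "\<dots> = (\<Sum>l\<le>n. (fps_const (1 / fact l) * (E ^^ l) \<Phi> $ 0)
      * (fps_const (1 / fact (n - l)) * (E ^^ (n - l)) \<Psi> $ 0))"
    by (intro sum.cong refl key) simp
  also have "\<dots> = (taylor \<Phi> * taylor \<Psi>) $ n"
    by (simp add: taylor_def fps_mult_nth atLeast0AtMost)
  finally show "taylor (\<Phi> * \<Psi>) $ n = (taylor \<Phi> * taylor \<Psi>) $ n" .
qed

lemma taylor_power: "taylor (\<Phi> ^ j) = taylor \<Phi> ^ j"
  by (induction j) (simp_all add: taylor_1 taylor_mult)

text \<open>The Faa di Bruno formula behind the recursion for y_i. Expand \<open>\<Phi>\<close> in
  powers of y. On a coefficient, a function of x alone, E acts as e d/dx; and E^l (y^j) on y = 0 is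
  l! times the coefficient of t^l in the j-th power of y_1 t + y_2 t^2 / 2! + ..., that is j! times
  a Bell polynomial. The Leibniz rule combines the two.\<close>

lemma vfield_funpow_nth_0:
  "(E ^^ m) \<Phi> $ 0 = (\<Sum>l\<le>m. \<Sum>j\<le>l. of_nat (m choose l) * fps_const (e ^ (m - l))
      * (fps_deriv ^^ (m - l)) (\<Phi> $ j) * (fps_const (fact l) * (taylor fps_X ^ j) $ l))"
proof -
  have X: "(E ^^ l) (fps_X ^ j) $ 0 = fps_const (fact l) * (taylor fps_X ^ j) $ l" for l j
  proof -
    have "(taylor fps_X ^ j) $ l = fps_const (1 / fact l) * (E ^^ l) (fps_X ^ j) $ 0"
      by (simp only: taylor_power[symmetric]) (simp add: taylor_def)
    then show ?thesis by (simp add: mult.assoc[symmetric])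
  qed
  \<comment> \<open>The terms of order above m in y do not survive m applications of E followed by y
    = 0.\<close>
  have "\<Phi> = (\<Sum>j\<le>m. fps_const (\<Phi> $ j) * fps_X ^ j) + fps_X ^ Suc m * fps_shift (Suc m) \<Phi>"
    by (rule fps_ext)
       (simp add: fps_sum_nth fps_X_power_mult_nth fps_X_power_nth if_distrib[of "(*) _"] not_less
          del: power_Suc cong: if_cong)
  then have "(E ^^ m) \<Phi> $ 0 = (\<Sum>j\<le>m. (E ^^ m) (fps_X ^ j * fps_const (\<Phi> $ j)) $ 0)"
  proof -
    have "(E ^^ m) \<Phi> = (\<Sum>j\<le>m. (E ^^ m) (fps_const (\<Phi> $ j) * fps_X ^ j))
        + (E ^^ m) (fps_X ^ Suc m * fps_shift (Suc m) \<Phi>)"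
      by (subst \<open>\<Phi> = _\<close>) (simp only: vfield_funpow_add vfield_funpow_sum)
    then show ?thesis
      using vfield_order[of m "Suc m"] by (simp only: fps_add_nth fps_sum_nth) (simp add: mult.commute)
  qed
  also have "\<dots> = (\<Sum>j\<le>m. \<Sum>l\<le>m. of_nat (m choose l) * fps_const (e ^ (m - l))
      * (fps_deriv ^^ (m - l)) (\<Phi> $ j) * (E ^^ l) (fps_X ^ j) $ 0)"
    unfolding vfield_funpow_mult vfield_funpow_const fps_sum_nth
    by (intro sum.cong refl) (simp add: mult_ac)
  also have "\<dots> = (\<Sum>l\<le>m. \<Sum>j\<le>m. of_nat (m choose l) * fps_const (e ^ (m - l))
      * (fps_deriv ^^ (m - l)) (\<Phi> $ j) * (E ^^ l) (fps_X ^ j) $ 0)"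
    by (rule sum.swap)
  also have "\<dots> = (\<Sum>l\<le>m. \<Sum>j\<le>l. of_nat (m choose l) * fps_const (e ^ (m - l))
      * (fps_deriv ^^ (m - l)) (\<Phi> $ j) * (E ^^ l) (fps_X ^ j) $ 0)"
    using vfield_order[where \<Psi> = 1]
    by (intro sum.cong refl sum.mono_neutral_right) auto
  finally show ?thesis by (simp add: X)
qed

text \<open>The operator \<open>\<Phi> \<mapsto> \<Sum>j. (- e x)^j / j! * E^j \<Phi>\<close> is the flow of \<open>E\<close> back to \<open>x = 0\<close>: it kills the
  multiples of \<open>x\<close> and fixes the first integrals.\<close>

lemma first_integral_nth:
  assumes e: "e * e = 1" and H: "E \<H> = 0" and H0: "\<And>j. \<H> $ j $ 0 = (if j = 1 then 1 else 0)"
  shows "\<H> $ 0 $ m = (\<Sum>j\<le>m. (- e) ^ j / fact j * (E ^^ j) fps_X $ 0 $ (m - j))"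
proof -
  \<comment> \<open>\<open>S \<Phi> m\<close> is the coefficient of x^m in the Lie series of
    \<open>\<Phi>\<close> restricted to y = 0.\<close>
  define S where "S \<Phi> m = (\<Sum>j\<le>m. (- e) ^ j / fact j * (E ^^ j) \<Phi> $ 0 $ (m - j))" for \<Phi> and m :: nat
  have EX: "E (fps_const fps_X) = fps_const (fps_const e)"
    by (simp add: vfield_def fps_eq_iff)
  have pow: "(E ^^ j) (fps_const fps_X * \<Psi>)
      = fps_const fps_X * (E ^^ j) \<Psi> + (if j = 0 then 0 else fps_const (fps_const (of_nat j * e)) * (E ^^ (j - 1)) \<Psi>)" for j \<Psi>
  proof (induction j)
    case (Suc j)
    have "E (fps_const (fps_const c) * \<Phi>) = fps_const (fps_const c) * E \<Phi>" for c \<Phi>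
      unfolding vfield_mult by (simp add: vfield_def fps_eq_iff)
    then have "(E ^^ Suc j) (fps_const fps_X * \<Psi>) = fps_const (fps_const e) * (E ^^ j) \<Psi> + fps_const fps_X * (E ^^ Suc j) \<Psi>
        + (if j = 0 then 0 else fps_const (fps_const (of_nat j * e)) * (E ^^ j) \<Psi>)"
      unfolding funpow.simps o_apply Suc by (cases j) (simp_all add: vfield_add vfield_mult[of "fps_const fps_X"] EX)
    also have "\<dots> = fps_const fps_X * (E ^^ Suc j) \<Psi> + fps_const (fps_const (e + of_nat j * e)) * (E ^^ j) \<Psi>"
      by (simp add: distrib_right flip: fps_const_add)
    also have "e + of_nat j * e = of_nat (Suc j) * e"
      by (simp add: algebra_simps)
    finally show ?case by simp
  qed simp
  \<comment> \<open>By \<open>pow\<close>, E^j (x \<Psi>) consists of x E^j \<Psi> and j e E^(j - 1)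
    \<Psi>. After a shift of j the second sum is the negative of the first, because e * e =
    1.\<close>
  have S0: "S (fps_const fps_X * \<Psi>) m = 0" for \<Psi> m
  proof (cases m)
    case 0
    then show ?thesis by (simp add: S_def)
  next
    case (Suc n)
    have "S (fps_const fps_X * \<Psi>) m = (\<Sum>j\<le>Suc n. (- e) ^ j / fact j * (fps_X * (E ^^ j) \<Psi> $ 0) $ (Suc n - j))
        + (\<Sum>j\<le>Suc n. (- e) ^ j / fact j * (if j = 0 then 0 else of_nat j * e * (E ^^ (j - 1)) \<Psi> $ 0 $ (Suc n - j)))"
      unfolding S_def Suc sum.distrib[symmetric]
      by (intro sum.cong refl) (simp add: pow distrib_left del: funpow.simps)
    also have "(\<Sum>j\<le>Suc n. (- e) ^ j / fact j * (fps_X * (E ^^ j) \<Psi> $ 0) $ (Suc n - j))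
        = (\<Sum>j\<le>n. (- e) ^ j / fact j * (E ^^ j) \<Psi> $ 0 $ (n - j))"
      by simp
    also have "(\<Sum>j\<le>Suc n. (- e) ^ j / fact j * (if j = 0 then 0 else of_nat j * e * (E ^^ (j - 1)) \<Psi> $ 0 $ (Suc n - j)))
        = (\<Sum>j\<le>n. (- e) ^ Suc j / fact (Suc j) * (of_nat (Suc j) * e * (E ^^ j) \<Psi> $ 0 $ (n - j)))"
      by (subst sum.atMost_Suc_shift) simp
    also have "\<dots> = (\<Sum>j\<le>n. - ((- e) ^ j / fact j * (E ^^ j) \<Psi> $ 0 $ (n - j)))"
    proof (intro sum.cong refl)
      fix j
      have "(- e) ^ Suc j / fact (Suc j) * (of_nat (Suc j) * e * c) = - (e * e) * ((- e) ^ j / fact j * c)" for c :: real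
        by (simp del: of_nat_Suc)
      then show "(- e) ^ Suc j / fact (Suc j) * (of_nat (Suc j) * e * (E ^^ j) \<Psi> $ 0 $ (n - j))
          = - ((- e) ^ j / fact j * (E ^^ j) \<Psi> $ 0 $ (n - j))"
        by (simp only: e)
    qed
    finally show ?thesis by (simp add: sum_negf)
  qed
  \<comment> \<open>\<open>\<H>\<close> and y agree at x = 0 by \<open>H0\<close>, so y - \<H> is x
    times a series.\<close>
  define \<Psi> where "\<Psi> = Abs_fps (\<lambda>j. - fps_shift 1 (\<H> $ j - fps_X $ j))"
  have "fps_X = \<H> + fps_const fps_X * \<Psi>"
  proof (intro fps_ext)
    fix j i
    show "fps_X $ j $ i = (\<H> + fps_const fps_X * \<Psi>) $ j $ i"
      using H0[of j] by (cases i) (auto simp: \<Psi>_def)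
  qed
  then have "S fps_X m = S \<H> m + S (fps_const fps_X * \<Psi>) m"
    unfolding S_def sum.distrib[symmetric]
    by (metis (no_types, lifting) vfield_funpow_add fps_add_nth distrib_left)
  also have "S \<H> m = \<H> $ 0 $ m"
  proof -
    have "(E ^^ Suc j) \<H> = 0" for j
      by (simp add: funpow_swap1 H)
    then have "(- e) ^ j / fact j * (E ^^ j) \<H> $ 0 $ (m - j) = (if j = 0 then \<H> $ 0 $ m else 0)" for j
      by (cases j) auto
    then show ?thesis by (simp add: S_def)
  qed
  finally have "S fps_X m = \<H> $ 0 $ m" by (simp only: S0 add_0_right)
  then show ?thesis by (simp add: S_def)
qed

end

section \<open>Bell polynomials as coefficients of powers\<close>

lemma finite_exponents:
  assumes "finite S"
  shows "finite {b. b \<in> S \<rightarrow>\<^sub>E (UNIV :: nat set) \<and> sum b S = r}"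
proof (rule finite_subset)
  show "{b. b \<in> S \<rightarrow>\<^sub>E (UNIV :: nat set) \<and> sum b S = r} \<subseteq> S \<rightarrow>\<^sub>E {..r}"
    using assms by (auto simp: PiE_iff extensional_def intro: member_le_sum)
qed (use assms in \<open>auto intro: finite_PiE\<close>)

text \<open>The map \<open>c\<close> carries the multinomial coefficients from the reals into the
  ring; for power series it is \<open>fps_const\<close>. Exponent vectors are extensional functions,
  to match \<open>bell_index\<close>.\<close>

lemma multinomial_theorem:
  fixes z :: "'i \<Rightarrow> 'a::comm_ring_1" and c :: "real \<Rightarrow> 'a"
  assumes "finite S" and c1: "c 1 = 1" and cmult: "\<And>a b. c (a * b) = c a * c b" and cnat: "\<And>n. c (of_nat n) = of_nat n"
  shows "(\<Sum>j\<in>S. z j) ^ q = (\<Sum>b | b \<in> S \<rightarrow>\<^sub>E UNIV \<and> sum b S = q.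
    c (fact q / (\<Prod>j\<in>S. fact (b j))) * (\<Prod>j\<in>S. z j ^ b j))"
  using \<open>finite S\<close>
proof (induction S arbitrary: q rule: finite_induct)
  case empty
  have "{b. b \<in> {} \<rightarrow>\<^sub>E (UNIV :: nat set) \<and> sum b ({} :: 'i set) = q} = (if q = 0 then {\<lambda>_. undefined} else {})"
    by auto
  then show ?case by (cases q) (simp_all add: c1)
next
  case (insert a S)
  let ?B = "\<lambda>S q. {b. b \<in> S \<rightarrow>\<^sub>E (UNIV :: nat set) \<and> sum b S = q}"

  have "(\<Sum>j\<in>insert a S. z j) ^ q = (\<Sum>k\<le>q. of_nat (q choose k) * z a ^ k * (\<Sum>j\<in>S. z j) ^ (q - k))"
    using insert.hyps by (simp add: binomial_ring)
  also have "\<dots> = (\<Sum>k\<le>q. \<Sum>b\<in>?B S (q - k). of_nat (q choose k) * z a ^ k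
      * (c (fact (q - k) / (\<Prod>j\<in>S. fact (b j))) * (\<Prod>j\<in>S. z j ^ b j)))"
    by (simp only: insert.IH sum_distrib_left)
  also have "\<dots> = (\<Sum>(k, b)\<in>(SIGMA k:{..q}. ?B S (q - k)). of_nat (q choose k) * z a ^ k
      * (c (fact (q - k) / (\<Prod>j\<in>S. fact (b j))) * (\<Prod>j\<in>S. z j ^ b j)))"
    using insert.hyps by (intro sum.Sigma) (auto intro: finite_exponents)
  also have "\<dots> = (\<Sum>b\<in>?B (insert a S) q. c (fact q / (\<Prod>j\<in>insert a S. fact (b j))) * (\<Prod>j\<in>insert a S. z j ^ b j))"
  proof (rule sum.reindex_bij_witness[where i = "\<lambda>b. (b a, restrict b S)" and j = "\<lambda>(k, b). b(a := k)"], goal_cases)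
    case (1 u)
    then show ?case using insert.hyps by (auto simp: fun_eq_iff restrict_def PiE_def extensional_def)
  next
    case (2 u)
    have "sum (b(a := k)) S = sum b S" for b and k :: nat
      using insert.hyps by (intro sum.cong) auto
    then show ?case using 2 insert.hyps by (auto simp: PiE_iff extensional_def)
  next
    case (3 u)
    then show ?case using insert.hyps by (auto simp: fun_eq_iff restrict_def PiE_def extensional_def)
  next
    case (4 u)
    then show ?case using insert.hyps by (auto simp: PiE_iff)
  next
    case (5 u)
    then obtain k b where u: "u = (k, b)" "k \<le> q" by auto
    have eq: "(b(a := k)) j = b j" if "j \<in> S" for j
      using that insert.hyps by auto
    have "c (fact q / (\<Prod>j\<in>insert a S. fact ((b(a := k)) j)))
        = c (of_nat (q choose k) * (fact (q - k) / (\<Prod>j\<in>S. fact (b j))))"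
      using insert.hyps u(2) eq by (intro arg_cong[where f = c]) (simp add: binomial_fact cong: prod.cong)
    also have "\<dots> = of_nat (q choose k) * c (fact (q - k) / (\<Prod>j\<in>S. fact (b j)))"
      by (simp only: cmult cnat)
    finally show ?case
      using insert.hyps eq by (simp add: u mult_ac cong: prod.cong)
  qed
  finally show ?case .
qed

lemma fps_power_nth_cong:
  fixes A B :: "'a::comm_ring_1 fps"
  assumes "\<And>i. i \<le> n \<Longrightarrow> A $ i = B $ i" and "i \<le> n"
  shows "(A ^ q) $ i = (B ^ q) $ i"
  using assms(2)
proof (induction q arbitrary: i)
  case (Suc q)
  then show ?case
    using assms(1) by (simp add: fps_mult_nth)
qed simp

text \<open>Without constant term, the q-th power of the series is X^q times the q-th power of the
  shifted series, so its coefficient at p involves \<open>x 1\<close>, ...,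
  \<open>x (p - q + 1)\<close> only. The series may thus be truncated to a polynomial, and the
  multinomial theorem sorts the terms of its power by degree.\<close>

lemma ordinary_bell_eq:
  assumes "1 \<le> q" "q \<le> p"
  shows "ordinary_bell p q x = (Abs_fps (\<lambda>j. if j = 0 then 0 else x j) ^ q) $ p"
proof -
  define N where "N = p - q + 1"
  define V where "V = Abs_fps (\<lambda>j. if j = 0 then 0 else x j)"
  define V' where "V' = (\<Sum>j\<in>{1..N}. fps_const (x j) * fps_X ^ j)"
  have V'_nth: "V' $ i = (if i \<in> {1..N} then x i else 0)" for i
    by (simp add: V'_def fps_sum_nth fps_X_power_nth if_distrib[of "(*) _"] cong: if_cong)
  have "V = fps_X * fps_shift 1 V" "V' = fps_X * fps_shift 1 V'"
    by (rule fps_ext, simp add: V_def V'_nth)+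
  then have "V ^ q = fps_X ^ q * fps_shift 1 V ^ q" "V' ^ q = fps_X ^ q * fps_shift 1 V' ^ q"
    by (metis power_mult_distrib)+
  moreover have "(fps_shift 1 V ^ q) $ (p - q) = (fps_shift 1 V' ^ q) $ (p - q)"
    by (rule fps_power_nth_cong[where n = "p - q"]) (auto simp: V_def V'_nth N_def)
  ultimately have "(V ^ q) $ p = (V' ^ q) $ p"
    using assms by (simp add: fps_X_power_mult_nth)
  also have "V' ^ q = (\<Sum>b | b \<in> {1..N} \<rightarrow>\<^sub>E UNIV \<and> sum b {1..N} = q.
      fps_const (fact q / (\<Prod>j\<in>{1..N}. fact (b j))) * (\<Prod>j\<in>{1..N}. (fps_const (x j) * fps_X ^ j) ^ b j))"
    unfolding V'_def by (rule multinomial_theorem) (auto simp: fps_of_nat)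
  also have "\<dots> $ p = (\<Sum>b | b \<in> {1..N} \<rightarrow>\<^sub>E UNIV \<and> sum b {1..N} = q.
      if (\<Sum>j\<in>{1..N}. j * b j) = p then fact q / (\<Prod>j\<in>{1..N}. fact (b j)) * (\<Prod>j\<in>{1..N}. x j ^ b j) else 0)"
    unfolding fps_sum_nth
  proof (intro sum.cong refl)
    fix b :: "nat \<Rightarrow> nat"
    have "(\<Prod>j\<in>{1..N}. (fps_const (x j) * fps_X ^ j) ^ b j)
        = fps_const (\<Prod>j\<in>{1..N}. x j ^ b j) * fps_X ^ (\<Sum>j\<in>{1..N}. j * b j)"
      by (induction N) (simp_all add: power_mult_distrib power_mult power_add mult_ac flip: fps_const_mult fps_const_power)
    then show "(fps_const (fact q / (\<Prod>j\<in>{1..N}. fact (b j))) * (\<Prod>j\<in>{1..N}. (fps_const (x j) * fps_X ^ j) ^ b j)) $ p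
        = (if (\<Sum>j\<in>{1..N}. j * b j) = p then fact q / (\<Prod>j\<in>{1..N}. fact (b j)) * (\<Prod>j\<in>{1..N}. x j ^ b j) else 0)"
      by (simp add: fps_X_power_nth)
  qed
  also have "\<dots> = (\<Sum>b\<in>bell_index p q. fact q / (\<Prod>j\<in>{1..N}. fact (b j)) * (\<Prod>j\<in>{1..N}. x j ^ b j))"
  proof (rule sum.mono_neutral_cong_right)
    show "finite {b. b \<in> {1..N} \<rightarrow>\<^sub>E UNIV \<and> sum b {1..N} = q}"
      by (rule finite_exponents) simp
  qed (auto simp: bell_index_def N_def)
  finally show ?thesis
    by (simp add: ordinary_bell_def N_def V_def)
qed

lemma bell_eq:
  assumes "1 \<le> q" "q \<le> p"
  shows "bell p q x = fact p / fact q * (Abs_fps (\<lambda>j. if j = 0 then 0 else x j / fact j) ^ q) $ p"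
  unfolding ordinary_bell_eq[OF assms, symmetric]
  by (simp add: bell_def ordinary_bell_def sum_distrib_left)

section \<open>Convergent power series in two variables\<close>

lemma fps_coeff_bound:
  fixes A :: "real fps"
  assumes "fps_conv_radius A > 0"
  obtains M R where "M > 0" "R > 0" "\<And>i. \<bar>A $ i\<bar> \<le> M * R ^ i"
proof -
  obtain r where r: "0 < ereal r" "ereal r < fps_conv_radius A"
    using ereal_dense2[OF assms] by auto
  then have "summable (\<lambda>i. norm (A $ i * r ^ i))"
    using norm_summable_fps[of r A] by simp
  then have "Bseq (\<lambda>i. A $ i * r ^ i)"
    by (intro convergent_imp_Bseq convergentI[where L = 0] summable_LIMSEQ_zero) (rule summable_norm_cancel)
  then obtain M where M: "M > 0" "\<And>i. norm (A $ i * r ^ i) \<le> M"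
    by (auto elim: BseqE)
  have "\<bar>A $ i\<bar> \<le> M * (1 / r) ^ i" for i
    using M(2)[of i] r(1) by (simp add: abs_mult field_simps)
  then show ?thesis using that[of M "1 / r"] M(1) r(1) by simp
qed

lemma fps_conv_radius_ge_of_bound:
  fixes A :: "real fps"
  assumes "\<And>i. \<bar>A $ i\<bar> \<le> M * R ^ i" "R > 0"
  shows "fps_conv_radius A \<ge> ereal (1 / R)"
  unfolding fps_conv_radius_def
proof (rule conv_radius_geI_ex')
  fix r :: real assume r: "0 < r" "ereal r < ereal (1 / R)"
  then have "r * R < 1" using assms(2) by (simp add: field_simps)
  then have "summable (\<lambda>i. M * (r * R) ^ i)"
    using r assms(2) by (intro summable_mult summable_geometric) simp
  then show "summable (\<lambda>i. A $ i * of_real r ^ i)"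
  proof (rule summable_comparison_test'[where N = 0])
    fix i
    have "\<bar>A $ i\<bar> * r ^ i \<le> M * R ^ i * r ^ i"
      using r by (intro mult_right_mono assms(1)) auto
    then show "norm (A $ i * of_real r ^ i) \<le> M * (r * R) ^ i"
      using r by (simp add: abs_mult power_mult_distrib mult_ac)
  qed
qed

lemma eval_fps_bound:
  fixes A :: "real fps"
  assumes "\<And>i. \<bar>A $ i\<bar> \<le> M * R ^ i" "R > 0" "\<bar>x\<bar> * R \<le> 1 / 2"
  shows "\<bar>eval_fps A x\<bar> \<le> 2 * M"
proof -
  have M: "M \<ge> 0" using assms(1)[of 0] by simp
  have le: "norm (A $ i * x ^ i) \<le> M * (1 / 2) ^ i" for i
  proof -
    have "\<bar>A $ i\<bar> * \<bar>x\<bar> ^ i \<le> M * R ^ i * \<bar>x\<bar> ^ i"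
      by (intro mult_right_mono assms(1)) auto
    also have "\<dots> = M * (\<bar>x\<bar> * R) ^ i" by (simp add: power_mult_distrib)
    also have "\<dots> \<le> M * (1 / 2) ^ i"
      using assms(2,3) M by (intro mult_left_mono power_mono) auto
    finally show ?thesis by (simp add: abs_mult power_abs)
  qed
  have s: "(\<lambda>i. M * (1 / 2) ^ i) sums (2 * M)"
    using sums_mult[OF geometric_sums[of "1/2 :: real"], of M] by (simp add: mult.commute)
  show ?thesis
    using norm_suminf_le[OF le sums_summable[OF s]] sums_unique[OF s] by (simp add: eval_fps_def)
qed

text \<open>Convergence near the origin is encoded as a geometric bound on the coefficients, a
  condition that sums, products, inverses and derivatives preserve by estimates on coefficients
  alone.\<close>

definition fps2_conv :: "real fps fps \<Rightarrow> bool"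
  where "fps2_conv F \<longleftrightarrow> (\<exists>M R. R > 0 \<and> (\<forall>i j. \<bar>F $ j $ i\<bar> \<le> M * R ^ (i + j)))"

text \<open>The rate R may be enlarged beyond any prescribed \<open>R0\<close>; the majorant for the
  first integral needs it to be at least 1.\<close>

lemma fps2_convE:
  assumes "fps2_conv F"
  obtains M R where "M > 0" "R \<ge> R0" "R > 0" "\<And>i j. \<bar>F $ j $ i\<bar> \<le> M * R ^ (i + j)"
proof -
  obtain M R where MR: "R > 0" "\<And>i j. \<bar>F $ j $ i\<bar> \<le> M * R ^ (i + j)"
    using assms unfolding fps2_conv_def by blast
  have "\<bar>F $ j $ i\<bar> \<le> (\<bar>M\<bar> + 1) * (max R R0) ^ (i + j)" for i j
    by (rule order.trans[OF MR(2)]) (use MR(1) in \<open>intro mult_mono power_mono; simp\<close>)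
  then show ?thesis
    using that[of "\<bar>M\<bar> + 1" "max R R0"] MR(1) by simp
qed

definition fps_eval_inner :: "real fps fps \<Rightarrow> real \<Rightarrow> real fps"
  where "fps_eval_inner F x = Abs_fps (\<lambda>j. eval_fps (F $ j) x)"

text \<open>An iterated sum, inner variable first, so that one-variable results on
  \<open>eval_fps\<close> apply twice. Its agreement with the unordered double sum is
  \<open>eval_fps2_has_sum\<close>.\<close>

definition eval_fps2 :: "real fps fps \<Rightarrow> real \<Rightarrow> real \<Rightarrow> real"
  where "eval_fps2 F x y = eval_fps (fps_eval_inner F x) y"

lemma fps_eval_inner_nth [simp]: "fps_eval_inner F x $ j = eval_fps (F $ j) x"
  by (simp add: fps_eval_inner_def)

lemma fps_conv_radius_inner:
  assumes "\<And>i j. \<bar>F $ j $ i\<bar> \<le> M * R ^ (i + j)" "R > (0::real)" "\<bar>x\<bar> * R < 1"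
  shows "ereal (norm x) < fps_conv_radius (F $ j)"
proof -
  have "\<bar>F $ j $ i\<bar> \<le> (M * R ^ j) * R ^ i" for i
    using assms(1)[of j i] by (simp add: power_add mult_ac)
  then have "fps_conv_radius (F $ j) \<ge> ereal (1 / R)"
    using assms(2) by (rule fps_conv_radius_ge_of_bound)
  moreover have "ereal (norm x) < ereal (1 / R)" using assms(2,3) by (simp add: field_simps)
  ultimately show ?thesis by order
qed

lemma fps_conv_radius_eval_inner:
  assumes "\<And>i j. \<bar>F $ j $ i\<bar> \<le> M * R ^ (i + j)" "R > (0::real)" "\<bar>x\<bar> * R \<le> 1 / 2"
  shows "fps_conv_radius (fps_eval_inner F x) \<ge> ereal (1 / R)"
proof (rule fps_conv_radius_ge_of_bound[OF _ assms(2)])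
  fix j
  have "\<bar>F $ j $ i\<bar> \<le> (M * R ^ j) * R ^ i" for i
    using assms(1)[of j i] by (simp add: power_add mult_ac)
  from eval_fps_bound[OF this assms(2,3)]
  show "\<bar>fps_eval_inner F x $ j\<bar> \<le> (2 * M) * R ^ j" by (simp add: mult_ac)
qed

lemma fps2_conv_radius:
  assumes "fps2_conv F"
  obtains r where "r > 0" "\<And>x j. \<bar>x\<bar> < r \<Longrightarrow> ereal (norm x) < fps_conv_radius (F $ j)"
    "\<And>x y. \<bar>x\<bar> < r \<Longrightarrow> \<bar>y\<bar> < r \<Longrightarrow> ereal (norm y) < fps_conv_radius (fps_eval_inner F x)"
proof -
  obtain M R where MR: "M > 0" "R > 0" "\<And>i j. \<bar>F $ j $ i\<bar> \<le> M * R ^ (i + j)"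
    using fps2_convE[OF assms] by metis
  show ?thesis
  proof (rule that[of "1 / (2 * R)"])
    show "1 / (2 * R) > 0" using MR by simp
  next
    fix x :: real and j assume "\<bar>x\<bar> < 1 / (2 * R)"
    then show "ereal (norm x) < fps_conv_radius (F $ j)"
      using MR(2) by (intro fps_conv_radius_inner[OF MR(3,2)]) (simp add: field_simps)
  next
    fix x y :: real assume x: "\<bar>x\<bar> < 1 / (2 * R)" and y: "\<bar>y\<bar> < 1 / (2 * R)"
    have "fps_conv_radius (fps_eval_inner F x) \<ge> ereal (1 / R)"
      using MR(2) x by (intro fps_conv_radius_eval_inner[OF MR(3,2)]) (simp add: field_simps)
    moreover have "ereal (norm y) < ereal (1 / R)"
      using y MR(2) by (simp add: field_simps)
    ultimately show "ereal (norm y) < fps_conv_radius (fps_eval_inner F x)" by order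
  qed
qed

definition has_fps2 :: "(real \<Rightarrow> real \<Rightarrow> real) \<Rightarrow> real fps fps \<Rightarrow> bool" (infixl "has'_fps2" 60)
  where "h has_fps2 F \<longleftrightarrow> fps2_conv F \<and> (\<exists>r>0. \<forall>x y. \<bar>x\<bar> < r \<longrightarrow> \<bar>y\<bar> < r \<longrightarrow> h x y = eval_fps2 F x y)"

lemma has_fps2_eval: "fps2_conv F \<Longrightarrow> eval_fps2 F has_fps2 F"
  by (auto simp: has_fps2_def intro: exI[of _ 1])

lemma has_fps2_cong:
  assumes "h has_fps2 F" "r > 0" "\<And>x y. \<bar>x\<bar> < r \<Longrightarrow> \<bar>y\<bar> < r \<Longrightarrow> h' x y = h x y"
  shows "h' has_fps2 F"
proof -
  obtain s where "s > 0" "\<And>x y. \<bar>x\<bar> < s \<Longrightarrow> \<bar>y\<bar> < s \<Longrightarrow> h x y = eval_fps2 F x y"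
    using assms(1) by (auto simp: has_fps2_def)
  then show ?thesis
    using assms unfolding has_fps2_def by (intro conjI exI[of _ "min r s"]) auto
qed

lemma geometric2_summable:
  assumes "0 \<le> a" "a < 1" "0 \<le> b" "b < (1::real)"
  shows "(\<lambda>(i, j). a ^ i * b ^ j) summable_on (UNIV :: (nat \<times> nat) set)"
proof -
  have geo: "((\<lambda>i. c ^ i) has_sum (1 / (1 - c))) UNIV" if "0 \<le> c" "c < 1" for c :: real
    using that by (intro sums_nonneg_imp_has_sum geometric_sums) auto
  have "(\<lambda>(i, j). a ^ i * b ^ j) summable_on (UNIV \<times> UNIV :: (nat \<times> nat) set)"
  proof (rule summable_on_SigmaI)
    fix i
    show "((\<lambda>j. case (i, j) of (i, j) \<Rightarrow> a ^ i * b ^ j) has_sum a ^ i * (1 / (1 - b))) UNIV"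
      using has_sum_cmult_right[OF geo[OF assms(3,4)], of "a ^ i"] by simp
  next
    show "(\<lambda>i. a ^ i * (1 / (1 - b))) summable_on UNIV"
      using has_sum_cmult_left[OF geo[OF assms(1,2)], of "1 / (1 - b)"] by (auto simp: summable_on_def)
  qed (use assms in auto)
  then show ?thesis by simp
qed

lemma fps2_term_bound:
  assumes MR: "\<And>i j. \<bar>F $ j $ i\<bar> \<le> M * R ^ (i + j)" "R > (0::real)" and x: "\<bar>x\<bar> * R \<le> 1 / 2" and y: "\<bar>y\<bar> * R \<le> 1 / 2"
  shows "norm (F $ j $ i * x ^ i * y ^ j) \<le> M * ((1 / 2) ^ i * (1 / 2) ^ j)"
proof -
  have M: "M \<ge> 0" using MR(1)[of 0 0] by simp
  have "norm (F $ j $ i * x ^ i * y ^ j) = \<bar>F $ j $ i\<bar> * (\<bar>x\<bar> ^ i * \<bar>y\<bar> ^ j)"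
    by (simp add: abs_mult power_abs)
  also have "\<dots> \<le> M * R ^ (i + j) * (\<bar>x\<bar> ^ i * \<bar>y\<bar> ^ j)"
    by (intro mult_right_mono MR) auto
  also have "\<dots> = M * ((\<bar>x\<bar> * R) ^ i * (\<bar>y\<bar> * R) ^ j)"
    by (simp add: power_mult_distrib power_add)
  also have "\<dots> \<le> M * ((1 / 2) ^ i * (1 / 2) ^ j)"
    using x y MR(2) M by (intro mult_left_mono mult_mono power_mono) auto
  finally show ?thesis .
qed

text \<open>Domination by a geometric double series gives summability over the pairs of indices, and
  then the sum may be taken row by row.\<close>

lemma eval_fps2_has_sum:
  assumes MR: "\<And>i j. \<bar>F $ j $ i\<bar> \<le> M * R ^ (i + j)" "R > (0::real)" and x: "\<bar>x\<bar> * R \<le> 1 / 2" and y: "\<bar>y\<bar> * R \<le> 1 / 2"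
  shows "((\<lambda>(i, j). F $ j $ i * x ^ i * y ^ j) has_sum eval_fps2 F x y) UNIV"
proof -
  have bd: "norm (F $ j $ i * x ^ i * y ^ j) \<le> M * ((1 / 2) ^ i * (1 / 2) ^ j)" for i j
    by (rule fps2_term_bound[OF MR x y])
  have summ: "(\<lambda>(j, i). F $ j $ i * x ^ i * y ^ j) summable_on (UNIV \<times> UNIV)"
  proof -
    have "(\<lambda>p. M * (case p of (j, i) \<Rightarrow> (1 / 2) ^ i * (1 / 2) ^ j)) summable_on (UNIV :: (nat \<times> nat) set)"
      using geometric2_summable[of "1/2" "1/2"]
      by (intro summable_on_cmult_right) (simp add: mult.commute case_prod_unfold)
    then have "(\<lambda>p. norm (case p of (j, i) \<Rightarrow> F $ j $ i * x ^ i * y ^ j)) summable_on UNIV"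
      by (rule Infinite_Sum.abs_summable_on_comparison_test') (use bd in auto)
    then show ?thesis by (simp add: abs_summable_summable)
  qed
  have c1: "((\<lambda>i. A $ i * z ^ i) has_sum eval_fps A z) UNIV" if "ereal (norm z) < fps_conv_radius A" for A :: "real fps" and z
    using that by (intro norm_summable_imp_has_sum norm_summable_fps sums_eval_fps)
  have "\<bar>x\<bar> * R < 1" using x by simp
  note rad1 = fps_conv_radius_inner[OF MR this]
  have "ereal (norm y) < ereal (1 / R)" using y MR(2) by (simp add: field_simps)
  then have rad2: "ereal (norm y) < fps_conv_radius (fps_eval_inner F x)"
    using fps_conv_radius_eval_inner[OF MR x] by order
  have "((\<lambda>(j, i). F $ j $ i * x ^ i * y ^ j) has_sum eval_fps2 F x y) (UNIV \<times> UNIV)"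
  proof (rule has_sum_SigmaI)
    fix j
    show "((\<lambda>i. case (j, i) of (j, i) \<Rightarrow> F $ j $ i * x ^ i * y ^ j) has_sum eval_fps (F $ j) x * y ^ j) UNIV"
      using has_sum_cmult_left[OF c1[OF rad1]] by simp
  next
    show "((\<lambda>j. eval_fps (F $ j) x * y ^ j) has_sum eval_fps2 F x y) UNIV"
      using c1[OF rad2] by (simp add: eval_fps2_def)
  qed (use summ in auto)
  then have "((\<lambda>(i, j). (case (j, i) of (j, i) \<Rightarrow> F $ j $ i * x ^ i * y ^ j)) has_sum eval_fps2 F x y) (UNIV \<times> UNIV)"
    by (subst has_sum_swap) simp
  then show ?thesis by simp
qed

lemma fps2_conv_scale:
  assumes "fps2_conv F"
  obtains M r where "r > 0" "\<And>i j x y. \<bar>x\<bar> < r \<Longrightarrow> \<bar>y\<bar> < r \<Longrightarrow> norm (F $ j $ i * x ^ i * y ^ j) \<le> M * ((1 / 2) ^ i * (1 / 2) ^ j)"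
    "\<And>x y. \<bar>x\<bar> < r \<Longrightarrow> \<bar>y\<bar> < r \<Longrightarrow> ((\<lambda>(i, j). F $ j $ i * x ^ i * y ^ j) has_sum eval_fps2 F x y) UNIV"
proof -
  obtain M R where MR: "M > 0" "R > 0" "\<And>i j. \<bar>F $ j $ i\<bar> \<le> M * R ^ (i + j)"
    using fps2_convE[OF assms] by metis
  have *: "\<bar>x\<bar> * R \<le> 1 / 2" if "\<bar>x\<bar> < 1 / (2 * R)" for x
    using that MR(2) by (simp add: field_simps)
  show ?thesis
  proof (rule that[of "1 / (2 * R)" M])
    show "1 / (2 * R) > 0" using MR(2) by simp
  qed (use fps2_term_bound[OF MR(3,2) * *] eval_fps2_has_sum[OF MR(3,2) * *] in blast)+
qed

lemma fps2_conv_has_sum: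
  assumes "fps2_conv F"
  shows "\<exists>r>0. \<forall>x y. \<bar>x\<bar> < r \<longrightarrow> \<bar>y\<bar> < r \<longrightarrow>
    ((\<lambda>(i, j). F $ j $ i * x ^ i * y ^ j) has_sum eval_fps2 F x y) UNIV"
proof (rule fps2_conv_scale[OF assms], goal_cases)
  case (1 M r)
  then show ?case by (intro exI[of _ r]) simp
qed

text \<open>Links expansions to the unordered sums in \<open>real_analytic2_on\<close>. For the
  converse direction, summability at a single point off the axes already forces the geometric bound
  on the coefficients.\<close>

lemma has_fps2_iff_has_sum:
  "h has_fps2 F \<longleftrightarrow> (\<exists>r>0. \<forall>x y. \<bar>x\<bar> < r \<longrightarrow> \<bar>y\<bar> < r \<longrightarrow>
     ((\<lambda>(i, j). F $ j $ i * x ^ i * y ^ j) has_sum h x y) UNIV)"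
proof
  assume h: "h has_fps2 F"
  then obtain s where s: "s > 0" "\<And>x y. \<bar>x\<bar> < s \<Longrightarrow> \<bar>y\<bar> < s \<Longrightarrow> h x y = eval_fps2 F x y"
    by (auto simp: has_fps2_def)
  have "fps2_conv F" using h by (simp add: has_fps2_def)
  then have "\<exists>r>0. \<forall>x y. \<bar>x\<bar> < r \<longrightarrow> \<bar>y\<bar> < r \<longrightarrow>
      ((\<lambda>(i, j). F $ j $ i * x ^ i * y ^ j) has_sum eval_fps2 F x y) UNIV"
    by (rule fps2_conv_has_sum)
  then obtain r where r: "r > 0" "\<forall>x y. \<bar>x\<bar> < r \<longrightarrow> \<bar>y\<bar> < r \<longrightarrow> ((\<lambda>(i, j). F $ j $ i * x ^ i * y ^ j) has_sum eval_fps2 F x y) UNIV"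
    by (elim exE conjE) (rule that)
  show "\<exists>r>0. \<forall>x y. \<bar>x\<bar> < r \<longrightarrow> \<bar>y\<bar> < r \<longrightarrow>
     ((\<lambda>(i, j). F $ j $ i * x ^ i * y ^ j) has_sum h x y) UNIV"
  proof (intro exI[of _ "min r s"] conjI allI impI)
    fix x y assume "\<bar>x\<bar> < min r s" "\<bar>y\<bar> < min r s"
    then show "((\<lambda>(i, j). F $ j $ i * x ^ i * y ^ j) has_sum h x y) UNIV"
      using r(2)[rule_format, of x y] s(2)[of x y] by simp
  qed (use r(1) s(1) in simp)
next
  assume "\<exists>r>0. \<forall>x y. \<bar>x\<bar> < r \<longrightarrow> \<bar>y\<bar> < r \<longrightarrow>
     ((\<lambda>(i, j). F $ j $ i * x ^ i * y ^ j) has_sum h x y) UNIV"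
  then obtain r where r: "r > 0" "\<And>x y. \<bar>x\<bar> < r \<Longrightarrow> \<bar>y\<bar> < r \<Longrightarrow>
     ((\<lambda>(i, j). F $ j $ i * x ^ i * y ^ j) has_sum h x y) UNIV" by blast
  \<comment> \<open>A summable real family is absolutely summable, so each term at (q, q) is at most
    the total M in absolute value; dividing by q^(i + j) gives the rate 1 / q.\<close>
  define q where "q = r / 2"
  have q: "q > 0" "\<bar>q\<bar> < r" using r(1) by (auto simp: q_def)
  have "(\<lambda>(i, j). F $ j $ i * q ^ i * q ^ j) summable_on UNIV"
    using r(2)[OF q(2,2)] by (auto simp: summable_on_def)
  then have abs: "(\<lambda>p. \<bar>case p of (i, j) \<Rightarrow> F $ j $ i * q ^ i * q ^ j\<bar>) summable_on UNIV"
    using summable_on_iff_abs_summable_on_real[THEN iffD1] by fastforce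
  define M where "M = (\<Sum>\<^sub>\<infinity>p. \<bar>case p of (i, j) \<Rightarrow> F $ j $ i * q ^ i * q ^ j\<bar>)"
  have "\<bar>F $ j $ i\<bar> \<le> M * (1 / q) ^ (i + j)" for i j
  proof -
    have "(\<Sum>p\<in>{(i, j)}. \<bar>case p of (i, j) \<Rightarrow> F $ j $ i * q ^ i * q ^ j\<bar>) \<le> M"
      unfolding M_def by (rule finite_sum_le_infsum) (use abs in auto)
    then show ?thesis using q(1) by (simp add: abs_mult field_simps power_add)
  qed
  then have conv: "fps2_conv F"
    unfolding fps2_conv_def using q(1) by (intro exI[of _ M] exI[of _ "1 / q"]) simp
  obtain s where s: "s > 0" "\<forall>x y. \<bar>x\<bar> < s \<longrightarrow> \<bar>y\<bar> < s \<longrightarrow> ((\<lambda>(i, j). F $ j $ i * x ^ i * y ^ j) has_sum eval_fps2 F x y) UNIV"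
    using fps2_conv_has_sum[OF conv] by (elim exE conjE) (rule that)
  show "h has_fps2 F"
    unfolding has_fps2_def
  proof (intro conjI conv exI[of _ "min r s"] allI impI)
    fix x y assume "\<bar>x\<bar> < min r s" "\<bar>y\<bar> < min r s"
    then show "h x y = eval_fps2 F x y"
      using has_sum_unique[OF r(2)[of x y] s(2)[rule_format, of x y]] by simp
  qed (use r(1) s(1) in simp)
qed

lemma real_analytic2_on_iff:
  "real_analytic2_on h S \<longleftrightarrow> (\<forall>(a, b)\<in>S. \<exists>F. (\<lambda>x y. h (a + x) (b + y)) has_fps2 F)"
proof -
  have "(\<exists>F :: real fps fps. P (\<lambda>i j. F $ j $ i)) \<longleftrightarrow> (\<exists>c. P c)" for P
  proof
    assume "\<exists>c. P c"
    then obtain c where "P c" by blast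
    then have "P (\<lambda>i j. Abs_fps (\<lambda>j. Abs_fps (\<lambda>i. c i j)) $ j $ i)" by simp
    then show "\<exists>F :: real fps fps. P (\<lambda>i j. F $ j $ i)" by blast
  qed blast
  from this[of "\<lambda>c. \<exists>r>0. \<forall>x y. \<bar>x\<bar> < r \<longrightarrow> \<bar>y\<bar> < r \<longrightarrow>
     ((\<lambda>(i, j). c i j * x ^ i * y ^ j) has_sum h (a + x) (b + y)) UNIV" for a b]
  show ?thesis unfolding real_analytic2_on_def has_fps2_iff_has_sum by (simp only:)
qed

section \<open>Algebra of convergent double power series\<close>

lemma fps2_convI: "R > 0 \<Longrightarrow> (\<And>i j. \<bar>F $ j $ i\<bar> \<le> M * R ^ (i + j)) \<Longrightarrow> fps2_conv F"
  by (auto simp: fps2_conv_def)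

lemma fps2_conv_common:
  assumes "fps2_conv F" "fps2_conv G"
  obtains M R where "M > 0" "R > 0" "\<And>i j. \<bar>F $ j $ i\<bar> \<le> M * R ^ (i + j)" "\<And>i j. \<bar>G $ j $ i\<bar> \<le> M * R ^ (i + j)"
proof -
  obtain M1 R1 where 1: "M1 > 0" "R1 > 0" "\<And>i j. \<bar>F $ j $ i\<bar> \<le> M1 * R1 ^ (i + j)"
    using fps2_convE[OF assms(1)] by metis
  obtain M2 R2 where 2: "M2 > 0" "R2 > 0" "\<And>i j. \<bar>G $ j $ i\<bar> \<le> M2 * R2 ^ (i + j)"
    using fps2_convE[OF assms(2)] by metis
  show ?thesis
  proof (rule that[of "max M1 M2" "max R1 R2"])
    fix i j
    show "\<bar>F $ j $ i\<bar> \<le> max M1 M2 * max R1 R2 ^ (i + j)"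
      by (rule order.trans[OF 1(3)]) (use 1 2 in \<open>intro mult_mono power_mono; simp\<close>)
    show "\<bar>G $ j $ i\<bar> \<le> max M1 M2 * max R1 R2 ^ (i + j)"
      by (rule order.trans[OF 2(3)]) (use 1 2 in \<open>intro mult_mono power_mono; simp\<close>)
  qed (use 1 2 in auto)
qed

lemma fps2_conv_add:
  assumes "fps2_conv F" "fps2_conv G"
  shows "fps2_conv (F + G)"
proof -
  obtain M R where MR: "M > 0" "R > 0" "\<And>i j. \<bar>F $ j $ i\<bar> \<le> M * R ^ (i + j)" "\<And>i j. \<bar>G $ j $ i\<bar> \<le> M * R ^ (i + j)"
    using fps2_conv_common[OF assms] by metis
  show ?thesis
  proof (rule fps2_convI[OF MR(2), where M = "2 * M"])
    fix i j
    show "\<bar>(F + G) $ j $ i\<bar> \<le> 2 * M * R ^ (i + j)"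
      using MR(3)[of j i] MR(4)[of j i] by simp
  qed
qed

lemma Suc_le_2_power: "real (Suc n) \<le> 2 ^ n"
  by (induction n) (simp_all add: algebra_simps)

text \<open>The coefficient is a sum of (i + 1) (j + 1) products, each at most M * M * R^(i + j);
  doubling the rate absorbs the number of terms.\<close>

lemma fps2_conv_mult:
  assumes "fps2_conv F" "fps2_conv G"
  shows "fps2_conv (F * G)"
proof -
  obtain M R where MR: "M > 0" "R > 0" "\<And>i j. \<bar>F $ j $ i\<bar> \<le> M * R ^ (i + j)" "\<And>i j. \<bar>G $ j $ i\<bar> \<le> M * R ^ (i + j)"
    using fps2_conv_common[OF assms] by metis
  show ?thesis
  proof (rule fps2_convI[where R = "2 * R" and M = "M * M"])
    fix i j
    have "\<bar>(F * G) $ j $ i\<bar> \<le> (\<Sum>b=0..j. \<Sum>a=0..i. \<bar>F $ b $ a * G $ (j - b) $ (i - a)\<bar>)"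
      unfolding fps_mult_nth fps_sum_nth by (intro order.trans[OF sum_abs] sum_mono order.refl)
    also have "\<dots> \<le> (\<Sum>b=0..j. \<Sum>a=0..i. M * M * R ^ (i + j))"
    proof (intro sum_mono)
      fix a b assume ab: "b \<in> {0..j}" "a \<in> {0..i}"
      have "\<bar>F $ b $ a * G $ (j - b) $ (i - a)\<bar> \<le> (M * R ^ (a + b)) * (M * R ^ ((i - a) + (j - b)))"
        unfolding abs_mult by (intro mult_mono MR) (use MR in auto)
      also have "\<dots> = M * M * R ^ ((a + b) + ((i - a) + (j - b)))" by (simp add: power_add)
      also have "(a + b) + ((i - a) + (j - b)) = i + j" using ab by simp
      finally show "\<bar>F $ b $ a * G $ (j - b) $ (i - a)\<bar> \<le> M * M * R ^ (i + j)" .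
    qed
    also have "\<dots> = M * M * R ^ (i + j) * (real (Suc j) * real (Suc i))" by simp
    also have "\<dots> \<le> M * M * R ^ (i + j) * (2 ^ j * 2 ^ i)"
      by (intro mult_left_mono mult_mono Suc_le_2_power) (use MR in auto)
    also have "\<dots> = M * M * (2 * R) ^ (i + j)" by (simp add: power_mult_distrib power_add)
    finally show "\<bar>(F * G) $ j $ i\<bar> \<le> M * M * (2 * R) ^ (i + j)" .
  qed (use MR in simp)
qed

text \<open>Induction on the total degree. The equation for a coefficient of \<open>F * D\<close> is
  solved for \<open>D $ j $ i\<close>, which carries the nonzero constant term c of \<open>F\<close>
  as factor; the remaining terms are controlled by allowing \<open>D\<close> a growth rate S much
  larger than the rate R of \<open>F\<close>.\<close>

lemma fps2_conv_inverse:
  assumes "fps2_conv F" and FD: "F * D = 1"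
  shows "fps2_conv D"
proof -
  obtain M R where MR: "M > 0" "R > 0" "\<And>i j. \<bar>F $ j $ i\<bar> \<le> M * R ^ (i + j)"
    using fps2_convE[OF assms(1)] by metis
  define c where "c = F $ 0 $ 0"
  define d where "d = D $ 0 $ 0"
  have "(F * D) $ 0 $ 0 = c * d" by (simp add: c_def d_def)
  then have cd: "c * d = 1" using FD by simp
  then have c0: "\<bar>c\<bar> > 0" by auto
  \<comment> \<open>For q \<le> 1/2 one has 1 / (1 - q)^2 - 1 \<le> 6 q, which bounds the sum of q^a
    q^b over (a, b) \<noteq> (0, 0). The second bound on q makes M times this at most |c|.\<close>
  define q where "q = min (1/2) (\<bar>c\<bar> / (6 * M))"
  have q: "0 < q" "q \<le> 1/2" "6 * M * q \<le> \<bar>c\<bar>"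
    using c0 MR(1) by (auto simp: q_def min_def field_simps)
  define S where "S = R / q"
  have S: "S > 0" "R = q * S" using q MR(2) by (auto simp: S_def)
  have geo: "(\<Sum>a=0..n. q ^ a) \<le> 1 / (1 - q)" for n
  proof -
    have "(\<Sum>a=0..n. q ^ a) \<le> (\<Sum>a. q ^ a)"
      by (rule sum_le_suminf) (use q in \<open>auto intro: summable_geometric\<close>)
    then show ?thesis using q by (simp add: suminf_geometric)
  qed
  have bound: "\<forall>i j. i + j = n \<longrightarrow> \<bar>D $ j $ i\<bar> \<le> \<bar>d\<bar> * S ^ n" for n
  proof (induction n rule: less_induct)
    case (less n)
    show ?case
    proof (intro allI impI)
      fix i j assume ij: "i + j = n"
      show "\<bar>D $ j $ i\<bar> \<le> \<bar>d\<bar> * S ^ n"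
      proof (cases "n = 0")
        case True
        then show ?thesis using ij by (simp add: d_def)
      next
        case False
        let ?t = "\<lambda>(b, a). F $ b $ a * D $ (j - b) $ (i - a)"
        let ?I = "{0..j} \<times> {0..i}"
        have "(F * D) $ j $ i = 0" unfolding FD using ij False by auto
        then have "(\<Sum>p\<in>?I. ?t p) = 0"
          by (simp add: fps_mult_nth fps_sum_nth sum.cartesian_product)
        then have "c * D $ j $ i = - (\<Sum>p\<in>?I - {(0, 0)}. ?t p)"
          by (subst (asm) sum.remove[of _ "(0, 0)"]) (auto simp: c_def)
        then have "\<bar>c\<bar> * \<bar>D $ j $ i\<bar> \<le> (\<Sum>p\<in>?I - {(0, 0)}. \<bar>?t p\<bar>)"
          by (simp only: abs_mult[symmetric] abs_minus_cancel sum_abs)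
        also have "\<dots> \<le> (\<Sum>p\<in>?I - {(0, 0)}. M * \<bar>d\<bar> * S ^ n * (case p of (b, a) \<Rightarrow> q ^ b * q ^ a))"
        proof (rule sum_mono)
          fix p assume p: "p \<in> ?I - {(0, 0)}"
          then obtain a b where ab: "p = (b, a)" "a \<le> i" "b \<le> j" "a + b > 0" by (cases p) auto
          have "\<bar>D $ (j - b) $ (i - a)\<bar> \<le> \<bar>d\<bar> * S ^ ((i - a) + (j - b))"
            using less[of "(i - a) + (j - b)"] ab ij by auto
          then have "\<bar>?t p\<bar> \<le> (M * R ^ (a + b)) * (\<bar>d\<bar> * S ^ ((i - a) + (j - b)))"
            unfolding ab abs_mult prod.case by (intro mult_mono MR) (use MR in auto)
          also have "\<dots> = M * \<bar>d\<bar> * S ^ ((a + b) + ((i - a) + (j - b))) * (q ^ b * q ^ a)"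
            by (simp add: S(2) power_mult_distrib power_add mult_ac)
          also have "(a + b) + ((i - a) + (j - b)) = n" using ab ij by simp
          finally show "\<bar>?t p\<bar> \<le> M * \<bar>d\<bar> * S ^ n * (case p of (b, a) \<Rightarrow> q ^ b * q ^ a)"
            by (simp add: ab)
        qed
        also have "\<dots> = M * \<bar>d\<bar> * S ^ n * (\<Sum>p\<in>?I - {(0, 0)}. (case p of (b, a) \<Rightarrow> q ^ b * q ^ a))"
          by (simp add: sum_distrib_left)
        also have "(\<Sum>p\<in>?I - {(0, 0)}. (case p of (b, a) \<Rightarrow> q ^ b * q ^ a))
            = (\<Sum>b=0..j. q ^ b) * (\<Sum>a=0..i. q ^ a) - 1"
          by (simp add: sum_diff1 sum_product sum.cartesian_product)
        also have "\<dots> \<le> (1 / (1 - q)) * (1 / (1 - q)) - 1"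
          by (intro diff_right_mono mult_mono geo sum_nonneg) (use q in auto)
        also have "\<dots> \<le> 6 * q"
        proof -
          \<comment> \<open>This product equals (1 + 6 q) (1 - q)^2 - 1.\<close>
          have "0 \<le> q * (1 - 2 * q) * (4 - 3 * q)" using q by (intro mult_nonneg_nonneg) auto
          then have "1 \<le> (1 + 6 * q) * ((1 - q) * (1 - q))" by (simp add: algebra_simps)
          moreover have "(1 - q) * (1 - q) > 0" using q by simp
          ultimately have "1 / ((1 - q) * (1 - q)) \<le> 1 + 6 * q" by (simp only: divide_le_eq if_True)
          then show ?thesis by simp
        qed
        finally have "\<bar>c\<bar> * \<bar>D $ j $ i\<bar> \<le> M * \<bar>d\<bar> * S ^ n * (6 * q)"
          using MR(1) S(1) by (simp add: mult_left_mono)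
        also have "\<dots> = (6 * M * q) * (\<bar>d\<bar> * S ^ n)" by simp
        also have "\<dots> \<le> \<bar>c\<bar> * (\<bar>d\<bar> * S ^ n)"
          using q(3) S(1) by (intro mult_right_mono) auto
        finally show ?thesis using c0 by (simp only: mult_le_cancel_left_pos)
      qed
    qed
  qed
  show ?thesis
    using bound by (intro fps2_convI[OF S(1)]) auto
qed

lemma fps2_conv_const: "fps_conv_radius A > 0 \<Longrightarrow> fps2_conv (fps_const A)"
proof -
  assume "fps_conv_radius A > 0"
  then obtain M R where MR: "M > 0" "R > 0" "\<And>i. \<bar>A $ i\<bar> \<le> M * R ^ i"
    using fps_coeff_bound by blast
  show ?thesis by (rule fps2_convI[OF MR(2), of _ M]) (use MR in auto)
qed

lemma fps2_conv_X: "fps2_conv fps_X"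
  by (rule fps2_convI[of 1 _ 1]) (auto simp: fps_X_nth)

lemma fps2_conv_shift:
  assumes "fps2_conv F" shows "fps2_conv (fps_shift n F)"
proof -
  obtain M R where MR: "M > 0" "R > 0" "\<And>i j. \<bar>F $ j $ i\<bar> \<le> M * R ^ (i + j)"
    using fps2_convE[OF assms] by metis
  show ?thesis
  proof (rule fps2_convI[OF MR(2), of _ "M * R ^ n"])
    fix i j show "\<bar>fps_shift n F $ j $ i\<bar> \<le> M * R ^ n * R ^ (i + j)"
      using MR(3)[of "j + n" i] by (simp add: power_add mult_ac)
  qed
qed

text \<open>Exchanging the variables transfers statements about the outer variable to the inner
  one.\<close>

definition fps2_swap :: "real fps fps \<Rightarrow> real fps fps"
  where "fps2_swap F = Abs_fps (\<lambda>j. Abs_fps (\<lambda>i. F $ i $ j))"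

lemma fps2_swap_nth [simp]: "fps2_swap F $ j $ i = F $ i $ j"
  by (simp add: fps2_swap_def)

lemma fps2_conv_swap: "fps2_conv F \<Longrightarrow> fps2_conv (fps2_swap F)"
  by (metis (no_types, lifting) fps2_conv_def add.commute fps2_swap_nth)

lemma fps2_conv_deriv:
  assumes "fps2_conv F" shows "fps2_conv (fps_deriv F)"
proof -
  obtain M R where MR: "M > 0" "R > 0" "\<And>i j. \<bar>F $ j $ i\<bar> \<le> M * R ^ (i + j)"
    using fps2_convE[OF assms] by metis
  show ?thesis
  proof (rule fps2_convI[of "2 * R" _ "M * R"])
    fix i j
    have "\<bar>fps_deriv F $ j $ i\<bar> = real (Suc j) * \<bar>F $ Suc j $ i\<bar>"
      by (simp add: abs_mult fps_mult_of_nat_nth del: of_nat_Suc)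
    also have "\<dots> \<le> 2 ^ (i + j) * (M * R ^ (i + Suc j))"
    proof (intro mult_mono MR)
      show "real (Suc j) \<le> 2 ^ (i + j)"
        by (rule order.trans[OF Suc_le_2_power]) simp
    qed auto
    also have "\<dots> = M * R * (2 * R) ^ (i + j)" by (simp add: power_mult_distrib)
    finally show "\<bar>fps_deriv F $ j $ i\<bar> \<le> M * R * (2 * R) ^ (i + j)" .
  qed (use MR in simp)
qed

lemma has_fps2_swap:
  assumes "h has_fps2 F" shows "(\<lambda>x y. h y x) has_fps2 fps2_swap F"
proof -
  obtain r where r: "r > 0" "\<And>x y. \<bar>x\<bar> < r \<Longrightarrow> \<bar>y\<bar> < r \<Longrightarrow>
     ((\<lambda>(i, j). F $ j $ i * x ^ i * y ^ j) has_sum h x y) UNIV"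
    using assms unfolding has_fps2_iff_has_sum by blast
  show ?thesis
    unfolding has_fps2_iff_has_sum
  proof (intro exI[of _ r] conjI r allI impI)
    fix x y assume "\<bar>x\<bar> < r" "\<bar>y\<bar> < r"
    then have "((\<lambda>(i, j). F $ j $ i * y ^ i * x ^ j) has_sum h y x) (UNIV \<times> UNIV)"
      using r(2) by simp
    then show "((\<lambda>(i, j). fps2_swap F $ j $ i * x ^ i * y ^ j) has_sum h y x) UNIV"
      by (subst (asm) has_sum_swap) (simp add: mult_ac case_prod_unfold)
  qed
qed

lemma has_fps2_add:
  assumes "h has_fps2 F" "k has_fps2 G"
  shows "(\<lambda>x y. h x y + k x y) has_fps2 (F + G)"
proof -
  have conv: "fps2_conv F" "fps2_conv G" using assms by (auto simp: has_fps2_def)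
  have *: "(\<lambda>x y. eval_fps2 F x y + eval_fps2 G x y) has_fps2 (F + G)"
  proof -
    obtain r where r: "r > 0" "\<And>x j. \<bar>x\<bar> < r \<Longrightarrow> ereal (norm x) < fps_conv_radius (F $ j)"
      "\<And>x y. \<bar>x\<bar> < r \<Longrightarrow> \<bar>y\<bar> < r \<Longrightarrow> ereal (norm y) < fps_conv_radius (fps_eval_inner F x)"
      using fps2_conv_radius[OF conv(1)] by blast
    obtain s where s: "s > 0" "\<And>x j. \<bar>x\<bar> < s \<Longrightarrow> ereal (norm x) < fps_conv_radius (G $ j)"
      "\<And>x y. \<bar>x\<bar> < s \<Longrightarrow> \<bar>y\<bar> < s \<Longrightarrow> ereal (norm y) < fps_conv_radius (fps_eval_inner G x)"
      using fps2_conv_radius[OF conv(2)] by blast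
    show ?thesis unfolding has_fps2_def
    proof (intro conjI fps2_conv_add conv exI[of _ "min r s"] allI impI)
      fix x y assume xy: "\<bar>x\<bar> < min r s" "\<bar>y\<bar> < min r s"
      have "fps_eval_inner (F + G) x = fps_eval_inner F x + fps_eval_inner G x"
        using xy r(2) s(2) by (intro fps_ext) (simp add: eval_fps_add)
      then show "eval_fps2 F x y + eval_fps2 G x y = eval_fps2 (F + G) x y"
        using xy r(3)[of x y] s(3)[of x y] by (simp add: eval_fps2_def eval_fps_add)
    qed (use r s in simp)
  qed
  obtain r s where "r > 0" "\<And>x y. \<bar>x\<bar> < r \<Longrightarrow> \<bar>y\<bar> < r \<Longrightarrow> h x y = eval_fps2 F x y"
    "s > 0" "\<And>x y. \<bar>x\<bar> < s \<Longrightarrow> \<bar>y\<bar> < s \<Longrightarrow> k x y = eval_fps2 G x y"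
    using assms by (auto simp: has_fps2_def)
  then show ?thesis
    by (intro has_fps2_cong[OF *, of "min r s"]) auto
qed

lemma has_fps2_mult:
  assumes "h has_fps2 F" "k has_fps2 G"
  shows "(\<lambda>x y. h x y * k x y) has_fps2 (F * G)"
proof -
  have conv: "fps2_conv F" "fps2_conv G" using assms by (auto simp: has_fps2_def)
  have *: "(\<lambda>x y. eval_fps2 F x y * eval_fps2 G x y) has_fps2 (F * G)"
  proof -
    obtain r where r: "r > 0" "\<And>x j. \<bar>x\<bar> < r \<Longrightarrow> ereal (norm x) < fps_conv_radius (F $ j)"
      "\<And>x y. \<bar>x\<bar> < r \<Longrightarrow> \<bar>y\<bar> < r \<Longrightarrow> ereal (norm y) < fps_conv_radius (fps_eval_inner F x)"
      using fps2_conv_radius[OF conv(1)] by blast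
    obtain s where s: "s > 0" "\<And>x j. \<bar>x\<bar> < s \<Longrightarrow> ereal (norm x) < fps_conv_radius (G $ j)"
      "\<And>x y. \<bar>x\<bar> < s \<Longrightarrow> \<bar>y\<bar> < s \<Longrightarrow> ereal (norm y) < fps_conv_radius (fps_eval_inner G x)"
      using fps2_conv_radius[OF conv(2)] by blast
    show ?thesis unfolding has_fps2_def
    proof (intro conjI fps2_conv_mult conv exI[of _ "min r s"] allI impI)
      fix x y assume xy: "\<bar>x\<bar> < min r s" "\<bar>y\<bar> < min r s"
      have prod: "ereal (norm x) < fps_conv_radius (F $ b * G $ c)" "eval_fps (F $ b * G $ c) x = eval_fps (F $ b) x * eval_fps (G $ c) x" for b c
        using xy r(2)[of x b] s(2)[of x c] fps_conv_radius_mult[of "F $ b" "G $ c"]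
        by (auto simp: eval_fps_mult min_def split: if_splits)
      have "ereal (norm x) < fps_conv_radius (\<Sum>b\<in>B. F $ b * G $ (n - b)) \<and>
          eval_fps (\<Sum>b\<in>B. F $ b * G $ (n - b)) x = (\<Sum>b\<in>B. eval_fps (F $ b) x * eval_fps (G $ (n - b)) x)"
        if "finite B" for B n
        using that
      proof (induction B rule: finite_induct)
        case (insert b B)
        then show ?case
          using prod[of b "n - b"] fps_conv_radius_add[of "F $ b * G $ (n - b)" "\<Sum>b\<in>B. F $ b * G $ (n - b)"]
          by (auto simp: eval_fps_add min_def split: if_splits)
      qed auto
      then have "fps_eval_inner (F * G) x = fps_eval_inner F x * fps_eval_inner G x"
        by (intro fps_ext) (simp add: fps_mult_nth)
      then show "eval_fps2 F x y * eval_fps2 G x y = eval_fps2 (F * G) x y"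
        using xy r(3)[of x y] s(3)[of x y] by (simp add: eval_fps2_def eval_fps_mult)
    qed (use r s in simp)
  qed
  obtain r s where "r > 0" "\<And>x y. \<bar>x\<bar> < r \<Longrightarrow> \<bar>y\<bar> < r \<Longrightarrow> h x y = eval_fps2 F x y"
    "s > 0" "\<And>x y. \<bar>x\<bar> < s \<Longrightarrow> \<bar>y\<bar> < s \<Longrightarrow> k x y = eval_fps2 G x y"
    using assms by (auto simp: has_fps2_def)
  then show ?thesis
    by (intro has_fps2_cong[OF *, of "min r s"]) auto
qed

lemma has_fps2_inner:
  assumes "f has_fps_expansion A" shows "(\<lambda>x y. f x) has_fps2 fps_const A"
proof -
  have "eventually (\<lambda>x. eval_fps A x = f x) (nhds 0)" using assms by (simp add: has_fps_expansion_def)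
  then obtain r where r: "r > 0" "\<And>x. \<bar>x\<bar> < r \<Longrightarrow> eval_fps A x = f x"
    unfolding eventually_nhds_metric by (auto simp: dist_norm)
  have eq: "fps_eval_inner (fps_const A) x = fps_const (eval_fps A x)" for x
    by (rule fps_ext) simp
  show ?thesis unfolding has_fps2_def
    using assms r by (intro conjI exI[of _ r] fps2_conv_const) (auto simp: has_fps_expansion_def eval_fps2_def eq)
qed

lemma has_fps2_const: "(\<lambda>x y. c) has_fps2 fps_const (fps_const c)"
  by (rule has_fps2_inner) simp

lemma has_fps2_outer:
  assumes "f has_fps_expansion A" shows "\<exists>F. (\<lambda>x y. f y) has_fps2 F"
  using has_fps2_swap[OF has_fps2_inner[OF assms]] by blast

lemma has_fps2_cmult:
  "h has_fps2 F \<Longrightarrow> (\<lambda>x y. c * h x y) has_fps2 (fps_const (fps_const c) * F)"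
  by (intro has_fps2_mult has_fps2_const)

lemma has_fps2_unique:
  assumes "h has_fps2 F" "k has_fps2 F"
  shows "\<exists>r>0. \<forall>x y. \<bar>x\<bar> < r \<longrightarrow> \<bar>y\<bar> < r \<longrightarrow> h x y = k x y"
proof -
  obtain r s where rs: "r > 0" "\<forall>x y. \<bar>x\<bar> < r \<longrightarrow> \<bar>y\<bar> < r \<longrightarrow> h x y = eval_fps2 F x y"
    "s > 0" "\<forall>x y. \<bar>x\<bar> < s \<longrightarrow> \<bar>y\<bar> < s \<longrightarrow> k x y = eval_fps2 F x y"
    using assms unfolding has_fps2_def by blast
  then show ?thesis by (intro exI[of _ "min r s"]) simp
qed

section \<open>Slices, derivatives and continuity of two-variable expansions\<close>

lemma fps2_conv_imp_inner:
  assumes "fps2_conv F"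
  shows "eval_fps (F $ j) has_fps_expansion F $ j"
proof -
  obtain r where "r > 0" "\<And>x j. \<bar>x\<bar> < r \<Longrightarrow> ereal (norm x) < fps_conv_radius (F $ j)"
    "\<And>x y. \<bar>x\<bar> < r \<Longrightarrow> \<bar>y\<bar> < r \<Longrightarrow> ereal (norm y) < fps_conv_radius (fps_eval_inner F x)"
    using fps2_conv_radius[OF assms] by metis
  from this(2)[of 0 j] this(1) show ?thesis
    by (simp add: has_fps_expansion_def zero_ereal_def)
qed

lemma has_fps2_slice:
  assumes "h has_fps2 F"
  shows "\<exists>r>0. \<forall>x. \<bar>x\<bar> < r \<longrightarrow> h x has_fps_expansion fps_eval_inner F x"
proof -
  have conv: "fps2_conv F" using assms by (simp add: has_fps2_def)
  obtain r where r: "r > 0" "\<And>x y. \<bar>x\<bar> < r \<Longrightarrow> \<bar>y\<bar> < r \<Longrightarrow> ereal (norm y) < fps_conv_radius (fps_eval_inner F x)"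
    using fps2_conv_radius[OF conv] by metis
  obtain s where s: "s > 0" "\<And>x y. \<bar>x\<bar> < s \<Longrightarrow> \<bar>y\<bar> < s \<Longrightarrow> h x y = eval_fps2 F x y"
    using assms by (auto simp: has_fps2_def)
  have "h x has_fps_expansion fps_eval_inner F x" if x: "\<bar>x\<bar> < min r s" for x
    unfolding has_fps_expansion_def
  proof
    show "fps_conv_radius (fps_eval_inner F x) > 0"
      using r(2)[of x 0] x r(1) by (simp add: zero_ereal_def)
    show "eventually (\<lambda>y. eval_fps (fps_eval_inner F x) y = h x y) (nhds 0)"
      unfolding eventually_nhds_metric using s x by (intro exI[of _ s]) (simp add: dist_norm eval_fps2_def)
  qed
  then show ?thesis using r s by (intro exI[of _ "min r s"]) simp
qed

lemma eval_fps2_at_0: "eval_fps2 F x 0 = eval_fps (F $ 0) x"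
  by (simp add: eval_fps2_def eval_fps_at_0)

lemma has_fps2_slice_0:
  assumes "h has_fps2 F"
  shows "(\<lambda>x. h x 0) has_fps_expansion F $ 0"
proof -
  have conv: "fps2_conv F" using assms by (simp add: has_fps2_def)
  obtain s where s: "s > 0" "\<And>x y. \<bar>x\<bar> < s \<Longrightarrow> \<bar>y\<bar> < s \<Longrightarrow> h x y = eval_fps2 F x y"
    using assms by (auto simp: has_fps2_def)
  have "eventually (\<lambda>x. eval_fps (F $ 0) x = h x 0) (nhds 0)"
    unfolding eventually_nhds_metric using s by (intro exI[of _ s]) (simp add: dist_norm eval_fps2_at_0)
  then show ?thesis
    using fps2_conv_imp_inner[OF conv, of 0] by (simp add: has_fps_expansion_def)
qed

lemma has_fps_expansion_higher_deriv:
  fixes f :: "real \<Rightarrow> real"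
  assumes "f has_fps_expansion A"
  shows "(deriv ^^ n) f has_fps_expansion (fps_deriv ^^ n) A"
  by (induction n) (auto intro: assms has_fps_expansion_deriv)

lemma has_fps_expansion_imp_nth_0:
  fixes f :: "real \<Rightarrow> real"
  assumes "f has_fps_expansion A" shows "f 0 = A $ 0"
  using assms by (auto simp: has_fps_expansion_def eval_fps_at_0 dest: eventually_nhds_x_imp_x)

lemma has_fps_expansion_higher_deriv_0:
  fixes f :: "real \<Rightarrow> real"
  assumes "f has_fps_expansion A"
  shows "(deriv ^^ n) f 0 = fact n * A $ n"
  using has_fps_expansion_imp_nth_0[OF has_fps_expansion_higher_deriv[OF assms]]
  by (simp add: fps_0th_higher_deriv)

lemma has_fps_expansion_cong_real:
  fixes f g :: "real \<Rightarrow> real"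
  assumes "f has_fps_expansion A" "eventually (\<lambda>x. f x = g x) (nhds 0)"
  shows "g has_fps_expansion A"
proof -
  have "eventually (\<lambda>x. eval_fps A x = f x) (nhds 0)" using assms(1) by (simp add: has_fps_expansion_def)
  then have "eventually (\<lambda>x. eval_fps A x = g x) (nhds 0)"
    using assms(2) by eventually_elim simp
  then show ?thesis using assms(1) by (simp add: has_fps_expansion_def)
qed

text \<open>\<open>pd\<close> differentiates in y before x. At fixed x the slice expansion gives the
  y-derivative at 0 as n! times the value of the n-th outer coefficient, a function of x that can
  then be differentiated as a one-variable series.\<close>

lemma has_fps2_pd:
  assumes "h has_fps2 F"
  shows "(\<lambda>x. pd m n h x 0) has_fps_expansion (fps_deriv ^^ m) (fps_const (fact n) * F $ n)"
proof -
  have conv: "fps2_conv F" using assms by (simp add: has_fps2_def)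
  obtain r where r: "r > 0" "\<forall>x. \<bar>x\<bar> < r \<longrightarrow> h x has_fps_expansion fps_eval_inner F x"
    using has_fps2_slice[OF assms] by blast
  have "eventually (\<lambda>x. fact n * eval_fps (F $ n) x = (deriv ^^ n) (h x) 0) (nhds 0)"
    unfolding eventually_nhds_metric
  proof (intro exI[of _ r] conjI r(1) allI impI)
    fix x :: real assume "dist x 0 < r"
    then have "h x has_fps_expansion fps_eval_inner F x" using r(2) by simp
    from has_fps_expansion_higher_deriv_0[OF this]
    show "fact n * eval_fps (F $ n) x = (deriv ^^ n) (h x) 0" by simp
  qed
  from has_fps_expansion_cong_real[OF has_fps_expansion_cmult_left[OF fps2_conv_imp_inner[OF conv]] this]
  have *: "(\<lambda>x. (deriv ^^ n) (h x) 0) has_fps_expansion fps_const (fact n) * F $ n" .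
  show "(\<lambda>x. pd m n h x 0) has_fps_expansion (fps_deriv ^^ m) (fps_const (fact n) * F $ n)"
    using has_fps_expansion_higher_deriv[OF *, of m] by (simp add: pd_def)
qed

lemma has_fps2_X: "(\<lambda>x y. y) has_fps2 fps_X"
proof -
  have "fps_eval_inner fps_X x = fps_X" for x
    by (rule fps_ext) simp
  then show ?thesis
    unfolding has_fps2_def by (auto simp: eval_fps2_def fps2_conv_X intro: exI[of _ 1])
qed

text \<open>The inverse series exists formally because the outer constant term \<open>F $ 0\<close>
  is a unit of the ring of power series in x; its convergence is
  \<open>fps2_conv_inverse\<close>.\<close>

lemma has_fps2_inverse:
  assumes "h has_fps2 F" "F $ 0 $ 0 \<noteq> 0"
  obtains D where "F * D = 1" "(\<lambda>x y. inverse (h x y)) has_fps2 D"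
proof -
  define D where "D = fps_right_inverse F (inverse (F $ 0))"
  have D: "F * D = 1"
    unfolding D_def by (rule fps_right_inverse) (rule inverse_mult_eq_1'[OF assms(2)])
  have conv: "fps2_conv D" using assms(1) fps2_conv_inverse[OF _ D] by (simp add: has_fps2_def)
  have "(\<lambda>x y. h x y * eval_fps2 D x y) has_fps2 1"
    using has_fps2_mult[OF assms(1) has_fps2_eval[OF conv]] D by simp
  moreover have "(\<lambda>x y. 1) has_fps2 1"
    using has_fps2_const[of 1] by simp
  ultimately obtain r where r: "r > 0" "\<forall>x y. \<bar>x\<bar> < r \<longrightarrow> \<bar>y\<bar> < r \<longrightarrow> h x y * eval_fps2 D x y = 1"
    using has_fps2_unique by blast
  have "(\<lambda>x y. inverse (h x y)) has_fps2 D"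
    by (rule has_fps2_cong[OF has_fps2_eval[OF conv] r(1)]) (use r(2) in \<open>simp add: inverse_unique\<close>)
  with D show ?thesis by (rule that)
qed

lemma fps_outer_split: "fps_const (F $ 0) + fps_X * fps_shift 1 F = (F :: 'a::comm_ring_1 fps)"
proof (rule fps_ext)
  fix n show "(fps_const (F $ 0) + fps_X * fps_shift 1 F) $ n = F $ n" by (cases n) simp_all
qed

text \<open>Extracts the factor y from h(x, y) - h(x, 0); this is how the quotient g acquires its
  expansion.\<close>

lemma has_fps2_split:
  assumes "h has_fps2 F"
  shows "\<exists>r>0. \<forall>x y. \<bar>x\<bar> < r \<longrightarrow> \<bar>y\<bar> < r \<longrightarrow> h x y = h x 0 + y * eval_fps2 (fps_shift 1 F) x y"
proof -
  have conv: "fps2_conv (fps_shift 1 F)" using assms fps2_conv_shift by (simp add: has_fps2_def)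
  have "(\<lambda>x y. h x 0 + y * eval_fps2 (fps_shift 1 F) x y) has_fps2 (fps_const (F $ 0) + fps_X * fps_shift 1 F)"
    by (intro has_fps2_add has_fps2_inner has_fps2_slice_0 assms has_fps2_mult has_fps2_X has_fps2_eval conv)
  then show ?thesis
    unfolding fps_outer_split by (rule has_fps2_unique[OF assms])
qed

text \<open>The finite partial sums converge uniformly on a box by the Weierstrass test.\<close>

lemma has_fps2_continuous:
  assumes "h has_fps2 F"
  shows "\<exists>r>0. continuous_on ({-r<..<r} \<times> {-r<..<r}) (\<lambda>p. h (fst p) (snd p))"
proof -
  have conv: "fps2_conv F" using assms by (simp add: has_fps2_def)
  obtain s where s: "s > 0" "\<And>x y. \<bar>x\<bar> < s \<Longrightarrow> \<bar>y\<bar> < s \<Longrightarrow> h x y = eval_fps2 F x y"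
    using assms by (auto simp: has_fps2_def)
  show ?thesis
  proof (rule fps2_conv_scale[OF conv], goal_cases)
    case (1 M r)
    define B where "B = {-min r s<..<min r s} \<times> {-min r s<..<min r s}"
    have B: "\<bar>fst p\<bar> < r" "\<bar>snd p\<bar> < r" "\<bar>fst p\<bar> < s" "\<bar>snd p\<bar> < s" if "p \<in> B" for p
      using that by (auto simp: B_def)
    have "uniform_limit B (\<lambda>I p. \<Sum>q\<in>I. (case q of (i, j) \<Rightarrow> F $ j $ i * fst p ^ i * snd p ^ j))
        (\<lambda>p. eval_fps2 F (fst p) (snd p)) (finite_subsets_at_top UNIV)"
    proof (rule Weierstrass_m_test_general'[where M = "\<lambda>q. M * (case q of (i, j) \<Rightarrow> (1 / 2) ^ i * (1 / 2) ^ j)"])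
      fix q :: "nat \<times> nat" and p assume "p \<in> B"
      then show "norm (case q of (i, j) \<Rightarrow> F $ j $ i * fst p ^ i * snd p ^ j)
          \<le> M * (case q of (i, j) \<Rightarrow> (1 / 2) ^ i * (1 / 2) ^ j)"
        using 1(2) B by (auto split: prod.splits simp del: norm_mult real_norm_def)
    next
      fix p assume "p \<in> B"
      then show "((\<lambda>q. case q of (i, j) \<Rightarrow> F $ j $ i * fst p ^ i * snd p ^ j) has_sum eval_fps2 F (fst p) (snd p)) UNIV"
        using 1(3) B by simp
    next
      show "(\<lambda>q. M * (case q of (i, j) \<Rightarrow> (1 / 2) ^ i * (1 / 2) ^ j)) summable_on (UNIV :: (nat \<times> nat) set)"
        by (intro summable_on_cmult_right geometric2_summable) auto
    qed
    moreover have "\<forall>\<^sub>F I in finite_subsets_at_top UNIV.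
        continuous_on B (\<lambda>p. \<Sum>q\<in>I. (case q of (i, j) \<Rightarrow> F $ j $ i * fst p ^ i * snd p ^ j))"
      by (intro always_eventually allI continuous_on_sum) (auto split: prod.splits intro!: continuous_intros)
    ultimately have "continuous_on B (\<lambda>p. eval_fps2 F (fst p) (snd p))"
      by (intro uniform_limit_theorem[where F = "finite_subsets_at_top UNIV"]) auto
    then have "continuous_on B (\<lambda>p. h (fst p) (snd p))"
      using s B by (subst continuous_on_cong[OF refl]) auto
    then show ?case
      using 1 s by (intro exI[of _ "min r s"]) (simp add: B_def)
  qed
qed

lemma has_fps2_partial_outer:
  assumes "h has_fps2 F"
  shows "\<exists>r>0. \<forall>x y. \<bar>x\<bar> < r \<longrightarrow> \<bar>y\<bar> < r \<longrightarrow> (h x has_real_derivative eval_fps2 (fps_deriv F) x y) (at y)"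
proof -
  have conv: "fps2_conv F" using assms by (simp add: has_fps2_def)
  obtain r where r: "r > 0" "\<And>x j. \<bar>x\<bar> < r \<Longrightarrow> ereal (norm x) < fps_conv_radius (F $ j)"
    "\<And>x y. \<bar>x\<bar> < r \<Longrightarrow> \<bar>y\<bar> < r \<Longrightarrow> ereal (norm y) < fps_conv_radius (fps_eval_inner F x)"
    using fps2_conv_radius[OF conv] by metis
  obtain s where s: "s > 0" "\<And>x y. \<bar>x\<bar> < s \<Longrightarrow> \<bar>y\<bar> < s \<Longrightarrow> h x y = eval_fps2 F x y"
    using assms by (auto simp: has_fps2_def)
  show ?thesis
  proof (intro exI[of _ "min r s"] conjI allI impI)
    fix x y assume x: "\<bar>x\<bar> < min r s" and y: "\<bar>y\<bar> < min r s"
    have "fps_eval_inner (fps_deriv F) x = fps_deriv (fps_eval_inner F x)"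
    proof (rule fps_ext)
      fix j
      have "eval_fps (fps_const (of_nat (Suc j)) * F $ Suc j) x = of_nat (Suc j) * eval_fps (F $ Suc j) x"
        using r(2)[of x "Suc j"] x by (subst eval_fps_mult) (auto simp del: of_nat_Suc)
      then show "fps_eval_inner (fps_deriv F) x $ j = fps_deriv (fps_eval_inner F x) $ j"
        by (simp add: fps_of_nat del: of_nat_Suc)
    qed
    then have "(eval_fps (fps_eval_inner F x) has_real_derivative eval_fps2 (fps_deriv F) x y) (at y)"
      using has_field_derivative_eval_fps[of y "fps_eval_inner F x" UNIV] r(3)[of x y] x y by (simp add: eval_fps2_def)
    then show "(h x has_real_derivative eval_fps2 (fps_deriv F) x y) (at y)"
    proof (rule has_field_derivative_transform_within_open)
      show "open {-s<..<s}" "y \<in> {-s<..<s}" using y by auto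
    qed (use s x in \<open>auto simp: eval_fps2_def\<close>)
  qed (use r s in simp)
qed

lemma fps_deriv_inner_swap: "fps_deriv_inner F = fps2_swap (fps_deriv (fps2_swap F))"
  by (intro fps_ext) (simp add: fps_mult_of_nat_nth flip: fps_of_nat)

lemma fps2_conv_deriv_inner: "fps2_conv F \<Longrightarrow> fps2_conv (fps_deriv_inner F)"
  unfolding fps_deriv_inner_swap by (intro fps2_conv_swap fps2_conv_deriv)

lemma has_fps2_partial_inner:
  assumes "h has_fps2 F"
  shows "\<exists>r>0. \<forall>x y. \<bar>x\<bar> < r \<longrightarrow> \<bar>y\<bar> < r \<longrightarrow>
    ((\<lambda>x. h x y) has_real_derivative eval_fps2 (fps_deriv_inner F) x y) (at x)"
proof -
  have conv: "fps2_conv F" using assms by (simp add: has_fps2_def)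
  obtain r where r: "r > 0" "\<forall>y x. \<bar>y\<bar> < r \<longrightarrow> \<bar>x\<bar> < r \<longrightarrow>
      ((\<lambda>x. h x y) has_real_derivative eval_fps2 (fps_deriv (fps2_swap F)) y x) (at x)"
    using has_fps2_partial_outer[OF has_fps2_swap[OF assms]] by blast
  have "(\<lambda>x y. eval_fps2 (fps_deriv (fps2_swap F)) y x) has_fps2 fps_deriv_inner F"
    unfolding fps_deriv_inner_swap
    by (intro has_fps2_swap has_fps2_eval fps2_conv_deriv fps2_conv_swap conv)
  from has_fps2_unique[OF this has_fps2_eval[OF fps2_conv_deriv_inner[OF conv]]]
  obtain s where s: "s > 0" "\<forall>x y. \<bar>x\<bar> < s \<longrightarrow> \<bar>y\<bar> < s \<longrightarrow>
      eval_fps2 (fps_deriv (fps2_swap F)) y x = eval_fps2 (fps_deriv_inner F) x y"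
    by blast
  show ?thesis
  proof (intro exI[of _ "min r s"] conjI allI impI)
    fix x y assume xy: "\<bar>x\<bar> < min r s" "\<bar>y\<bar> < min r s"
    then have "eval_fps2 (fps_deriv (fps2_swap F)) y x = eval_fps2 (fps_deriv_inner F) x y"
      using s(2) by simp
    with r(2) xy show "((\<lambda>x. h x y) has_real_derivative eval_fps2 (fps_deriv_inner F) x y) (at x)"
      by force
  qed (use r s in simp)
qed

text \<open>The chain rule along an orbit requires the total derivative. It follows from the two
  partial derivatives and the continuity of the one in y.\<close>

lemma has_fps2_has_derivative:
  assumes "h has_fps2 F"
  shows "\<exists>r>0. \<forall>x y. \<bar>x\<bar> < r \<longrightarrow> \<bar>y\<bar> < r \<longrightarrow>
    ((\<lambda>(x, y). h x y) has_derivative (\<lambda>(a, b). eval_fps2 (fps_deriv_inner F) x y * a + eval_fps2 (fps_deriv F) x y * b)) (at (x, y))"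
proof -
  have conv: "fps2_conv F" using assms by (simp add: has_fps2_def)
  obtain r where r: "r > 0" "\<forall>x y. \<bar>x\<bar> < r \<longrightarrow> \<bar>y\<bar> < r \<longrightarrow>
      ((\<lambda>x. h x y) has_real_derivative eval_fps2 (fps_deriv_inner F) x y) (at x)"
    using has_fps2_partial_inner[OF assms] by blast
  obtain s where s: "s > 0" "\<forall>x y. \<bar>x\<bar> < s \<longrightarrow> \<bar>y\<bar> < s \<longrightarrow>
      (h x has_real_derivative eval_fps2 (fps_deriv F) x y) (at y)"
    using has_fps2_partial_outer[OF assms] by blast
  obtain t where t: "t > 0" "continuous_on ({-t<..<t} \<times> {-t<..<t}) (\<lambda>p. eval_fps2 (fps_deriv F) (fst p) (snd p))"
    using has_fps2_continuous[OF has_fps2_eval[OF fps2_conv_deriv[OF conv]]] by blast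
  define d where "d = min r (min s t)"
  define I where "I = {-d<..<d}"
  have I: "open I" "convex I" "\<And>x. x \<in> I \<Longrightarrow> \<bar>x\<bar> < r \<and> \<bar>x\<bar> < s \<and> \<bar>x\<bar> < t"
    by (auto simp: I_def d_def)
  have "((\<lambda>(x, y). h x y) has_derivative (\<lambda>(a, b). eval_fps2 (fps_deriv_inner F) x y * a + eval_fps2 (fps_deriv F) x y * b)) (at (x, y))"
    if xy: "x \<in> I" "y \<in> I" for x y
  proof -
    have "((\<lambda>(x, y). h x y) has_derivative (\<lambda>(a, b). eval_fps2 (fps_deriv_inner F) x y * a
        + blinfun_apply (blinfun_mult_right (eval_fps2 (fps_deriv F) x y)) b)) (at (x, y) within I \<times> I)"
    proof (rule has_derivative_partialsI)
      show "((\<lambda>x. h x y) has_derivative (*) (eval_fps2 (fps_deriv_inner F) x y)) (at x within I)"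
        using r(2) I(3) xy by (auto simp: has_field_derivative_def intro: has_derivative_at_withinI)
      fix u v assume "u \<in> I" "v \<in> I"
      then show "(h u has_derivative blinfun_apply (blinfun_mult_right (eval_fps2 (fps_deriv F) u v))) (at v within I)"
        using s(2) I(3) by (auto simp: has_field_derivative_def intro: has_derivative_at_withinI)
    next
      have "continuous_on (I \<times> I) (\<lambda>p. eval_fps2 (fps_deriv F) (fst p) (snd p))"
        by (rule continuous_on_subset[OF t(2)]) (auto simp: I_def d_def)
      then have "continuous (at (x, y) within I \<times> I) (\<lambda>p. eval_fps2 (fps_deriv F) (fst p) (snd p))"
        using xy by (simp add: continuous_on_eq_continuous_within)
      then show "continuous (at (x, y) within I \<times> I) (\<lambda>(x, y). blinfun_mult_right (eval_fps2 (fps_deriv F) x y))"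
        unfolding case_prod_unfold
        by (rule bounded_linear.continuous[OF bounded_linear_blinfun_mult_right])
    qed (use xy I in auto)
    moreover have "at (x, y) within I \<times> I = at (x, y)"
      using xy I by (intro at_within_open open_Times) auto
    ultimately show ?thesis by (simp add: case_prod_unfold)
  qed
  then show ?thesis
    using r s t by (intro exI[of _ d]) (auto simp: I_def d_def abs_less_iff)
qed

section \<open>The first integral\<close>

text \<open>The coefficient of x^m, a series in y, of the solution of H_x = q H_y with H(0, y) = y.
  Here \<open>Q\<close> is q with its variables swapped, so that \<open>Q $ i\<close> is the
  coefficient of x^i.\<close>

fun first_integral_coeff :: "real fps fps \<Rightarrow> nat \<Rightarrow> real fps" where
  "first_integral_coeff Q 0 = fps_X"
| "first_integral_coeff Q (Suc m) =
     fps_const (1 / real (Suc m)) * (\<Sum>i\<le>m. Q $ i * fps_deriv (first_integral_coeff Q (m - i)))"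

text \<open>The constant A = R (1 + 2 M) is chosen so that A - R = 2 M R; the convolution of the
  powers of R and A then telescopes to A^(m + 1) - R^(m + 1), which lets the majorant induction on m
  close.\<close>

lemma power_majorant_sum:
  fixes R M :: real
  shows "2 * M * R * (\<Sum>i\<le>m. R ^ i * (R * (1 + 2 * M)) ^ (m - i)) = (R * (1 + 2 * M)) ^ Suc m - R ^ Suc m"
proof -
  have "R ^ Suc m - (R * (1 + 2 * M)) ^ Suc m = (R - R * (1 + 2 * M)) * (\<Sum>i<Suc m. R ^ i * (R * (1 + 2 * M)) ^ (m - i))"
    by (rule diff_power_eq_sum)
  then show ?thesis by (simp add: lessThan_Suc_atMost algebra_simps)
qed

text \<open>The majorant is the coefficient of \<open>y^n\<close> in \<open>A^m (1 - R y)^(-2m-2)\<close>: differentiating and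
  multiplying by \<open>1 / (1 - R y)\<close> raises the exponent by \<open>2\<close>, and the factor \<open>2 m + 2\<close> that comes out
  is absorbed by the division by \<open>m + 1\<close>.\<close>

lemma first_integral_coeff_bound:
  assumes Q: "\<And>i j. \<bar>Q $ i $ j\<bar> \<le> M * R ^ (i + j)" and R: "R \<ge> 1"
  shows "\<bar>first_integral_coeff Q m $ n\<bar> \<le> (R * (1 + 2 * M)) ^ m * R ^ n * real ((n + 2 * m + 1) choose n)"
proof (induction m arbitrary: n rule: less_induct)
  case (less m)
  have M: "M \<ge> 0" using Q[of 0 0] by simp
  define A where "A = R * (1 + 2 * M)"
  have A: "A \<ge> 0" using M R by (simp add: A_def)
  show ?case
  proof (cases m)
    case 0
    have "\<bar>fps_X $ n :: real\<bar> \<le> R ^ n * real ((n + 1) choose n)"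
      using R by (cases "n = 1") (auto simp: fps_X_nth)
    then show ?thesis using 0 by simp
  next
    case (Suc p)
    have term_bound: "\<bar>(Q $ i * fps_deriv (first_integral_coeff Q (p - i))) $ n\<bar>
        \<le> real (Suc p) * (2 * M * R * R ^ n * real ((n + 2 * p + 3) choose n) * (R ^ i * A ^ (p - i)))" if i: "i \<le> p" for i
    proof -
      define k where "k = p - i"
      have "\<bar>(Q $ i * fps_deriv (first_integral_coeff Q k)) $ n\<bar>
          \<le> (\<Sum>N\<le>n. \<bar>Q $ i $ (n - N)\<bar> * \<bar>fps_deriv (first_integral_coeff Q k) $ N\<bar>)"
        unfolding fps_mult_nth
        by (subst sum.atLeastAtMost_rev) (simp add: atLeast0AtMost sum_abs abs_mult[symmetric])
      also have "\<dots> \<le> (\<Sum>N\<le>n. M * R ^ (i + Suc n) * A ^ k * real (2 * k + 2) * real ((2 * k + 2 + N) choose N))"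
      proof (rule sum_mono)
        fix N assume N: "N \<in> {..n}"
        define T where "T = 2 * k + 2 + N"
        \<comment> \<open>As T - N = 2 k + 2 does not depend on N, absorption turns the factor N + 1
          produced by the derivative into a constant that leaves the sum over N.\<close>
        have "Suc N * (T choose Suc N) = (T - N) * (T choose N)"
          by (simp only: binomial_absorption binomial_absorb_comp)
        also have "T - N = 2 * k + 2" by (simp add: T_def)
        finally have T: "real (Suc N) * real (T choose Suc N) = real (2 * k + 2) * real (T choose N)"
          by (simp only: of_nat_mult[symmetric])
        have "\<bar>fps_deriv (first_integral_coeff Q k) $ N\<bar> = real (Suc N) * \<bar>first_integral_coeff Q k $ Suc N\<bar>"
          by (simp add: abs_mult del: of_nat_Suc)
        also have "\<dots> \<le> real (Suc N) * (A ^ k * R ^ Suc N * real ((Suc N + 2 * k + 1) choose Suc N))"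
          using less.IH[of k "Suc N"] Suc by (intro mult_left_mono) (simp_all add: A_def k_def)
        also have "Suc N + 2 * k + 1 = T" by (simp add: T_def)
        also have "real (Suc N) * (A ^ k * R ^ Suc N * real (T choose Suc N))
            = A ^ k * R ^ Suc N * (real (Suc N) * real (T choose Suc N))" by (simp only: mult_ac)
        finally have 1: "\<bar>fps_deriv (first_integral_coeff Q k) $ N\<bar> \<le> A ^ k * R ^ Suc N * (real (2 * k + 2) * real (T choose N))"
          unfolding T .
        have "\<bar>Q $ i $ (n - N)\<bar> * \<bar>fps_deriv (first_integral_coeff Q k) $ N\<bar>
            \<le> (M * R ^ (i + (n - N))) * (A ^ k * R ^ Suc N * (real (2 * k + 2) * real (T choose N)))"
          by (rule mult_mono[OF Q 1]) (use M R in auto)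
        also have "\<dots> = M * R ^ (i + (n - N) + Suc N) * A ^ k * real (2 * k + 2) * real (T choose N)"
          by (simp add: power_add)
        also have "i + (n - N) + Suc N = i + Suc n" using N by simp
        finally show "\<bar>Q $ i $ (n - N)\<bar> * \<bar>fps_deriv (first_integral_coeff Q k) $ N\<bar>
            \<le> M * R ^ (i + Suc n) * A ^ k * real (2 * k + 2) * real ((2 * k + 2 + N) choose N)"
          by (simp only: T_def)
      qed
      also have "\<dots> = M * R ^ (i + Suc n) * A ^ k * real (2 * k + 2) * real (\<Sum>N\<le>n. (2 * k + 2 + N) choose N)"
        by (simp only: sum_distrib_left of_nat_sum)
      \<comment> \<open>The sum over N is a single binomial coefficient by
        \<open>sum_choose_lower\<close>; k \<le> p bounds both 2 k + 2 by 2 (p + 1) and this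
        coefficient by the one for p.\<close>
      also have "\<dots> \<le> M * R ^ (i + Suc n) * A ^ k * (2 * real (Suc p)) * real ((n + 2 * p + 3) choose n)"
        unfolding sum_choose_lower
        by (intro mult_mono mult_left_mono of_nat_mono binomial_right_mono) (use M R A in \<open>auto simp: k_def\<close>)
      also have "\<dots> = real (Suc p) * (2 * M * R * R ^ n * real ((n + 2 * p + 3) choose n) * (R ^ i * A ^ k))"
        by (simp only: power_add power_Suc mult_ac)
      finally show ?thesis by (simp only: k_def)
    qed
    have "\<bar>first_integral_coeff Q m $ n\<bar>
        = \<bar>\<Sum>i\<le>p. (Q $ i * fps_deriv (first_integral_coeff Q (p - i))) $ n\<bar> / real (Suc p)"
      by (simp add: Suc fps_sum_nth abs_mult del: of_nat_Suc)
    also have "\<dots> \<le> (\<Sum>i\<le>p. real (Suc p) * (2 * M * R * R ^ n * real ((n + 2 * p + 3) choose n) * (R ^ i * A ^ (p - i)))) / real (Suc p)"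
      by (intro divide_right_mono order.trans[OF sum_abs] sum_mono term_bound) auto
    also have "\<dots> = R ^ n * real ((n + 2 * p + 3) choose n) * (2 * M * R * (\<Sum>i\<le>p. R ^ i * A ^ (p - i)))"
      by (simp add: sum_distrib_left[symmetric] del: of_nat_Suc)
    also have "\<dots> \<le> R ^ n * real ((n + 2 * p + 3) choose n) * A ^ Suc p"
      unfolding A_def power_majorant_sum using R by (intro mult_left_mono) auto
    also have "n + 2 * p + 3 = n + 2 * m + 1" using Suc by simp
    finally show ?thesis by (simp add: Suc A_def mult_ac)
  qed
qed

text \<open>The Cauchy-Kovalevskaya theorem for one linear equation, with data y on the line x =
  0.\<close>

lemma first_integral_exists:
  assumes "fps2_conv q"
  obtains \<H> where "fps2_conv \<H>" "fps_deriv_inner \<H> = q * fps_deriv \<H>"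
    "\<And>j. \<H> $ j $ 0 = (if j = 1 then 1 else 0)"
proof -
  define Q where "Q = fps2_swap q"
  have "fps2_conv Q" unfolding Q_def by (rule fps2_conv_swap[OF assms])
  then obtain M R where MR: "M > 0" "R \<ge> 1" "R > 0" "\<And>i j. \<bar>Q $ j $ i\<bar> \<le> M * R ^ (i + j)"
    using fps2_convE by metis
  have Q: "\<bar>Q $ i $ j\<bar> \<le> M * R ^ (i + j)" for i j
    using MR(4)[of i j] by (simp add: add.commute)
  define c where "c = first_integral_coeff Q"
  define \<H> where "\<H> = fps2_swap (Abs_fps c)"
  define A where "A = R * (1 + 2 * M)"
  have A: "A \<ge> R" "A > 0"
    using mult_left_mono[of 1 "1 + 2 * M" R] MR unfolding A_def by (simp, intro mult_pos_pos, auto)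
  show ?thesis
  proof (rule that)
    show "fps2_conv \<H>"
    proof (rule fps2_convI[of "4 * A" _ 2])
      fix i j
      have "\<bar>\<H> $ j $ i\<bar> \<le> A ^ i * R ^ j * real ((j + 2 * i + 1) choose j)"
        using first_integral_coeff_bound[OF Q MR(2), of i j] by (simp add: \<H>_def c_def A_def)
      \<comment> \<open>The binomial coefficient costs a factor 4 per power of x and 2 per power of
        y, whence the rate 4 A.\<close>
      also have "\<dots> \<le> A ^ i * A ^ j * real (2 ^ (j + 2 * i + 1))"
        by (intro mult_mono power_mono of_nat_mono binomial_le_pow2) (use A MR in auto)
      also have "\<dots> = 2 * (4 * A) ^ i * (2 * A) ^ j"
        by (simp add: power_mult_distrib power_add power_mult)
      also have "\<dots> \<le> 2 * (4 * A) ^ i * (4 * A) ^ j"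
        using A by (intro mult_left_mono power_mono) auto
      finally show "\<bar>\<H> $ j $ i\<bar> \<le> 2 * (4 * A) ^ (i + j)" by (simp add: power_add)
    qed (use A in auto)
    show "\<H> $ j $ 0 = (if j = 1 then 1 else 0)" for j
      by (simp add: \<H>_def c_def fps_X_nth)
    show "fps_deriv_inner \<H> = q * fps_deriv \<H>"
    proof (intro fps_ext)
      fix j i
      have dH: "fps_deriv \<H> $ b $ a = of_nat (Suc b) * c a $ Suc b" for a b
        by (simp add: \<H>_def del: of_nat_Suc flip: fps_of_nat)
      have "(fps_const (of_nat (Suc i)) * c (Suc i)) $ j = (\<Sum>a\<le>i. Q $ a * fps_deriv (c (i - a))) $ j"
        by (simp add: c_def mult.assoc[symmetric] del: of_nat_Suc fps_const_mult)
           (simp add: del: of_nat_Suc)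
      also have "\<dots> = (\<Sum>a\<le>i. \<Sum>b=0..j. q $ b $ a * (of_nat (Suc (j - b)) * c (i - a) $ Suc (j - b)))"
        by (simp add: fps_sum_nth fps_mult_nth Q_def del: of_nat_Suc)
      also have "\<dots> = (\<Sum>b=0..j. \<Sum>a=0..i. q $ b $ a * fps_deriv \<H> $ (j - b) $ (i - a))"
        by (subst sum.swap) (simp add: dH atLeast0AtMost del: of_nat_Suc fps_deriv_nth)
      also have "\<dots> = (q * fps_deriv \<H>) $ j $ i"
        by (simp only: fps_mult_nth fps_sum_nth)
      finally show "fps_deriv_inner \<H> $ j $ i = (q * fps_deriv \<H>) $ j $ i"
        by (simp add: \<H>_def del: of_nat_Suc)
    qed
  qed
qed

section \<open>Analytic involutions\<close>

lemma has_fps_expansion_unique_real: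
  fixes f :: "real \<Rightarrow> real"
  assumes "f has_fps_expansion A" "f has_fps_expansion B"
  shows "A = B"
proof (rule fps_ext)
  fix n show "A $ n = B $ n"
    using has_fps_expansion_higher_deriv_0[OF assms(1), of n] has_fps_expansion_higher_deriv_0[OF assms(2), of n]
    by simp
qed

definition fps_complex :: "real fps \<Rightarrow> complex fps"
  where "fps_complex A = Abs_fps (\<lambda>n. complex_of_real (A $ n))"

lemma fps_complex_nth [simp]: "fps_complex A $ n = complex_of_real (A $ n)"
  by (simp add: fps_complex_def)

lemma fps_complex_power: "fps_complex (A ^ n) = fps_complex A ^ n"
proof (induction n)
  case 0
  show ?case by (rule fps_ext) simp
next
  case (Suc n)
  show ?case unfolding power_Suc Suc[symmetric]
    by (rule fps_ext) (simp add: fps_mult_nth)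
qed

lemma fps_complex_compose: "fps_complex (A oo B) = fps_complex A oo fps_complex B"
  by (rule fps_ext) (simp add: fps_compose_nth fps_complex_power[symmetric])

lemma fps_complex_conv_radius: "fps_conv_radius (fps_complex A) = fps_conv_radius A"
proof -
  have "conv_radius (\<lambda>n. norm (fps_complex A $ n)) = conv_radius (\<lambda>n. norm (A $ n))" by simp
  then show ?thesis unfolding conv_radius_norm by (simp only: fps_conv_radius_def)
qed

lemma eval_fps_complex:
  assumes "ereal \<bar>x\<bar> < fps_conv_radius A"
  shows "eval_fps (fps_complex A) (of_real x) = of_real (eval_fps A x)"
proof -
  have "(\<lambda>n. A $ n * x ^ n) sums eval_fps A x"
    using assms by (intro sums_eval_fps) simp
  then have "(\<lambda>n. complex_of_real (A $ n * x ^ n)) sums of_real (eval_fps A x)"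
    by (simp only: sums_of_real_iff)
  then show ?thesis by (simp add: eval_fps_def sums_iff)
qed

text \<open>On the real axis the imaginary parts of the coefficients form an expansion of the zero
  function, so they vanish.\<close>

lemma real_part_has_fps_expansion:
  fixes f :: "real \<Rightarrow> real" and F :: "complex \<Rightarrow> complex"
  assumes F: "F has_fps_expansion C" and eq: "eventually (\<lambda>x. F (of_real x) = of_real (f x)) (nhds 0)"
  shows "f has_fps_expansion Abs_fps (\<lambda>n. Re (C $ n))" "C = fps_complex (Abs_fps (\<lambda>n. Re (C $ n)))"
proof -
  have rad: "fps_conv_radius C > 0" and ev: "eventually (\<lambda>z. eval_fps C z = F z) (nhds 0)"
    using F by (auto simp: has_fps_expansion_def)
  have tend: "filterlim (\<lambda>x. complex_of_real x) (nhds 0) (nhds 0)"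
    using tendsto_of_real[OF filterlim_ident[of "nhds (0::real)"], where 'a = complex] by simp
  have "eventually (\<lambda>z. z \<in> eball 0 (fps_conv_radius C)) (nhds (0::complex))"
    using rad by (intro eventually_nhds_in_open) (auto simp: zero_ereal_def)
  with ev have "eventually (\<lambda>z. eval_fps C z = F z \<and> z \<in> eball 0 (fps_conv_radius C)) (nhds 0)"
    by eventually_elim simp
  from eventually_compose_filterlim[OF this tend]
  have "eventually (\<lambda>x. eval_fps C (of_real x) = F (of_real x) \<and> complex_of_real x \<in> eball 0 (fps_conv_radius C)) (nhds 0)" .
  with eq have sums: "eventually (\<lambda>x. (\<lambda>n. C $ n * of_real x ^ n) sums complex_of_real (f x)) (nhds 0)"
  proof eventually_elim
    case (elim x)
    then have "(\<lambda>n. C $ n * of_real x ^ n) sums eval_fps C (of_real x)"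
      by (intro sums_eval_fps) simp
    with elim show ?case by simp
  qed
  show "f has_fps_expansion Abs_fps (\<lambda>n. Re (C $ n))"
    using sums
  proof (intro has_fps_expansionI, eventually_elim)
    case (elim x)
    from sums_Re[OF elim(2)] show ?case by (simp flip: of_real_power)
  qed
  have "(\<lambda>_. 0 :: real) has_fps_expansion Abs_fps (\<lambda>n. Im (C $ n))"
    using sums
  proof (intro has_fps_expansionI, eventually_elim)
    case (elim x)
    from sums_Im[OF elim(2)] show ?case by (simp flip: of_real_power)
  qed
  then have "Abs_fps (\<lambda>n. Im (C $ n)) = 0"
    using has_fps_expansion_unique_real has_fps_expansion_0 by blast
  then have "Im (C $ n) = 0" for n by (simp add: fps_eq_iff)
  then show "C = fps_complex (Abs_fps (\<lambda>n. Re (C $ n)))"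
    by (simp add: fps_eq_iff complex_eq_iff)
qed

text \<open>If \<open>W = c \<psi>^K\<close> with \<open>\<psi>\<close> a local diffeomorphism, the equation \<open>W (\<phi> x) = W x\<close> forces
  \<open>\<phi> = \<psi>^(-1) \<circ> (- \<psi>)\<close>; the root \<open>\<psi>\<close> and its inverse are taken in the complex domain, where their
  analyticity is automatic.\<close>

lemma analytic_involution:
  fixes W \<phi> :: "real \<Rightarrow> real"
  assumes W: "W has_fps_expansion A" and K: "even K" "K \<ge> 1" and low: "\<And>m. m < K \<Longrightarrow> A $ m = 0" and AK: "A $ K \<noteq> 0"
    and \<phi>0: "\<phi> 0 = 0" and lim: "(\<phi> \<longlongrightarrow> 0) (nhds 0)"
    and eq: "eventually (\<lambda>x. W (\<phi> x) = W x \<and> \<phi> x \<noteq> x) (at 0)"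
  obtains \<alpha> where "\<phi> has_fps_expansion \<alpha>" "\<alpha> $ 0 = 0" "\<alpha> $ 1 = - 1" "A oo \<alpha> = A"
proof -
  define B where "B = fps_const (1 / A $ K) * fps_shift K A"
  have AB: "A = fps_const (A $ K) * (fps_X ^ K * B)"
    by (rule fps_ext) (use AK low in \<open>auto simp: B_def fps_X_power_mult_nth\<close>)
  have B0: "B $ 0 = 1" using AK by (simp add: B_def)
  have radA: "fps_conv_radius A > 0" using W by (simp add: has_fps_expansion_def)
  have radB: "fps_conv_radius B > 0"
    using radA AK unfolding B_def by (subst fps_conv_radius_cmult_left) auto
  define u where "u = eval_fps (fps_complex B)"
  have u_exp: "u has_fps_expansion fps_complex B"
    unfolding u_def by (rule eval_fps_has_fps_expansion) (simp add: fps_complex_conv_radius radB)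
  have u0: "u 0 = 1" by (simp add: u_def eval_fps_at_0 B0)
  have u_ana: "u analytic_on {0}"
    using u_exp by (rule has_fps_expansion_imp_analytic_0)
  \<comment> \<open>A K-th root of z^K u(z); the principal logarithm is analytic near u(0) =
    1.\<close>
  define \<psi> where "\<psi> = (\<lambda>z. z * exp (Ln (u z) / of_nat K))"
  have \<psi>_ana: "\<psi> analytic_on {0}"
    unfolding \<psi>_def using u_ana K by (intro analytic_intros) (auto simp: u0)
  have \<psi>0: "\<psi> 0 = 0" by (simp add: \<psi>_def)
  obtain S where S: "open S" "0 \<in> S" "\<psi> holomorphic_on S"
    using \<psi>_ana by (auto simp: analytic_at)
  have e_ana: "(\<lambda>z. exp (Ln (u z) / of_nat K)) analytic_on {0}"
    using u_ana K by (intro analytic_intros) (auto simp: u0)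
  have "(\<psi> has_field_derivative exp (Ln (u 0) / of_nat K)) (at 0)"
  proof -
    have "((\<lambda>z. exp (Ln (u z) / of_nat K)) has_field_derivative deriv (\<lambda>z. exp (Ln (u z) / of_nat K)) 0) (at 0)"
      using e_ana analytic_on_imp_differentiable_at DERIV_deriv_iff_field_differentiable by blast
    from DERIV_mult[OF DERIV_ident this] show ?thesis unfolding \<psi>_def by simp
  qed
  then have d\<psi>: "deriv \<psi> 0 = 1" by (simp add: DERIV_imp_deriv u0)
  have "deriv \<psi> 0 \<noteq> 0" using d\<psi> by simp
  from has_complex_derivative_locally_invertible[OF S(3,2,1) this]
  obtain r where r: "r > 0" "ball 0 r \<subseteq> S" "open (\<psi> ` ball 0 r)" "inj_on \<psi> (ball 0 r)"
    by metis
  have hol: "\<psi> holomorphic_on ball 0 r" using S(3) r(2) by (rule holomorphic_on_subset)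
  from holomorphic_has_inverse[OF hol open_ball r(4)]
  obtain g where g: "g holomorphic_on \<psi> ` ball 0 r" "\<And>z. z \<in> ball 0 r \<Longrightarrow> deriv \<psi> z * deriv g (\<psi> z) = 1"
    "\<And>z. z \<in> ball 0 r \<Longrightarrow> g (\<psi> z) = z" by metis
  have zero_in: "0 \<in> \<psi> ` ball 0 r" using \<psi>0 r(1) by force
  have g_ana: "g analytic_on {0}" using g(1) r(3) zero_in by (auto simp: analytic_at)
  define \<Phi> where "\<Phi> = (\<lambda>z. g (- \<psi> z))"
  have "g \<circ> (\<lambda>z. - \<psi> z) analytic_on {0}"
    by (intro analytic_on_compose_gen[of _ _ g "{0}"] analytic_on_neg \<psi>_ana g_ana) (simp add: \<psi>0)
  then have \<Phi>_ana: "\<Phi> analytic_on {0}" by (simp add: \<Phi>_def o_def)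
  define C where "C = fps_expansion \<Phi> 0"
  have C: "\<Phi> has_fps_expansion C"
    unfolding C_def by (rule analytic_at_imp_has_fps_expansion_0[OF \<Phi>_ana])
  have \<Phi>0: "\<Phi> 0 = 0" using g(3)[of 0] r(1) by (simp add: \<Phi>_def \<psi>0)
  have C0: "C $ 0 = 0" using fps_nth_fps_expansion[OF C, of 0] \<Phi>0 by simp
  have C1: "C $ 1 = - 1"
  proof -
    have dg: "deriv g 0 = 1" using g(2)[of 0] r(1) d\<psi> by (simp add: \<psi>0)
    have "(g has_field_derivative deriv g 0) (at (- \<psi> 0))"
      using g_ana analytic_on_imp_differentiable_at DERIV_deriv_iff_field_differentiable \<psi>0 by fastforce
    moreover have "((\<lambda>z. - \<psi> z) has_field_derivative - 1) (at 0)"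
      using DERIV_minus[of \<psi> 1 0] \<psi>_ana analytic_on_imp_differentiable_at DERIV_deriv_iff_field_differentiable d\<psi>
      by (metis singletonI)
    ultimately have "(\<Phi> has_field_derivative deriv g 0 * - 1) (at 0)"
      unfolding \<Phi>_def by (rule DERIV_chain2)
    then show ?thesis using fps_nth_fps_expansion[OF C, of 1] dg by (simp add: DERIV_imp_deriv)
  qed

  have powK: "\<psi> z ^ K = z ^ K * u z" if "u z \<noteq> 0" for z
  proof -
    have "exp (Ln (u z) / of_nat K) ^ K = exp (of_nat K * (Ln (u z) / of_nat K))"
      by (simp only: exp_of_nat_mult)
    also have "\<dots> = u z" using K that by simp
    finally show ?thesis by (simp add: \<psi>_def power_mult_distrib)
  qed
  have u_lim: "(u \<longlongrightarrow> 1) (nhds 0)"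
    using analytic_at_imp_isCont[OF u_ana] u0 by (metis isCont_def tendsto_at_iff_tendsto_nhds)
  have u_nz: "eventually (\<lambda>z. u z \<noteq> 0) (nhds 0)"
    by (rule tendsto_imp_eventually_ne[OF u_lim]) simp
  have \<psi>_lim: "(\<psi> \<longlongrightarrow> 0) (nhds 0)"
    using analytic_at_imp_isCont[OF \<psi>_ana] \<psi>0 by (metis isCont_def tendsto_at_iff_tendsto_nhds)
  have \<Phi>_lim: "(\<Phi> \<longlongrightarrow> 0) (nhds 0)"
    using analytic_at_imp_isCont[OF \<Phi>_ana] \<Phi>0 by (metis isCont_def tendsto_at_iff_tendsto_nhds)

  have "eventually (\<lambda>z. z \<in> uminus ` (\<psi> ` ball 0 r)) (nhds 0)"
    using r(3) zero_in by (intro eventually_nhds_in_open open_negations) force+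
  then have "eventually (\<lambda>z. - z \<in> \<psi> ` ball 0 r) (nhds 0)" by eventually_elim auto
  then have "eventually (\<lambda>z. - \<psi> z \<in> \<psi> ` ball 0 r) (nhds 0)"
    using \<psi>_lim by (auto simp: filterlim_iff)
  then have \<psi>\<Phi>: "eventually (\<lambda>z. \<psi> (\<Phi> z) = - \<psi> z) (nhds 0)"
    by eventually_elim (use g(3) in \<open>auto simp: \<Phi>_def\<close>)

  define Wc where "Wc = (\<lambda>z. of_real (A $ K) * (z ^ K * u z))"
  have Wc: "Wc has_fps_expansion fps_complex A"
  proof -
    have "fps_complex A = fps_const (of_real (A $ K)) * (fps_X ^ K * fps_complex B)"
      by (rule fps_ext, subst AB) (simp add: fps_X_power_mult_nth)
    then show ?thesis unfolding Wc_def
      by (simp only:) (intro has_fps_expansion_cmult_left has_fps_expansion_mult has_fps_expansion_fps_X_power u_exp)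
  qed
  have "eventually (\<lambda>z. u (\<Phi> z) \<noteq> 0) (nhds 0)"
    using u_nz \<Phi>_lim by (auto simp: filterlim_iff)
  with u_nz \<psi>\<Phi> have "eventually (\<lambda>z. (Wc \<circ> \<Phi>) z = Wc z) (nhds 0)"
  proof eventually_elim
    case (elim z)
    \<comment> \<open>K is even, so the sign in \<psi> (\<Phi> z) = - \<psi> z disappears.\<close>
    then have "\<psi> (\<Phi> z) ^ K = \<psi> z ^ K" using K by simp
    then have "\<Phi> z ^ K * u (\<Phi> z) = z ^ K * u z"
      using powK[of z] powK[of "\<Phi> z"] elim by metis
    then show ?case by (simp add: Wc_def)
  qed
  then have "(Wc \<circ> \<Phi>) has_fps_expansion fps_complex A"
    using Wc by (subst has_fps_expansion_cong) auto
  moreover have "(Wc \<circ> \<Phi>) has_fps_expansion (fps_complex A oo C)"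
    by (rule has_fps_expansion_compose[OF Wc C C0])
  ultimately have comp: "fps_complex A oo C = fps_complex A"
    by (intro fps_ext) (metis fps_nth_fps_expansion)

  have of_real_lim: "filterlim (\<lambda>x. complex_of_real x) (nhds 0) (nhds 0)"
    using tendsto_of_real[OF filterlim_ident[of "nhds (0::real)"], where 'a = complex] by simp
  define b where "b = eval_fps B"
  have b_exp: "b has_fps_expansion B" unfolding b_def using radB by (rule eval_fps_has_fps_expansion)
  have b_lim: "(b \<longlongrightarrow> 1) (nhds 0)"
  proof -
    have "continuous (at 0) b" using has_fps_expansion_imp_continuous[OF b_exp] .
    then show ?thesis
      using B0 by (metis b_def eval_fps_at_0 isCont_def tendsto_at_iff_tendsto_nhds)
  qed
  \<comment> \<open>The restriction of \<open>\<psi>\<close> to the real axis. Among real numbers,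
    equal even powers leave only the two choices p (\<phi> x) = p x and p (\<phi> x) = - p
    x.\<close>
  define p where "p = (\<lambda>x. x * exp (ln (b x) / real K))"
  have "eventually (\<lambda>x. ereal \<bar>x\<bar> < fps_conv_radius B) (nhds 0)"
    using eventually_nhds_in_open[of "eball 0 (fps_conv_radius B)" "0::real"] radB
    by (auto simp: zero_ereal_def)
  moreover have "eventually (\<lambda>x. b x > 0) (nhds 0)"
    by (rule order_tendstoD[OF b_lim]) simp
  moreover have "eventually (\<lambda>x. complex_of_real x \<in> ball 0 r) (nhds 0)"
    using of_real_lim eventually_nhds_in_open[of "ball (0::complex) r" 0] r(1) by (auto simp: filterlim_iff)
  moreover have "eventually (\<lambda>x. W x = A $ K * (x ^ K * b x)) (nhds 0)"
  proof -
    have "(\<lambda>x. A $ K * (x ^ K * b x)) has_fps_expansion A"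
      by (subst AB) (intro has_fps_expansion_cmult_left has_fps_expansion_mult has_fps_expansion_fps_X_power b_exp)
    then have "eventually (\<lambda>x. eval_fps A x = A $ K * (x ^ K * b x)) (nhds 0)"
      by (simp add: has_fps_expansion_def)
    moreover have "eventually (\<lambda>x. eval_fps A x = W x) (nhds 0)" using W by (simp add: has_fps_expansion_def)
    ultimately show ?thesis by eventually_elim simp
  qed
  ultimately have good: "eventually (\<lambda>x. complex_of_real x \<in> ball 0 r \<and> \<psi> (of_real x) = of_real (p x) \<and> W x = A $ K * p x ^ K) (nhds 0)"
  proof eventually_elim
    case (elim x)
    have "\<psi> (of_real x) = of_real (p x)"
      using elim(2) eval_fps_complex[OF elim(1)]
      by (simp add: \<psi>_def p_def u_def b_def Ln_of_real flip: exp_of_real)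
    moreover have "p x ^ K = x ^ K * b x"
    proof -
      have "exp (ln (b x) / real K) ^ K = exp (real K * (ln (b x) / real K))" by (simp only: exp_of_nat_mult)
      then show ?thesis using K elim(2) by (simp add: p_def power_mult_distrib)
    qed
    ultimately show ?case using elim by simp
  qed
  have good\<phi>: "eventually (\<lambda>x. complex_of_real (\<phi> x) \<in> ball 0 r \<and> \<psi> (of_real (\<phi> x)) = of_real (p (\<phi> x)) \<and> W (\<phi> x) = A $ K * p (\<phi> x) ^ K) (nhds 0)"
    using good lim by (auto simp: filterlim_iff)
  have eq': "eventually (\<lambda>x. x \<noteq> 0 \<longrightarrow> W (\<phi> x) = W x \<and> \<phi> x \<noteq> x) (nhds 0)"
    using eq by (simp add: eventually_at_filter)
  have "eventually (\<lambda>x. \<Phi> (of_real x) = of_real (\<phi> x)) (nhds 0)"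
    using good good\<phi> eq'
  proof eventually_elim
    case (elim x)
    show ?case
    proof (cases "x = 0")
      case True
      then show ?thesis by (simp add: \<Phi>0 \<phi>0)
    next
      case False
      then have W: "W (\<phi> x) = W x" "\<phi> x \<noteq> x" using elim by auto
      then have "p (\<phi> x) ^ K = p x ^ K" using elim AK by simp
      then have "\<bar>p (\<phi> x)\<bar> = \<bar>p x\<bar>"
        using K by (metis abs_ge_zero power_abs power_eq_imp_eq_base less_le_trans zero_less_one)
      \<comment> \<open>\<open>\<psi>\<close> is injective on the ball, so equality would force
        \<phi> x = x.\<close>
      moreover have "p (\<phi> x) \<noteq> p x"
      proof
        assume "p (\<phi> x) = p x"
        then have "\<psi> (of_real (\<phi> x)) = \<psi> (of_real x)" using elim by simp
        then have "complex_of_real (\<phi> x) = of_real x" using r(4) elim by (meson inj_onD)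
        then show False using W by simp
      qed
      ultimately have "p (\<phi> x) = - p x" by linarith
      then have "- \<psi> (of_real x) = \<psi> (of_real (\<phi> x))" using elim by simp
      moreover have "g (\<psi> (of_real (\<phi> x))) = of_real (\<phi> x)" using g(3) elim by blast
      ultimately show ?thesis by (simp only: \<Phi>_def)
    qed
  qed
  note real = real_part_has_fps_expansion[OF C this]
  define \<alpha> where "\<alpha> = Abs_fps (\<lambda>n. Re (C $ n))"
  have "fps_complex (A oo \<alpha>) = fps_complex A"
    using comp real(2) by (simp add: fps_complex_compose \<alpha>_def)
  then have "A oo \<alpha> = A" by (simp add: fps_eq_iff)
  moreover have "\<alpha> $ 0 = 0" "\<alpha> $ 1 = - 1" using C0 C1 by (simp_all add: \<alpha>_def)
  ultimately show ?thesis using that[of \<alpha>] real(1) by (simp add: \<alpha>_def)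
qed

section \<open>Confinement of orbits\<close>

text \<open>Rescaling time by T puts forward and backward orbits on the interval from 0 to 1, with T
  absorbed in the vector field. The side condition becomes non-strict so that it also holds at the
  endpoints.\<close>

lemma returns_at_unit_interval:
  assumes "returns_at \<sigma> U P Q x x'"
  shows "\<exists>T u v. T \<noteq> 0 \<and> u 0 = x \<and> v 0 = 0 \<and> u 1 = x' \<and> v 1 = 0 \<and>
    (\<forall>t\<in>{0..1}. (u has_real_derivative T * P (u t) (v t)) (at t within {0..1}) \<and>
       (v has_real_derivative T * Q (u t) (v t)) (at t within {0..1}) \<and> sg \<sigma> * v t \<ge> 0)"
proof -
  obtain T u v where T: "T \<noteq> 0" "u 0 = x" "v 0 = 0" "u T = x'" "v T = 0"
    and d: "\<And>t. t \<in> closed_segment 0 T \<Longrightarrow> (u has_real_derivative P (u t) (v t)) (at t within closed_segment 0 T)"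
      "\<And>t. t \<in> closed_segment 0 T \<Longrightarrow> (v has_real_derivative Q (u t) (v t)) (at t within closed_segment 0 T)"
    and pos: "\<And>t. t \<in> open_segment 0 T \<Longrightarrow> sg \<sigma> * v t > 0"
    using assms unfolding returns_at_def by blast
  have seg: "(\<lambda>t. T * t) ` {0..1} = closed_segment 0 T"
    by (auto simp: closed_segment_def mult.commute image_def)
  have mem: "T * t \<in> closed_segment 0 T" if "t \<in> {0..1}" for t using that seg by blast
  have chain: "((\<lambda>t. f (T * t)) has_real_derivative T * D) (at t within {0..1})"
    if "(f has_real_derivative D) (at (T * t) within closed_segment 0 T)" for f D t
  proof -
    have "((\<lambda>t. T * t) has_real_derivative T) (at t within {0..1})"
      by (auto intro!: derivative_eq_intros)
    from DERIV_image_chain[OF that[folded seg] this] show ?thesis by (simp add: o_def mult.commute)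
  qed
  show ?thesis
  proof (rule exI[of _ T], rule exI[of _ "\<lambda>t. u (T * t)"], rule exI[of _ "\<lambda>t. v (T * t)"], intro conjI ballI)
    fix t :: real assume t: "t \<in> {0..1}"
    show "((\<lambda>t. u (T * t)) has_real_derivative T * P (u (T * t)) (v (T * t))) (at t within {0..1})"
      by (rule chain, rule d, rule mem, rule t)
    show "((\<lambda>t. v (T * t)) has_real_derivative T * Q (u (T * t)) (v (T * t))) (at t within {0..1})"
      by (rule chain, rule d, rule mem, rule t)
    show "sg \<sigma> * v (T * t) \<ge> 0"
    proof (cases "T * t = 0 \<or> T * t = T")
      case True
      then show ?thesis using T by auto
    next
      case False
      then have "T * t \<in> open_segment 0 T" using mem[OF t] by (simp add: open_segment_def)
      then show ?thesis using pos by fastforce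
    qed
  qed (use T in auto)
qed

text \<open>An orbit in the half-plane of the side \<open>\<sigma>\<close> starting close to the origin cannot reach the boundary of
  the box of radius \<open>\<rho>\<close>, where the first integral \<open>h\<close> is too large. Hence it is local although its
  time span is not assumed to be short.\<close>

lemma orbit_confined:
  assumes ret: "returns_at \<sigma> U P Q x x'"
    and h: "\<And>x y. \<bar>x\<bar> < r \<Longrightarrow> \<bar>y\<bar> < r \<Longrightarrow>
      ((\<lambda>(x, y). h x y) has_derivative (\<lambda>(a, b). hx x y * a + hy x y * b)) (at (x, y))"
    and P: "\<And>x y. \<bar>x\<bar> < r \<Longrightarrow> \<bar>y\<bar> < r \<Longrightarrow> P x y \<noteq> 0"
    and int: "\<And>x y. \<bar>x\<bar> < r \<Longrightarrow> \<bar>y\<bar> < r \<Longrightarrow> hx x y * P x y + hy x y * Q x y = 0"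
    and low: "\<And>x y. \<bar>x\<bar> < r \<Longrightarrow> \<bar>y\<bar> < r \<Longrightarrow> sg \<sigma> * y \<ge> 0 \<Longrightarrow> sg \<sigma> * h x y \<ge> c * x ^ K + sg \<sigma> * y / 2"
    and c: "c > 0" and K: "even K" and \<rho>: "\<rho> < r" and x: "\<bar>x\<bar> < \<rho>"
    and small: "sg \<sigma> * h x 0 < c * \<rho> ^ K" "sg \<sigma> * h x 0 < \<rho> / 2"
  shows "\<bar>x'\<bar> < \<rho>" "h x' 0 = h x 0" "x' \<noteq> x"
proof -
  obtain T u v where T: "T \<noteq> 0" "u 0 = x" "v 0 = 0" "u 1 = x'" "v 1 = 0"
    and duv: "\<forall>t\<in>{0..1}. (u has_real_derivative T * P (u t) (v t)) (at t within {0..1}) \<and>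
       (v has_real_derivative T * Q (u t) (v t)) (at t within {0..1}) \<and> sg \<sigma> * v t \<ge> 0"
    using returns_at_unit_interval[OF ret] by (elim exE conjE) (rule that)
  note du = bspec[OF duv, THEN conjunct1] and dv = bspec[OF duv, THEN conjunct2, THEN conjunct1]
    and pos = bspec[OF duv, THEN conjunct2, THEN conjunct2]
  define q where "q t = max \<bar>u t\<bar> \<bar>v t\<bar>" for t
  have "continuous_on {0..1} u" by (rule DERIV_continuous_on, erule du)
  moreover have "continuous_on {0..1} v" by (rule DERIV_continuous_on, erule dv)
  ultimately have q_cont: "continuous_on {0..1} q" unfolding q_def by (intro continuous_intros)
  \<comment> \<open>As long as the arc stays in the box of radius r, the chain rule and
    \<open>int\<close> make \<open>h\<close> constant along it.\<close>
  have const: "h (u b) (v b) = h x 0" if b: "b \<in> {0..1}" and qb: "\<And>t. t \<in> {0..b} \<Longrightarrow> q t < r" for b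
  proof -
    have "((\<lambda>t. h (u t) (v t)) has_real_derivative 0) (at t within {0..b})" if t: "t \<in> {0..b}" for t
    proof -
      have t1: "t \<in> {0..1}" and sub: "{0..b} \<subseteq> {0..1}" using t b by auto
      have qt: "\<bar>u t\<bar> < r" "\<bar>v t\<bar> < r" using qb[OF t] by (auto simp: q_def)
      have "((\<lambda>t. (u t, v t)) has_derivative (\<lambda>a. (T * P (u t) (v t) * a, T * Q (u t) (v t) * a))) (at t within {0..b})"
        using DERIV_subset[OF du[OF t1] sub] DERIV_subset[OF dv[OF t1] sub]
        unfolding has_field_derivative_def by (rule has_derivative_Pair)
      from has_derivative_compose[OF this h[OF qt]]
      have "((\<lambda>t. h (u t) (v t)) has_derivative
          (\<lambda>a. hx (u t) (v t) * (T * P (u t) (v t) * a) + hy (u t) (v t) * (T * Q (u t) (v t) * a))) (at t within {0..b})"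
        by simp
      moreover have "hx (u t) (v t) * (T * P (u t) (v t) * a) + hy (u t) (v t) * (T * Q (u t) (v t) * a)
          = T * a * (hx (u t) (v t) * P (u t) (v t) + hy (u t) (v t) * Q (u t) (v t))" for a
        by (simp add: algebra_simps)
      moreover have "(*) (0 :: real) = (\<lambda>_. 0)" by auto
      ultimately show ?thesis
        by (simp add: int[OF qt] has_field_derivative_def)
    qed
    then obtain C where "\<And>t. t \<in> {0..b} \<Longrightarrow> h (u t) (v t) = C"
      using has_field_derivative_zero_constant[of "{0..b}" "\<lambda>t. h (u t) (v t)"] by blast
    from this[of 0] this[of b] show ?thesis using b T by simp
  qed
  have small_q: "q t < \<rho>" if t: "t \<in> {0..1}" for t
  proof (rule ccontr)
    assume "\<not> q t < \<rho>"
    \<comment> \<open>The times at which the arc is outside the open box of radius \<rho>; the least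
      element of \<open>S\<close> is the first exit time.\<close>
    define S where "S = {0..1} \<inter> q -` {\<rho>..}"
    have "compact S"
      unfolding S_def compact_eq_bounded_closed
      using continuous_closed_preimage[OF q_cont closed_atLeastAtMost closed_atLeast, of \<rho>]
      by (auto intro: bounded_subset[OF bounded_closed_interval[of 0 1]])
    moreover have "S \<noteq> {}" using t \<open>\<not> q t < \<rho>\<close> by (auto simp: S_def)
    ultimately have "\<exists>b\<in>S. \<forall>t\<in>S. b \<le> t" by (rule compact_attains_inf)
    then obtain b where b: "b \<in> S" "\<And>t. t \<in> S \<Longrightarrow> b \<le> t" by blast
    have b1: "b \<in> {0..1}" "q b \<ge> \<rho>" using b(1) by (auto simp: S_def)
    \<comment> \<open>By continuity the first exit happens exactly on the boundary of the box of
      radius \<rho> < r, so \<open>h\<close> is still conserved at the exit time.\<close>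
    have "q 0 \<le> \<rho>" using x T by (simp add: q_def)
    then obtain t0 where "0 \<le> t0" "t0 \<le> b" "q t0 = \<rho>"
      using IVT'[of q 0 \<rho> b] b1 continuous_on_subset[OF q_cont, of "{0..b}"] by auto
    then have qb: "q b = \<rho>" using b(2)[of t0] b1 by (auto simp: S_def)
    have "q t < r" if "t \<in> {0..b}" for t
    proof (cases "t = b")
      case False
      then have "t \<notin> S" using that b(2) by force
      then show ?thesis using that b1 \<rho> by (auto simp: S_def)
    qed (use qb \<rho> in simp)
    then have hb: "h (u b) (v b) = h x 0" using const b1 by blast
    have "c * u b ^ K + sg \<sigma> * v b / 2 \<le> sg \<sigma> * h (u b) (v b)"
      using qb \<rho> pos b1 by (intro low) (auto simp: q_def)
    moreover have "u b ^ K \<ge> 0" using K by (rule zero_le_even_power)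
    then have "c * u b ^ K \<ge> 0" using c by simp
    moreover have "sg \<sigma> * v b \<ge> 0" using pos b1 by blast
    \<comment> \<open>Each way of being on the boundary contradicts one of the bounds in
      \<open>small\<close>: the first forces \<open>sg \<sigma> * h\<close> up to c \<rho>^K, the
      second up to \<rho> / 2.\<close>
    moreover have "\<bar>u b\<bar> = \<rho> \<or> \<bar>v b\<bar> = \<rho>" using qb by (auto simp: q_def max_def split: if_splits)
    moreover have "\<bar>u b\<bar> ^ K = u b ^ K" using K by (simp add: power_even_abs)
    moreover have "\<bar>v b\<bar> = sg \<sigma> * v b" using \<open>sg \<sigma> * v b \<ge> 0\<close> by (cases \<sigma>) auto
    ultimately show False using small hb by (elim disjE) simp_all
  qed
  show "\<bar>x'\<bar> < \<rho>" using small_q[of 1] T by (simp add: q_def)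
  have q_r: "q t < r" if "t \<in> {0..1}" for t using small_q[OF that] \<rho> by simp
  show "h x' 0 = h x 0" using const[of 1] q_r T by simp
  \<comment> \<open>The derivative T P of u does not vanish on the arc, so u cannot return to its
    initial value.\<close>
  have "\<exists>t\<in>{0<..<1}. u 1 - u 0 = T * P (u t) (v t) * (1 - 0)"
    using du by (intro mvt_simple) (auto simp: has_field_derivative_def)
  then obtain t where t: "t \<in> {0<..<1}" "u 1 - u 0 = T * P (u t) (v t)" by auto
  then have "P (u t) (v t) \<noteq> 0" using q_r[of t] by (intro P) (auto simp: q_def)
  then show "x' \<noteq> x" using t T by auto
qed

lemma has_fps2_near:
  assumes k: "k has_fps2 G" and e: "e > 0"
  shows "\<exists>r>0. \<forall>x y. \<bar>x\<bar> < r \<longrightarrow> \<bar>y\<bar> < r \<longrightarrow> \<bar>k x y - k 0 0\<bar> < e"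
proof -
  obtain s where s: "s > 0" "continuous_on ({-s<..<s} \<times> {-s<..<s}) (\<lambda>p. k (fst p) (snd p))"
    using has_fps2_continuous[OF k] by blast
  have "(0, 0) \<in> {-s<..<s} \<times> {-s<..<s}" using s by simp
  with s(2) e obtain d where d: "d > 0" "\<And>p. p \<in> {-s<..<s} \<times> {-s<..<s} \<Longrightarrow> dist p (0, 0) < d \<Longrightarrow>
      dist (k (fst p) (snd p)) (k 0 0) < e"
    unfolding continuous_on_iff by fastforce
  show ?thesis
  proof (intro exI[of _ "min s (d / 2)"] conjI allI impI)
    fix x y assume xy: "\<bar>x\<bar> < min s (d / 2)" "\<bar>y\<bar> < min s (d / 2)"
    have "dist (x, y) (0, 0) \<le> \<bar>x\<bar> + \<bar>y\<bar>"
      using sqrt_sum_squares_le_sum_abs[of x y] by (simp add: dist_prod_def)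
    also have "\<dots> < d" using xy by simp
    finally have "dist (x, y) (0, 0) < d" .
    moreover have "(x, y) \<in> {-s<..<s} \<times> {-s<..<s}" using xy by auto
    ultimately show "\<bar>k x y - k 0 0\<bar> < e"
      using d(2)[of "(x, y)"] by (simp add: dist_real_def)
  qed (use s d in auto)
qed

lemma has_fps2_nonzero_near:
  assumes "k has_fps2 G" "k 0 0 \<noteq> 0"
  shows "\<exists>r>0. \<forall>x y. \<bar>x\<bar> < r \<longrightarrow> \<bar>y\<bar> < r \<longrightarrow> k x y \<noteq> 0"
  using has_fps2_near[OF assms(1), of "\<bar>k 0 0\<bar>"] assms(2) by fastforce

text \<open>Supplies the lower bound that \<open>orbit_confined\<close> asks for. In a small box
  \<open>sg \<sigma> * W\<close> is at least c x^K, and \<H> grows in y at a rate of at least 1/2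
  because its y-derivative is 1 at the origin. Confinement in boxes of every small radius also
  yields the continuity of \<open>\<phi>\<close> at 0.\<close>

lemma half_return_level:
  assumes X: "X has_fps2 A" and X0: "A $ 0 $ 0 \<noteq> 0" and Y: "Y has_fps2 B" and F: "B = F * A" "fps2_conv F"
    and H: "fps2_conv \<H>" "fps_deriv_inner \<H> + F * fps_deriv \<H> = 0" "\<H> $ 1 $ 0 = 1"
    and low: "\<And>m. m < K \<Longrightarrow> \<H> $ 0 $ m = 0" and HK: "sg \<sigma> * \<H> $ 0 $ K > 0" and K: "even K" "K > 0"
    and \<phi>: "half_return_map \<sigma> U X Y \<phi>"
  shows "eventually (\<lambda>x. eval_fps (\<H> $ 0) (\<phi> x) = eval_fps (\<H> $ 0) x \<and> \<phi> x \<noteq> x) (at 0)"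
    and "(\<phi> \<longlongrightarrow> 0) (nhds 0)"
proof -
  define h where "h = eval_fps2 \<H>"
  define hx where "hx = eval_fps2 (fps_deriv_inner \<H>)"
  define hy where "hy = eval_fps2 (fps_deriv \<H>)"
  define W where "W = eval_fps (\<H> $ 0)"
  have hW: "h x 0 = W x" for x by (simp add: h_def W_def eval_fps2_at_0)
  have h: "h has_fps2 \<H>" unfolding h_def by (rule has_fps2_eval[OF H(1)])
  have hx: "hx has_fps2 fps_deriv_inner \<H>" unfolding hx_def by (intro has_fps2_eval fps2_conv_deriv_inner H)
  have hy: "hy has_fps2 fps_deriv \<H>" unfolding hy_def by (intro has_fps2_eval fps2_conv_deriv H)
  obtain r1 where r1: "r1 > 0" "\<forall>x y. \<bar>x\<bar> < r1 \<longrightarrow> \<bar>y\<bar> < r1 \<longrightarrow>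
    ((\<lambda>(x, y). h x y) has_derivative (\<lambda>(a, b). hx x y * a + hy x y * b)) (at (x, y))"
    using has_fps2_has_derivative[OF h] unfolding hx_def hy_def by blast
  have "(\<lambda>x y. hx x y * X x y + hy x y * Y x y) has_fps2 (fps_deriv_inner \<H> * A + fps_deriv \<H> * B)"
    by (intro has_fps2_add has_fps2_mult hx hy X Y)
  \<comment> \<open>Multiplying H_x + F H_y = 0 by X clears the denominator of F = Y / X.\<close>
  also have "fps_deriv_inner \<H> * A + fps_deriv \<H> * B = (fps_deriv_inner \<H> + F * fps_deriv \<H>) * A"
    by (simp add: F(1) algebra_simps)
  finally have "(\<lambda>x y. hx x y * X x y + hy x y * Y x y) has_fps2 fps_const (fps_const 0)"
    using H(2) by simp
  from has_fps2_unique[OF this has_fps2_const]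
  obtain r2 where r2: "r2 > 0" "\<forall>x y. \<bar>x\<bar> < r2 \<longrightarrow> \<bar>y\<bar> < r2 \<longrightarrow> hx x y * X x y + hy x y * Y x y = 0"
    by blast
  have "X 0 0 = A $ 0 $ 0"
    using has_fps_expansion_imp_nth_0[OF has_fps2_slice_0[OF X]] .
  then obtain r3 where r3: "r3 > 0" "\<forall>x y. \<bar>x\<bar> < r3 \<longrightarrow> \<bar>y\<bar> < r3 \<longrightarrow> X x y \<noteq> 0"
    using has_fps2_nonzero_near[OF X] X0 by auto
  have "hy 0 0 = 1"
    using has_fps_expansion_imp_nth_0[OF has_fps2_slice_0[OF hy]] H(3) by simp
  then obtain r4 where r4: "r4 > 0" "\<forall>x y. \<bar>x\<bar> < r4 \<longrightarrow> \<bar>y\<bar> < r4 \<longrightarrow> \<bar>hy x y - 1\<bar> < 1 / 2"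
    using has_fps2_near[OF hy, of "1 / 2"] by auto
  obtain r5 where r5: "r5 > 0" "\<forall>x y. \<bar>x\<bar> < r5 \<longrightarrow> \<bar>y\<bar> < r5 \<longrightarrow> (h x has_real_derivative hy x y) (at y)"
    using has_fps2_partial_outer[OF h] unfolding hy_def by blast

  have W_exp: "W has_fps_expansion \<H> $ 0" unfolding W_def by (rule fps2_conv_imp_inner[OF H(1)])
  \<comment> \<open>Half of the leading coefficient of \<open>sg \<sigma> * W\<close>, so that the
    quotient by x^K, which tends to 2 c, exceeds c near 0.\<close>
  define c where "c = sg \<sigma> * \<H> $ 0 $ K / 2"
  have c: "c > 0" using HK by (simp add: c_def)
  have split: "\<H> $ 0 = fps_X ^ K * fps_shift K (\<H> $ 0)"
    by (rule fps_ext) (use low in \<open>auto simp: fps_X_power_mult_nth\<close>)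
  define w where "w = eval_fps (fps_shift K (\<H> $ 0))"
  have w_exp: "w has_fps_expansion fps_shift K (\<H> $ 0)"
    unfolding w_def using W_exp by (intro eval_fps_has_fps_expansion) (simp add: has_fps_expansion_def)
  have "(\<lambda>x. x ^ K * w x) has_fps_expansion \<H> $ 0"
    by (subst split) (intro has_fps_expansion_mult has_fps_expansion_fps_X_power w_exp)
  then have Ww: "eventually (\<lambda>x. W x = x ^ K * w x) (nhds 0)"
    by (simp add: has_fps_expansion_def W_def)
  have "w 0 = \<H> $ 0 $ K" using has_fps_expansion_imp_nth_0[OF w_exp] by simp
  moreover have "isCont w 0" using has_fps_expansion_imp_continuous[OF w_exp] .
  ultimately have "(w \<longlongrightarrow> \<H> $ 0 $ K) (nhds 0)"
    by (metis isCont_def tendsto_at_iff_tendsto_nhds)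
  from tendsto_mult_left[OF this, of "sg \<sigma>"] have "((\<lambda>x. sg \<sigma> * w x) \<longlongrightarrow> 2 * c) (nhds 0)"
    by (simp add: c_def)
  then have "eventually (\<lambda>x. sg \<sigma> * w x > c) (nhds 0)"
    by (rule order_tendstoD) (use c in simp)
  with Ww have "eventually (\<lambda>x. sg \<sigma> * W x \<ge> c * x ^ K) (nhds 0)"
  proof eventually_elim
    case (elim x)
    have "c * x ^ K \<le> (sg \<sigma> * w x) * x ^ K"
      using elim(2) K zero_le_even_power by (intro mult_right_mono) auto
    then show ?case using elim(1) by (simp add: mult_ac)
  qed
  then obtain r6 where r6: "r6 > 0" "\<And>x. \<bar>x\<bar> < r6 \<Longrightarrow> sg \<sigma> * W x \<ge> c * x ^ K"
    unfolding eventually_nhds_metric by (auto simp: dist_norm)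

  define r where "r = Min {r1, r2, r3, r4, r5, r6}"
  have r: "r > 0" "r \<le> r1" "r \<le> r2" "r \<le> r3" "r \<le> r4" "r \<le> r5" "r \<le> r6"
    using r1 r2 r3 r4 r5 r6 by (auto simp: r_def)
  have below: "sg \<sigma> * h x y \<ge> c * x ^ K + sg \<sigma> * y / 2"
    if x: "\<bar>x\<bar> < r" and y: "\<bar>y\<bar> < r" and sy: "sg \<sigma> * y \<ge> 0" for x y
  proof -
    \<comment> \<open>The mean value theorem in y on the segment between (x, 0) and (x, y), for
      either sign of y.\<close>
    have "\<exists>z. \<bar>z\<bar> < r \<and> h x y - h x 0 = hy x z * y"
    proof (cases "y = 0")
      case False
      have d: "(h x has_real_derivative hy x z) (at z)" if "\<bar>z\<bar> \<le> \<bar>y\<bar>" for z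
        using r5 x y r that by auto
      show ?thesis
      proof (cases "y > 0")
        case True
        have "\<exists>z>0. z < y \<and> h x y - h x 0 = (y - 0) * hy x z"
          by (rule MVT2[OF True]) (use d in auto)
        then show ?thesis using y by (metis abs_of_pos diff_zero less_trans mult.commute)
      next
        case neg: False
        have "\<exists>z>y. z < 0 \<and> h x 0 - h x y = (0 - y) * hy x z"
          by (rule MVT2) (use d neg False in auto)
        then obtain z where z: "z > y" "z < 0" "h x 0 - h x y = (0 - y) * hy x z" by blast
        have "\<bar>z\<bar> < r" using y z(1,2) by simp
        moreover have "h x y - h x 0 = hy x z * y" using z(3) by (simp add: mult.commute)
        ultimately show ?thesis by blast
      qed
    qed (use r in \<open>auto intro: exI[of _ 0]\<close>)
    then obtain z where z: "\<bar>z\<bar> < r" "h x y - h x 0 = hy x z * y" by blast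
    have "\<bar>hy x z - 1\<bar> < 1 / 2" using r4 x z r by auto
    then have "hy x z \<ge> 1 / 2" by linarith
    then have "1 / 2 * (sg \<sigma> * y) \<le> hy x z * (sg \<sigma> * y)" using sy by (rule mult_right_mono)
    also have "\<dots> = sg \<sigma> * h x y - sg \<sigma> * W x"
      using z(2) hW[of x] by (simp add: algebra_simps)
    finally show ?thesis using r6(2)[of x] x r by simp
  qed
  have confined: "eventually (\<lambda>x. \<bar>\<phi> x\<bar> < \<rho> \<and> W (\<phi> x) = W x \<and> \<phi> x \<noteq> x) (at 0)" if \<rho>: "0 < \<rho>" "\<rho> < r" for \<rho>
  proof -
    have "W 0 = 0" using has_fps_expansion_imp_nth_0[OF W_exp] low K by simp
    moreover have "isCont W 0" using has_fps_expansion_imp_continuous[OF W_exp] .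
    ultimately have "(W \<longlongrightarrow> 0) (nhds 0)"
      by (metis isCont_def tendsto_at_iff_tendsto_nhds)
    from tendsto_mult_left[OF this, of "sg \<sigma>"] have "((\<lambda>x. sg \<sigma> * W x) \<longlongrightarrow> 0) (nhds 0)"
      by simp
    moreover have "min (c * \<rho> ^ K) (\<rho> / 2) > 0" using c \<rho> by simp
    ultimately have "eventually (\<lambda>x. sg \<sigma> * W x < min (c * \<rho> ^ K) (\<rho> / 2)) (nhds 0)"
      by (rule order_tendstoD)
    then have "eventually (\<lambda>x. sg \<sigma> * W x < min (c * \<rho> ^ K) (\<rho> / 2)) (at 0)"
      by (simp add: eventually_nhds_conv_at)
    moreover have "eventually (\<lambda>x. \<bar>x\<bar> < \<rho>) (at 0)"
      unfolding eventually_at by (intro exI[of _ \<rho>]) (use \<rho> in \<open>simp add: dist_norm\<close>)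
    moreover have "eventually (\<lambda>x. returns_at \<sigma> U X Y x (\<phi> x)) (at 0)"
      using \<phi> by (simp add: half_return_map_def)
    ultimately show ?thesis
    proof eventually_elim
      case (elim x)
      have 1: "((\<lambda>(x, y). h x y) has_derivative (\<lambda>(a, b). hx x y * a + hy x y * b)) (at (x, y))"
        and 2: "X x y \<noteq> 0" and 3: "hx x y * X x y + hy x y * Y x y = 0" if "\<bar>x\<bar> < r" "\<bar>y\<bar> < r" for x y
        using r1(2) r2(2) r3(2) r that by auto
      have 4: "sg \<sigma> * h x 0 < c * \<rho> ^ K" "sg \<sigma> * h x 0 < \<rho> / 2"
        using elim(1) by (simp_all add: hW)
      note oc = orbit_confined[OF elim(3) 1 2 3 below c K(1) \<rho>(2) elim(2) 4]
      have "\<bar>\<phi> x\<bar> < \<rho>" by (rule oc(1))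
      moreover have "h (\<phi> x) 0 = h x 0" by (rule oc(2))
      moreover have "\<phi> x \<noteq> x" by (rule oc(3))
      ultimately show ?case by (simp add: hW)
    qed
  qed
  show "eventually (\<lambda>x. eval_fps (\<H> $ 0) (\<phi> x) = eval_fps (\<H> $ 0) x \<and> \<phi> x \<noteq> x) (at 0)"
    using confined[of "r / 2"] r(1) by (auto simp: W_def elim: eventually_mono)
  show "(\<phi> \<longlongrightarrow> 0) (nhds 0)"
  proof -
    have "\<phi> 0 = 0" using \<phi> by (simp add: half_return_map_def)
    moreover have "(\<phi> \<longlongrightarrow> 0) (at 0)"
    proof (rule tendstoI)
      fix e :: real assume "e > 0"
      then have "eventually (\<lambda>x. \<bar>\<phi> x\<bar> < min e (r / 2) \<and> W (\<phi> x) = W x \<and> \<phi> x \<noteq> x) (at 0)"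
        using r(1) by (intro confined) auto
      then show "eventually (\<lambda>x. dist (\<phi> x) 0 < e) (at 0)"
        by eventually_elim simp
    qed
    ultimately show ?thesis by (metis tendsto_at_iff_tendsto_nhds)
  qed
qed

section \<open>Comparison of coefficients in the equation for the half-return map\<close>

lemma fps_power_coeff_linear:
  fixes \<alpha> :: "nat \<Rightarrow> real"
  assumes \<alpha>0: "\<alpha> 0 = 0" and n: "n \<ge> 2" and K: "K \<ge> 1"
  shows "(Abs_fps \<alpha> ^ K) $ (n + K - 1) = (Abs_fps (\<alpha>(n := 0)) ^ K) $ (n + K - 1) + real K * \<alpha> 1 ^ (K - 1) * \<alpha> n"
proof -
  define \<beta> where "\<beta> = Abs_fps (\<alpha>(n := 0))"
  define \<beta>' where "\<beta>' = fps_shift 1 \<beta>"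
  have \<beta>: "\<beta> = fps_X * \<beta>'"
    by (rule fps_ext) (use \<alpha>0 n in \<open>auto simp: \<beta>_def \<beta>'_def\<close>)
  \<comment> \<open>The term of degree n is split off. The j-th term of the binomial expansion has
    order at least n j + K - j, which exceeds n + K - 1 once j \<ge> 2 because n \<ge> 2. So
    \<open>\<alpha> n\<close> enters linearly, through j = 1, with the lowest coefficient of
    \<beta>^(K - 1) as factor.\<close>
  have "Abs_fps \<alpha> = fps_const (\<alpha> n) * fps_X ^ n + \<beta>"
    by (rule fps_ext) (auto simp: \<beta>_def fps_X_power_nth)
  then have "Abs_fps \<alpha> ^ K = (\<Sum>j\<le>K. of_nat (K choose j) * (fps_const (\<alpha> n) * fps_X ^ n) ^ j * \<beta> ^ (K - j))"
    by (simp only: binomial_ring)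
  also have "\<dots> $ (n + K - 1) = (\<Sum>j\<le>K. (of_nat (K choose j) * (fps_const (\<alpha> n) * fps_X ^ n) ^ j * \<beta> ^ (K - j)) $ (n + K - 1))"
    by (simp only: fps_sum_nth)
  also have "\<dots> = (\<Sum>j\<in>{0, 1}. (of_nat (K choose j) * (fps_const (\<alpha> n) * fps_X ^ n) ^ j * \<beta> ^ (K - j)) $ (n + K - 1))"
  proof (rule sum.mono_neutral_right)
    show "\<forall>j\<in>{..K} - {0, 1}. (of_nat (K choose j) * (fps_const (\<alpha> n) * fps_X ^ n) ^ j * \<beta> ^ (K - j)) $ (n + K - 1) = 0"
    proof
      fix j assume j: "j \<in> {..K} - {0, 1}"
      then obtain i where i: "j = i + 2" by (metis Diff_iff insertI1 insertI2 One_nat_def add_2_eq_Suc' not0_implies_Suc)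
      have "of_nat (K choose j) * (fps_const (\<alpha> n) * fps_X ^ n) ^ j * \<beta> ^ (K - j)
          = fps_X ^ (n * j + (K - j)) * (of_nat (K choose j) * fps_const (\<alpha> n) ^ j * \<beta>' ^ (K - j))"
        unfolding \<beta> power_mult_distrib power_mult[symmetric] power_add by (simp only: mult_ac)
      moreover have "n + K - 1 < n * j + (K - j)"
      proof -
        obtain n' where n': "n = n' + 2" using n by (metis le_add_diff_inverse2)
        obtain K' where K': "K = K' + j" using j by (metis DiffD1 atMost_iff le_add_diff_inverse2)
        show ?thesis by (simp add: n' K' i algebra_simps)
      qed
      ultimately show "(of_nat (K choose j) * (fps_const (\<alpha> n) * fps_X ^ n) ^ j * \<beta> ^ (K - j)) $ (n + K - 1) = 0"
        by (simp only: fps_X_power_mult_nth if_True)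
    qed
  qed (use K in auto)
  also have "\<dots> = (\<beta> ^ K) $ (n + K - 1) + (fps_X ^ (n + (K - 1)) * (of_nat K * fps_const (\<alpha> n) * \<beta>' ^ (K - 1))) $ (n + K - 1)"
    unfolding \<beta> by (simp add: power_mult_distrib power_add mult_ac)
  also have "(fps_X ^ (n + (K - 1)) * (of_nat K * fps_const (\<alpha> n) * \<beta>' ^ (K - 1))) $ (n + K - 1)
      = real K * \<alpha> 1 ^ (K - 1) * \<alpha> n"
    using K n by (simp add: fps_X_power_mult_nth \<beta>'_def \<beta>_def fps_mult_nth_0 fps_power_zeroth)
  finally show ?thesis by (simp add: \<beta>_def)
qed

text \<open>This is the coefficient n + 2 k - 1 of the composition. The power i = 2 k of \<alpha>
  contributes \<open>\<alpha> n\<close> linearly, with factor - 2 k since \<open>\<alpha> 1\<close>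
  = - 1 is raised to an odd power. The powers i > 2 k involve only \<open>\<alpha> 1\<close>, ...,
  \<open>\<alpha> (n - 1)\<close>, so the equation can be solved for
  \<open>\<alpha> n\<close>.\<close>

lemma involution_coeff_recursion:
  assumes comp: "W oo Abs_fps \<alpha> = W" and \<alpha>: "\<alpha> 0 = 0" "\<alpha> 1 = - 1"
    and low: "\<And>m. m < 2 * k \<Longrightarrow> W $ m = 0" and lead: "W $ (2 * k) \<noteq> 0" and k: "k \<ge> 1" and n: "n \<ge> 2"
  shows "\<alpha> n = (p_poly (fps_nth W) n k \<alpha> - W $ (n + 2 * k - 1)) / (2 * real k * W $ (2 * k))"
proof -
  define K where "K = 2 * k"
  define m where "m = n + K - 1"
  have K: "K \<ge> 1" "odd (K - 1)" "K \<le> m" using k n by (auto simp: K_def m_def)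
  have ob: "ordinary_bell m i \<alpha> = (Abs_fps \<alpha> ^ i) $ m" if "1 \<le> i" "i \<le> m" for i
  proof -
    have "Abs_fps (\<lambda>j. if j = 0 then 0 else \<alpha> j) = Abs_fps \<alpha>" using \<alpha> by (auto simp: fps_eq_iff)
    then show ?thesis using ordinary_bell_eq[OF that] by simp
  qed
  have "Abs_fps (\<lambda>j. if j = 0 then 0 else (\<alpha>(n := 0)) j) = Abs_fps (\<alpha>(n := 0))" using \<alpha> by (auto simp: fps_eq_iff)
  then have obK: "ordinary_bell m K (\<alpha>(n := 0)) = (Abs_fps (\<alpha>(n := 0)) ^ K) $ m"
    using ordinary_bell_eq[OF K(1,3)] by simp
  have "W $ m = (\<Sum>i=0..m. W $ i * (Abs_fps \<alpha> ^ i) $ m)"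
    using comp fps_compose_nth[of W "Abs_fps \<alpha>" m] by simp
  also have "\<dots> = (\<Sum>i=K..m. W $ i * (Abs_fps \<alpha> ^ i) $ m)"
    by (rule sum.mono_neutral_right) (use low K in \<open>auto simp: K_def\<close>)
  also have "\<dots> = W $ K * (Abs_fps \<alpha> ^ K) $ m + (\<Sum>i=K+1..m. W $ i * (Abs_fps \<alpha> ^ i) $ m)"
    using K(3) by (simp add: sum.atLeast_Suc_atMost)
  also have "(\<Sum>i=K+1..m. W $ i * (Abs_fps \<alpha> ^ i) $ m) = (\<Sum>i=K+1..m. W $ i * ordinary_bell m i \<alpha>)"
    by (intro sum.cong refl) (use ob in auto)
  also have "(Abs_fps \<alpha> ^ K) $ m = ordinary_bell m K (\<alpha>(n := 0)) - real K * \<alpha> n"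
    unfolding m_def fps_power_coeff_linear[where \<alpha> = \<alpha>, OF \<alpha>(1) n K(1)] using obK \<alpha>(2) K(2) by (simp add: m_def)
  finally have "W $ m = p_poly (fps_nth W) n k \<alpha> - real K * W $ K * \<alpha> n"
    by (simp add: p_poly_def m_def K_def algebra_simps)
  then show ?thesis using lead k by (simp add: K_def m_def field_simps)
qed

section \<open>Expansions behind the definitions of y_i, f and g\<close>

lemma fps_higher_deriv_X_power:
  "(fps_deriv ^^ l) (fps_X ^ n) = (if l \<le> n then fps_const (fact n / fact (n - l)) * fps_X ^ (n - l) else (0 :: real fps))"
proof (induction l)
  case (Suc l)
  show ?case
  proof (cases "Suc l \<le> n")
    case True
    then obtain d where d: "n - l = Suc d" "n - Suc l = d" by (metis Suc_diff_Suc less_eq_Suc_le)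
    have "(fps_deriv ^^ l) (fps_X ^ n) = (fps_const (fact n / fact (Suc d)) * fps_X ^ Suc d :: real fps)"
      using Suc.IH True d by (simp del: fact_Suc power_Suc)
    then have "(fps_deriv ^^ Suc l) (fps_X ^ n) = fps_deriv (fps_const (fact n / fact (Suc d)) * fps_X ^ Suc d :: real fps)"
      by (simp only: funpow.simps o_apply)
    also have "\<dots> = fps_const (fact n / fact (Suc d)) * (fps_const (real (Suc d)) * fps_X ^ d)"
      by (simp add: fps_deriv_power' fps_of_nat del: power_Suc of_nat_Suc fact_Suc)
    also have "\<dots> = fps_const (fact n / fact (Suc d) * real (Suc d)) * fps_X ^ d"
      by (simp only: mult.assoc[symmetric] fps_const_mult)
    also have "fact n / fact (Suc d) * real (Suc d) = (fact n / fact d :: real)"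
      by (simp add: field_simps del: of_nat_Suc)
    finally show ?thesis using True by (simp add: d)
  next
    case False
    then show ?thesis using Suc by (cases "l = n") auto
  qed
qed simp

text \<open>With p = K - 1 this is the bracket in the recursion for y_i. The bound
  \<open>min m K\<close> on l covers its two cases at once.\<close>

lemma fps_higher_deriv_leading:
  fixes f :: "real fps"
  shows "(fps_deriv ^^ m) (fps_const a * fps_X ^ p + fps_X ^ K * f)
    = (if m \<le> p then fps_const (a * (fact p / fact (p - m))) * fps_X ^ (p - m) else 0)
      + (\<Sum>l\<le>min m K. fps_const (real (m choose l) * (fact K / fact (K - l))) * fps_X ^ (K - l) * (fps_deriv ^^ (m - l)) f)"
proof -
  have add: "(fps_deriv ^^ m) (u + v) = (fps_deriv ^^ m) u + (fps_deriv ^^ m) v" for u v :: "real fps"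
    by (induction m) simp_all
  have cmult: "(fps_deriv ^^ m) (fps_const a * u) = fps_const a * (fps_deriv ^^ m) u" for u :: "real fps"
    by (induction m) simp_all
  have "(fps_deriv ^^ m) (fps_X ^ K * f) = (\<Sum>l\<le>m. of_nat (m choose l) * (fps_deriv ^^ l) (fps_X ^ K) * (fps_deriv ^^ (m - l)) f)"
    by (rule derivation_funpow_mult) (simp_all add: add.commute)
  also have "\<dots> = (\<Sum>l\<le>min m K. of_nat (m choose l) * (fps_deriv ^^ l) (fps_X ^ K) * (fps_deriv ^^ (m - l)) f)"
    by (rule sum.mono_neutral_right) (auto simp: fps_higher_deriv_X_power)
  also have "\<dots> = (\<Sum>l\<le>min m K. fps_const (real (m choose l) * (fact K / fact (K - l))) * fps_X ^ (K - l) * (fps_deriv ^^ (m - l)) f)"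
    by (intro sum.cong refl) (simp add: fps_higher_deriv_X_power fps_of_nat[symmetric] mult.assoc[symmetric])
  finally show ?thesis
    unfolding add cmult by (simp add: fps_higher_deriv_X_power mult.assoc[symmetric])
qed

text \<open>On y = 0 the equation reads W' = - F H_y, where F has order at least K - 1 in x and H_y
  is 1 at the origin.\<close>

lemma first_integral_leading:
  fixes \<H> F :: "real fps fps"
  assumes H: "fps_deriv_inner \<H> = - F * fps_deriv \<H>" and H0: "\<And>j. \<H> $ j $ 0 = (if j = 1 then 1 else 0)"
    and F: "\<And>m. m < K - 1 \<Longrightarrow> F $ 0 $ m = 0" and K: "K \<ge> 1"
  shows "m < K \<Longrightarrow> \<H> $ 0 $ m = 0" and "real K * \<H> $ 0 $ K = - F $ 0 $ (K - 1)"
proof -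
  have "fps_deriv (\<H> $ 0) = - (F $ 0 * \<H> $ 1)"
    using arg_cong[OF H, of "\<lambda>G. G $ 0"] by simp
  then have "fps_deriv (\<H> $ 0) $ m = - (\<Sum>i=0..m. F $ 0 $ i * \<H> $ 1 $ (m - i))" for m
    by (simp add: fps_mult_nth)
  then have rec: "real (Suc m) * \<H> $ 0 $ Suc m = - (\<Sum>i=0..m. F $ 0 $ i * \<H> $ 1 $ (m - i))" for m
    by (simp del: of_nat_Suc)
  show "m < K \<Longrightarrow> \<H> $ 0 $ m = 0"
  proof (cases m)
    case (Suc m')
    assume "m < K"
    then have "(\<Sum>i=0..m'. F $ 0 $ i * \<H> $ 1 $ (m' - i)) = 0"
      using Suc F by (intro sum.neutral) auto
    then show ?thesis using rec[of m'] Suc by (simp del: of_nat_Suc)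
  qed (use H0[of 0] in simp)
  have "(\<Sum>i=0..K-1. F $ 0 $ i * \<H> $ 1 $ (K - 1 - i)) = (\<Sum>i\<in>{K-1}. F $ 0 $ i * \<H> $ 1 $ (K - 1 - i))"
    using F by (intro sum.mono_neutral_right) auto
  then show "real K * \<H> $ 0 $ K = - F $ 0 $ (K - 1)"
    using rec[of "K - 1"] K H0[of 1] by simp
qed

lemma has_fps2_pd_0:
  assumes "h has_fps2 F"
  shows "pd m n h 0 0 = fact m * fact n * F $ n $ m"
  using has_fps_expansion_imp_nth_0[OF has_fps2_pd[OF assms, of m n]]
  by (simp add: fps_0th_higher_deriv)

text \<open>Off 0 the quotient equals a function with an expansion, so the value chosen by
  \<open>Lim\<close> is its constant coefficient. This serves f in the variable x and g in the
  variable y.\<close>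

lemma Lim_removable:
  fixes q :: "real \<Rightarrow> real"
  assumes S: "s has_fps_expansion S" and q: "eventually (\<lambda>x. q x = s x) (at 0)"
  shows "Lim (at 0) q = S $ 0"
    and "(\<lambda>x. if x = 0 then Lim (at 0) q else q x) has_fps_expansion S"
proof -
  have s0: "s 0 = S $ 0" by (rule has_fps_expansion_imp_nth_0[OF S])
  have "isCont s 0" using has_fps_expansion_imp_continuous[OF S] .
  then have "(s \<longlongrightarrow> S $ 0) (at 0)" using s0 by (simp add: isCont_def)
  then have "(q \<longlongrightarrow> S $ 0) (at 0)" using q by (subst tendsto_cong) auto
  then show L: "Lim (at 0) q = S $ 0" by (intro tendsto_Lim) auto
  have "eventually (\<lambda>x. s x = (if x = 0 then Lim (at 0) q else q x)) (nhds 0)"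
    using q s0 unfolding L eventually_at_filter by (auto elim!: eventually_mono)
  then show "(\<lambda>x. if x = 0 then Lim (at 0) q else q x) has_fps_expansion S"
    by (rule has_fps_expansion_cong_real[OF S])
qed

text \<open>A coefficient of a power depends only on the coefficients up to the same index. This
  fits the strong induction for y_i, in which only the earlier functions have known
  expansions.\<close>

lemma fps_family_power_expansion:
  fixes v :: "nat \<Rightarrow> real \<Rightarrow> real"
  assumes "\<And>p. p \<le> n \<Longrightarrow> v p has_fps_expansion V $ p"
  shows "p \<le> n \<Longrightarrow> (\<lambda>x. (Abs_fps (\<lambda>p. v p x) ^ j) $ p) has_fps_expansion (V ^ j) $ p"
proof (induction j arbitrary: p)
  case (Suc j)
  show ?case
    unfolding power_Suc fps_mult_nth
    by (intro has_fps_expansion_sum has_fps_expansion_mult) (use Suc assms in auto)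
qed auto

section \<open>The half-return maps\<close>

locale tangential_side =
  fixes X Y :: planar and k :: "side \<Rightarrow> nat" and \<sigma> :: side and U :: "(real \<times> real) set"
  assumes U: "open U" "(0, 0) \<in> U"
    and X_ana: "real_analytic2_on (X \<sigma>) U" and Y_ana: "real_analytic2_on (Y \<sigma>) U"
    and k1: "k \<sigma> \<ge> 1" and mono: "monodromic_tangential X Y k"
begin

definition \<epsilon> :: real where "\<epsilon> = sg \<sigma> * delta X"
definition K :: nat where "K = 2 * k \<sigma>"
definition a :: real where "a = a_coeff X Y k \<sigma>"

lemma K: "K \<ge> 2" "even K" "K \<ge> 1" "K > 0"
  using k1 by (auto simp: K_def)

lemma X0: "X \<sigma> 0 0 \<noteq> 0"
  using mono by (simp add: monodromic_tangential_def)

lemma delta: "delta X * delta X = 1" "delta X \<noteq> 0"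
proof -
  have "X Plus 0 0 \<noteq> 0" using mono by (simp add: monodromic_tangential_def)
  then show "delta X * delta X = 1" "delta X \<noteq> 0" by (auto simp: delta_def sgn_if)
qed

lemma eps: "\<epsilon> * \<epsilon> = 1" "\<epsilon> \<noteq> 0"
proof -
  have "sg \<sigma> * sg \<sigma> = 1" by (cases \<sigma>) auto
  moreover have "\<epsilon> * \<epsilon> = (sg \<sigma> * sg \<sigma>) * (delta X * delta X)" unfolding \<epsilon>_def by (simp only: mult_ac)
  ultimately show "\<epsilon> * \<epsilon> = 1" using delta by simp
  then show "\<epsilon> \<noteq> 0" by auto
qed

text \<open>By C3 the first components have opposite signs at the origin, so \<epsilon> is the sign
  of \<open>X \<sigma> 0 0\<close> on either side, although \<open>delta\<close> is defined from the
  side \<open>Plus\<close>.\<close>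

lemma eps_abs: "\<bar>X \<sigma> 0 0\<bar> = \<epsilon> * X \<sigma> 0 0"
proof -
  have "X Plus 0 0 * X Minus 0 0 < 0" using mono by (simp add: monodromic_tangential_def)
  then show ?thesis
    unfolding \<epsilon>_def delta_def by (cases \<sigma>) (auto simp: sgn_if mult_less_0_iff)
qed

definition A :: "real fps fps" where "A = (SOME A. X \<sigma> has_fps2 A)"
definition B :: "real fps fps" where "B = (SOME B. Y \<sigma> has_fps2 B)"

lemma local_expansion:
  assumes "(x0, y0) \<in> U"
  shows "\<exists>A. (\<lambda>x y. X \<sigma> (x0 + x) (y0 + y)) has_fps2 A" "\<exists>B. (\<lambda>x y. Y \<sigma> (x0 + x) (y0 + y)) has_fps2 B"
  using assms X_ana Y_ana by (auto simp: real_analytic2_on_iff)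

lemma A: "X \<sigma> has_fps2 A" and B: "Y \<sigma> has_fps2 B"
  unfolding A_def B_def using local_expansion[OF U(2)] by (simp_all add: someI_ex)

lemma A0: "A $ 0 $ 0 = X \<sigma> 0 0"
  using has_fps_expansion_imp_nth_0[OF has_fps2_slice_0[OF A]] by simp

definition D :: "real fps fps" where "D = (SOME D. A * D = 1 \<and> (\<lambda>x y. inverse (X \<sigma> x y)) has_fps2 D)"

lemma D: "A * D = 1" "(\<lambda>x y. inverse (X \<sigma> x y)) has_fps2 D"
proof -
  have "\<exists>D. A * D = 1 \<and> (\<lambda>x y. inverse (X \<sigma> x y)) has_fps2 D"
    using has_fps2_inverse[OF A] A0 X0 by metis
  from someI_ex[OF this] show "A * D = 1" "(\<lambda>x y. inverse (X \<sigma> x y)) has_fps2 D"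
    by (auto simp: D_def)
qed

text \<open>The slope Y / X of the orbits. Since \<epsilon> * \<epsilon> = 1, the field E is
  \<epsilon> times d/dx + F d/dy, so its first integrals solve H_x = - F H_y.\<close>

definition F :: "real fps fps" where "F = B * D"
definition \<eta> :: "real fps fps" where "\<eta> = fps_const (fps_const \<epsilon>) * F"
definition fs :: "real fps" where "fs = fps_shift K (\<eta> $ 0)"
definition gs :: "real fps fps" where "gs = fps_shift 1 \<eta>"

lemma F: "(\<lambda>x y. Y \<sigma> x y * inverse (X \<sigma> x y)) has_fps2 F" "B = F * A" "fps2_conv F"
proof -
  show F: "(\<lambda>x y. Y \<sigma> x y * inverse (X \<sigma> x y)) has_fps2 F"
    unfolding F_def by (rule has_fps2_mult[OF B D(2)])
  show "B = F * A" using D(1) by (simp add: F_def mult.assoc mult.commute[of D])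
  show "fps2_conv F" using F by (simp add: has_fps2_def)
qed

lemma \<eta>: "(\<lambda>x y. \<epsilon> * (Y \<sigma> x y * inverse (X \<sigma> x y))) has_fps2 \<eta>" "fps2_conv \<eta>"
proof -
  show *: "(\<lambda>x y. \<epsilon> * (Y \<sigma> x y * inverse (X \<sigma> x y))) has_fps2 \<eta>"
    unfolding \<eta>_def by (rule has_fps2_cmult[OF F(1)])
  then show "fps2_conv \<eta>" by (simp add: has_fps2_def)
qed

lemma B_low: "m < K - 1 \<Longrightarrow> B $ 0 $ m = 0"
proof -
  assume m: "m < K - 1"
  have "pd m 0 (Y \<sigma>) 0 0 = 0"
  proof (cases "m = 0")
    case True
    then show ?thesis using mono by (simp add: monodromic_tangential_def pd_def)
  next
    case False
    then have "m \<in> {1..2 * k \<sigma> - 2}" using m by (auto simp: K_def)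
    then show ?thesis using mono by (auto simp: monodromic_tangential_def)
  qed
  then show ?thesis using has_fps2_pd_0[OF B, of m 0] by simp
qed

lemma B_lead: "pd (K - 1) 0 (Y \<sigma>) 0 0 = fact (K - 1) * B $ 0 $ (K - 1)"
  using has_fps2_pd_0[OF B, of "K - 1" 0] by simp

lemma F_low: "m < K - 1 \<Longrightarrow> F $ 0 $ m = 0"
  unfolding F_def by (simp add: fps_mult_nth B_low)

lemma D0: "D $ 0 $ 0 = 1 / X \<sigma> 0 0"
  using has_fps_expansion_imp_nth_0[OF has_fps2_slice_0[OF D(2)]] by (simp add: inverse_eq_divide)

lemma F_lead: "F $ 0 $ (K - 1) = \<epsilon> * a"
proof -
  have "F $ 0 $ (K - 1) = (\<Sum>i=0..K-1. B $ 0 $ i * D $ 0 $ (K - 1 - i))"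
    by (simp add: F_def fps_mult_nth)
  also have "\<dots> = (\<Sum>i\<in>{K-1}. B $ 0 $ i * D $ 0 $ (K - 1 - i))"
    by (rule sum.mono_neutral_right) (use B_low in auto)
  also have "\<dots> = B $ 0 $ (K - 1) / X \<sigma> 0 0" by (simp add: D0)
  finally have 1: "F $ 0 $ (K - 1) = B $ 0 $ (K - 1) / X \<sigma> 0 0" .
  have "a = B $ 0 $ (K - 1) / (\<epsilon> * X \<sigma> 0 0)"
    using B_lead by (simp add: a_def a_coeff_def K_def eps_abs)
  then have "\<epsilon> * a = B $ 0 $ (K - 1) / X \<sigma> 0 0" using eps by simp
  with 1 show ?thesis by simp
qed

lemma \<eta>0: "\<eta> $ 0 = fps_const a * fps_X ^ (K - 1) + fps_X ^ K * fs"
proof (rule fps_ext)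
  fix m
  consider "m < K - 1" | "m = K - 1" | "m \<ge> K" by linarith
  then show "\<eta> $ 0 $ m = (fps_const a * fps_X ^ (K - 1) + fps_X ^ K * fs) $ m"
  proof cases
    case 1
    then show ?thesis using K F_low by (simp add: \<eta>_def fps_X_power_mult_nth fps_X_power_nth)
  next
    case 2
    have "\<epsilon> * (\<epsilon> * a) = a" using eps by (simp add: mult.assoc[symmetric])
    then show ?thesis using 2 K F_lead by (simp add: \<eta>_def fps_X_power_mult_nth fps_X_power_nth)
  next
    case 3
    then show ?thesis using K by (simp add: fs_def fps_X_power_mult_nth fps_X_power_nth)
  qed
qed

text \<open>The two inequalities of C2 in one, divided by the square of X at the origin. It makes
  \<open>sg \<sigma> * W\<close> start with a positive term, on which the confinement of orbits
  rests.\<close>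

lemma sign_a: "sg \<sigma> * \<epsilon> * a < 0"
proof -
  have "sg \<sigma> * (X \<sigma> 0 0 * pd (K - 1) 0 (Y \<sigma>) 0 0) < 0"
    using mono unfolding K_def by (cases \<sigma>) (auto simp: monodromic_tangential_def)
  then have "sg \<sigma> * (X \<sigma> 0 0 * B $ 0 $ (K - 1)) < 0"
    unfolding B_lead by (simp add: mult_less_0_iff zero_less_mult_iff)
  moreover have "B $ 0 $ (K - 1) = X \<sigma> 0 0 * F $ 0 $ (K - 1)"
  proof -
    have "B $ 0 $ (K - 1) = (\<Sum>i=0..K-1. F $ 0 $ i * A $ 0 $ (K - 1 - i))"
      using arg_cong[OF F(2), of "\<lambda>G. G $ 0 $ (K - 1)"] by (simp add: fps_mult_nth)
    also have "\<dots> = (\<Sum>i\<in>{K-1}. F $ 0 $ i * A $ 0 $ (K - 1 - i))"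
      by (rule sum.mono_neutral_right) (use F_low in auto)
    finally show ?thesis by (simp add: A0)
  qed
  ultimately have "sg \<sigma> * (X \<sigma> 0 0 * (X \<sigma> 0 0 * (\<epsilon> * a))) < 0"
    by (simp only: F_lead)
  then have "(X \<sigma> 0 0 * X \<sigma> 0 0) * (sg \<sigma> * \<epsilon> * a) < 0"
    by (simp only: mult_ac)
  then show ?thesis using X0 by (simp add: mult_less_0_iff)
qed

section \<open>Analyticity of the quotients f and g\<close>

lemma X_nonzero_near: "\<exists>r>0. \<forall>x y. \<bar>x\<bar> < r \<longrightarrow> \<bar>y\<bar> < r \<longrightarrow> X \<sigma> x y \<noteq> 0"
  by (rule has_fps2_nonzero_near[OF A X0])

definition r0 :: real where
  "r0 = (SOME r. r > 0 \<and> (\<forall>x y. \<bar>x\<bar> < r \<longrightarrow> \<bar>y\<bar> < r \<longrightarrow> X \<sigma> x y \<noteq> 0 \<and> (x, y) \<in> U))"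

lemma r0: "r0 > 0" "\<bar>x\<bar> < r0 \<Longrightarrow> \<bar>y\<bar> < r0 \<Longrightarrow> X \<sigma> x y \<noteq> 0" "\<bar>x\<bar> < r0 \<Longrightarrow> \<bar>y\<bar> < r0 \<Longrightarrow> (x, y) \<in> U"
proof -
  obtain r1 where r1: "r1 > 0" "\<forall>x y. \<bar>x\<bar> < r1 \<longrightarrow> \<bar>y\<bar> < r1 \<longrightarrow> X \<sigma> x y \<noteq> 0"
    using X_nonzero_near by blast
  obtain S T where ST: "open S" "open T" "(0, 0) \<in> S \<times> T" "S \<times> T \<subseteq> U"
    using open_prod_elim[OF U] by blast
  obtain s t where s: "s > 0" "ball 0 s \<subseteq> S" and t: "t > 0" "ball 0 t \<subseteq> T"
    using ST by (metis mem_Sigma_iff openE)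
  have "min r1 (min s t) > 0 \<and> (\<forall>x y. \<bar>x\<bar> < min r1 (min s t) \<longrightarrow> \<bar>y\<bar> < min r1 (min s t) \<longrightarrow> X \<sigma> x y \<noteq> 0 \<and> (x, y) \<in> U)"
    using r1 s t ST(4) by (auto simp: subset_iff)
  then have "r0 > 0 \<and> (\<forall>x y. \<bar>x\<bar> < r0 \<longrightarrow> \<bar>y\<bar> < r0 \<longrightarrow> X \<sigma> x y \<noteq> 0 \<and> (x, y) \<in> U)"
    unfolding r0_def by (rule someI)
  then show "r0 > 0" "\<bar>x\<bar> < r0 \<Longrightarrow> \<bar>y\<bar> < r0 \<Longrightarrow> X \<sigma> x y \<noteq> 0" "\<bar>x\<bar> < r0 \<Longrightarrow> \<bar>y\<bar> < r0 \<Longrightarrow> (x, y) \<in> U"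
    by blast+
qed

text \<open>\<open>\<eta>0\<close> and the definition of f both split \<epsilon> Y / X on y = 0 into
  a x^(K - 1) and x^K times a remainder, so the remainders agree off 0.\<close>

lemma f_fun_expansion: "f_fun X Y k \<sigma> has_fps_expansion fs"
proof -
  have "fps_conv_radius (\<eta> $ 0) > 0"
    using fps2_conv_imp_inner[OF \<eta>(2), of 0] by (simp add: has_fps_expansion_def)
  then have fs: "eval_fps fs has_fps_expansion fs"
    unfolding fs_def by (intro eval_fps_has_fps_expansion) simp
  have "(\<lambda>x. a * x ^ (K - 1) + x ^ K * eval_fps fs x) has_fps_expansion \<eta> $ 0"
    unfolding \<eta>0 by (intro fps_expansion_intros fs)
  moreover have "(\<lambda>x. \<epsilon> * (Y \<sigma> x 0 * inverse (X \<sigma> x 0))) has_fps_expansion \<eta> $ 0"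
    using has_fps2_slice_0[OF \<eta>(1)] by simp
  ultimately have "eventually (\<lambda>x. a * x ^ (K - 1) + x ^ K * eval_fps fs x = eval_fps (\<eta> $ 0) x) (nhds 0)"
    "eventually (\<lambda>x. \<epsilon> * (Y \<sigma> x 0 * inverse (X \<sigma> x 0)) = eval_fps (\<eta> $ 0) x) (nhds 0)"
    by (simp_all add: has_fps_expansion_def eq_commute)
  moreover have "eventually (\<lambda>x. X \<sigma> x 0 \<noteq> 0) (nhds 0)"
    unfolding eventually_nhds_metric using r0 by (intro exI[of _ r0]) (simp add: dist_norm)
  ultimately have "eventually (\<lambda>x. x \<noteq> 0 \<longrightarrow> f_quot X Y k \<sigma> x = eval_fps fs x) (nhds 0)"
  proof eventually_elim
    case (elim x)
    show ?case
    proof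
      assume x: "x \<noteq> 0"
      have "\<epsilon> * Y \<sigma> x 0 = (a * x ^ (K - 1) + x ^ K * eval_fps fs x) * X \<sigma> x 0"
        using elim by (simp add: field_simps)
      then have "\<epsilon> * Y \<sigma> x 0 - a * x ^ (K - 1) * X \<sigma> x 0 = eval_fps fs x * (x ^ K * X \<sigma> x 0)"
        by (simp add: algebra_simps)
      moreover have "f_quot X Y k \<sigma> x = (\<epsilon> * Y \<sigma> x 0 - a * x ^ (K - 1) * X \<sigma> x 0) / (x ^ K * X \<sigma> x 0)"
        by (simp only: f_quot_def \<epsilon>_def a_def K_def)
      ultimately show "f_quot X Y k \<sigma> x = eval_fps fs x"
        using x elim(3) by simp
    qed
  qed
  then have "eventually (\<lambda>x. f_quot X Y k \<sigma> x = eval_fps fs x) (at 0)"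
    by (simp add: eventually_at_filter)
  from Lim_removable(2)[OF fs this] show ?thesis
    by (simp add: f_fun_def[abs_def])
qed

text \<open>The product y g is \<epsilon> Y / X minus its value at y = 0, so g has the outer shift
  of that expansion. The base point x0 is free because the singularity extends along the line y =
  0.\<close>

lemma g_fun_expansion_at:
  assumes x0: "\<bar>x0\<bar> < r0"
    and \<eta>': "(\<lambda>x y. \<epsilon> * (Y \<sigma> (x0 + x) y * inverse (X \<sigma> (x0 + x) y))) has_fps2 \<eta>'"
  shows "(\<lambda>x y. g_fun X Y \<sigma> (x0 + x) y) has_fps2 fps_shift 1 \<eta>'"
proof -
  define S where "S = eval_fps2 (fps_shift 1 \<eta>')"
  have conv: "fps2_conv (fps_shift 1 \<eta>')" using \<eta>' fps2_conv_shift by (simp add: has_fps2_def)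
  have S: "S has_fps2 fps_shift 1 \<eta>'" unfolding S_def by (rule has_fps2_eval[OF conv])
  obtain r1 where r1: "r1 > 0" "\<forall>x y. \<bar>x\<bar> < r1 \<longrightarrow> \<bar>y\<bar> < r1 \<longrightarrow>
      \<epsilon> * (Y \<sigma> (x0 + x) y * inverse (X \<sigma> (x0 + x) y))
        = \<epsilon> * (Y \<sigma> (x0 + x) 0 * inverse (X \<sigma> (x0 + x) 0)) + y * S x y"
    using has_fps2_split[OF \<eta>'] unfolding S_def by blast
  obtain r2 where r2: "r2 > 0" "\<forall>x. \<bar>x\<bar> < r2 \<longrightarrow> S x has_fps_expansion fps_eval_inner (fps_shift 1 \<eta>') x"
    using has_fps2_slice[OF S] by blast
  define r where "r = min (min r1 r2) (r0 - \<bar>x0\<bar>)"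
  have r: "r > 0" using r1 r2 x0 by (simp add: r_def)
  have quot: "g_quot X Y \<sigma> (x0 + x) y = S x y" if x: "\<bar>x\<bar> < r" and y: "\<bar>y\<bar> < r" "y \<noteq> 0" for x y
  proof -
    have "\<bar>x\<bar> < r0 - \<bar>x0\<bar>" "\<bar>y\<bar> < r0 - \<bar>x0\<bar>" using x y by (simp_all add: r_def)
    then have "\<bar>x0 + x\<bar> < r0" "\<bar>y\<bar> < r0" by linarith+
    then have X: "X \<sigma> (x0 + x) y \<noteq> 0" "X \<sigma> (x0 + x) 0 \<noteq> 0"
      using r0(1) r0(2)[of "x0 + x"] by auto
    have "y * S x y = \<epsilon> * (Y \<sigma> (x0 + x) y * inverse (X \<sigma> (x0 + x) y)) - \<epsilon> * (Y \<sigma> (x0 + x) 0 * inverse (X \<sigma> (x0 + x) 0))"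
      using r1(2) x y by (simp add: r_def)
    also have "\<dots> = sg \<sigma> * delta X * (X \<sigma> (x0 + x) 0 * Y \<sigma> (x0 + x) y - X \<sigma> (x0 + x) y * Y \<sigma> (x0 + x) 0)
        / (X \<sigma> (x0 + x) y * X \<sigma> (x0 + x) 0)"
      using X by (simp add: \<epsilon>_def field_simps)
    finally have "S x y * y = sg \<sigma> * delta X * (X \<sigma> (x0 + x) 0 * Y \<sigma> (x0 + x) y - X \<sigma> (x0 + x) y * Y \<sigma> (x0 + x) 0)
        / (X \<sigma> (x0 + x) y * X \<sigma> (x0 + x) 0)"
      by (simp only: mult.commute[of "S x y"])
    with y(2) have 1: "S x y = sg \<sigma> * delta X * (X \<sigma> (x0 + x) 0 * Y \<sigma> (x0 + x) y - X \<sigma> (x0 + x) y * Y \<sigma> (x0 + x) 0)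
        / (X \<sigma> (x0 + x) y * X \<sigma> (x0 + x) 0) / y"
      by (rule eq_divide_imp)
    have "sg \<sigma> / delta X = sg \<sigma> * delta X" using delta by (simp add: field_simps)
    then have "g_quot X Y \<sigma> (x0 + x) y = sg \<sigma> * delta X * (X \<sigma> (x0 + x) 0 * Y \<sigma> (x0 + x) y - X \<sigma> (x0 + x) y * Y \<sigma> (x0 + x) 0)
        / (X \<sigma> (x0 + x) y * X \<sigma> (x0 + x) 0) / y"
      unfolding \<open>sg \<sigma> / delta X = sg \<sigma> * delta X\<close>[symmetric]
      using X y delta by (simp add: g_quot_def field_simps)
    with 1 show ?thesis by simp
  qed
  have "g_fun X Y \<sigma> (x0 + x) y = S x y" if x: "\<bar>x\<bar> < r" and y: "\<bar>y\<bar> < r" for x y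
  proof (cases "y = 0")
    case True
    have ev: "eventually (\<lambda>y. g_quot X Y \<sigma> (x0 + x) y = S x y) (at 0)"
      unfolding eventually_at using r quot[OF x] by (intro exI[of _ r]) (auto simp: dist_norm)
    have Sx: "S x has_fps_expansion fps_eval_inner (fps_shift 1 \<eta>') x" using r2(2) x by (simp add: r_def)
    have "Lim (at 0) (g_quot X Y \<sigma> (x0 + x)) = S x 0"
      using Lim_removable(1)[OF Sx ev] has_fps_expansion_imp_nth_0[OF Sx] by simp
    then show ?thesis using True by (simp add: g_fun_def)
  next
    case False
    then show ?thesis using quot[OF x y] by (simp add: g_fun_def)
  qed
  then show ?thesis by (rule has_fps2_cong[OF S r])
qed

lemma g_fun_expansion: "g_fun X Y \<sigma> has_fps2 gs"
  using g_fun_expansion_at[of 0 \<eta>] \<eta>(1) r0(1) by (simp add: gs_def)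

lemma local_expansion_nonzero:
  assumes "\<bar>x0\<bar> < r0" "\<bar>y0\<bar> < r0"
  obtains A' B' D' where "(\<lambda>x y. X \<sigma> (x0 + x) (y0 + y)) has_fps2 A'" "(\<lambda>x y. Y \<sigma> (x0 + x) (y0 + y)) has_fps2 B'"
    "(\<lambda>x y. inverse (X \<sigma> (x0 + x) (y0 + y))) has_fps2 D'"
proof -
  obtain A' B' where AB: "(\<lambda>x y. X \<sigma> (x0 + x) (y0 + y)) has_fps2 A'" "(\<lambda>x y. Y \<sigma> (x0 + x) (y0 + y)) has_fps2 B'"
    using local_expansion[OF r0(3)[OF assms]] by blast
  have "A' $ 0 $ 0 = X \<sigma> x0 y0"
    using has_fps_expansion_imp_nth_0[OF has_fps2_slice_0[OF AB(1)]] by simp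
  then have "A' $ 0 $ 0 \<noteq> 0" using r0(2)[OF assms] by simp
  then obtain D' where "(\<lambda>x y. inverse (X \<sigma> (x0 + x) (y0 + y))) has_fps2 D'"
    using has_fps2_inverse[OF AB(1)] by metis
  with AB show ?thesis by (rule that)
qed

text \<open>Off the line y = 0 the defining quotient is analytic as it stands; on the line
  \<open>g_fun_expansion_at\<close> applies.\<close>

lemma g_fun_analytic: "\<exists>V. open V \<and> (0, 0) \<in> V \<and> real_analytic2_on (g_fun X Y \<sigma>) V"
proof (intro exI conjI)
  show "open ({-r0<..<r0} \<times> {-r0<..<r0})" by (intro open_Times) auto
  show "(0, 0) \<in> {-r0<..<r0} \<times> {-r0<..<r0}" using r0(1) by simp
  have "\<exists>G. (\<lambda>x y. g_fun X Y \<sigma> (x0 + x) (y0 + y)) has_fps2 G" if xy: "\<bar>x0\<bar> < r0" "\<bar>y0\<bar> < r0" for x0 y0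
  proof -
    obtain A1 B1 D1 where 1: "(\<lambda>x y. X \<sigma> (x0 + x) (0 + y)) has_fps2 A1" "(\<lambda>x y. Y \<sigma> (x0 + x) (0 + y)) has_fps2 B1"
      "(\<lambda>x y. inverse (X \<sigma> (x0 + x) (0 + y))) has_fps2 D1"
      using local_expansion_nonzero[OF xy(1), of 0] r0(1) by auto
    show ?thesis
    proof (cases "y0 = 0")
      case True
      have "(\<lambda>x y. \<epsilon> * (Y \<sigma> (x0 + x) y * inverse (X \<sigma> (x0 + x) y))) has_fps2 (fps_const (fps_const \<epsilon>) * (B1 * D1))"
        using has_fps2_cmult[OF has_fps2_mult[OF 1(2,3)]] by simp
      from g_fun_expansion_at[OF xy(1) this] show ?thesis using True by auto
    next
      case False
      obtain A2 B2 D2 where 2: "(\<lambda>x y. X \<sigma> (x0 + x) (y0 + y)) has_fps2 A2" "(\<lambda>x y. Y \<sigma> (x0 + x) (y0 + y)) has_fps2 B2"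
        "(\<lambda>x y. inverse (X \<sigma> (x0 + x) (y0 + y))) has_fps2 D2"
        using local_expansion_nonzero[OF xy] by blast
      have slice: "(\<lambda>x y. X \<sigma> (x0 + x) 0) has_fps2 fps_const (A1 $ 0)" "(\<lambda>x y. Y \<sigma> (x0 + x) 0) has_fps2 fps_const (B1 $ 0)"
        "(\<lambda>x y. inverse (X \<sigma> (x0 + x) 0)) has_fps2 fps_const (D1 $ 0)"
        using 1[THEN has_fps2_slice_0, THEN has_fps2_inner] by simp_all
      have "(\<lambda>y. inverse (y0 + y)) has_fps_expansion inverse (fps_const y0 + fps_X)"
        by (intro fps_expansion_intros) (use False in auto)
      then obtain I where I: "(\<lambda>x y. inverse (y0 + y)) has_fps2 I" using has_fps2_outer by blast
      have "(\<lambda>x y. ((sg \<sigma> * (X \<sigma> (x0 + x) 0 * Y \<sigma> (x0 + x) (y0 + y))) + (- sg \<sigma> * (X \<sigma> (x0 + x) (y0 + y) * Y \<sigma> (x0 + x) 0)))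
          * (inverse (delta X) * (inverse (y0 + y) * (inverse (X \<sigma> (x0 + x) (y0 + y)) * inverse (X \<sigma> (x0 + x) 0)))))
        has_fps2 ((fps_const (fps_const (sg \<sigma>)) * (fps_const (A1 $ 0) * B2) + fps_const (fps_const (- sg \<sigma>)) * (A2 * fps_const (B1 $ 0)))
          * (fps_const (fps_const (inverse (delta X))) * (I * (D2 * fps_const (D1 $ 0)))))"
        by (intro has_fps2_mult has_fps2_add has_fps2_cmult slice 2 I)
      then have "(\<lambda>x y. g_fun X Y \<sigma> (x0 + x) (y0 + y)) has_fps2 ((fps_const (fps_const (sg \<sigma>)) * (fps_const (A1 $ 0) * B2) + fps_const (fps_const (- sg \<sigma>)) * (A2 * fps_const (B1 $ 0)))
          * (fps_const (fps_const (inverse (delta X))) * (I * (D2 * fps_const (D1 $ 0)))))"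
      proof (rule has_fps2_cong)
        show "\<bar>y0\<bar> > 0" using False by simp
        fix x y :: real assume "\<bar>y\<bar> < \<bar>y0\<bar>"
        then have "y0 + y \<noteq> 0" by linarith
        then show "g_fun X Y \<sigma> (x0 + x) (y0 + y) = ((sg \<sigma> * (X \<sigma> (x0 + x) 0 * Y \<sigma> (x0 + x) (y0 + y))) + (- sg \<sigma> * (X \<sigma> (x0 + x) (y0 + y) * Y \<sigma> (x0 + x) 0)))
          * (inverse (delta X) * (inverse (y0 + y) * (inverse (X \<sigma> (x0 + x) (y0 + y)) * inverse (X \<sigma> (x0 + x) 0))))"
          by (simp add: g_fun_def g_quot_def divide_inverse mult_ac)
      qed
      then show ?thesis by blast
    qed
  qed
  then show "real_analytic2_on (g_fun X Y \<sigma>) ({-r0<..<r0} \<times> {-r0<..<r0})"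
    unfolding real_analytic2_on_iff by (auto simp: abs_less_iff)
qed

lemma f_fun_analytic: "\<exists>V. open V \<and> 0 \<in> V \<and> real_analytic_on (f_fun X Y k \<sigma>) V"
proof (intro exI conjI)
  show "open {-r0<..<r0}" "0 \<in> {-r0<..<r0}" using r0(1) by auto
  show "real_analytic_on (f_fun X Y k \<sigma>) {-r0<..<r0}"
    unfolding real_analytic_on_def
  proof
    fix x0 assume "x0 \<in> {-r0<..<r0}"
    then have x0: "\<bar>x0\<bar> < r0" by (simp add: abs_less_iff)
    show "\<exists>G. (\<lambda>x. f_fun X Y k \<sigma> (x0 + x)) has_fps_expansion G"
    proof (cases "x0 = 0")
      case True
      then show ?thesis using f_fun_expansion by auto
    next
      case False
      obtain A1 B1 D1 where 1: "(\<lambda>x y. X \<sigma> (x0 + x) (0 + y)) has_fps2 A1" "(\<lambda>x y. Y \<sigma> (x0 + x) (0 + y)) has_fps2 B1"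
        "(\<lambda>x y. inverse (X \<sigma> (x0 + x) (0 + y))) has_fps2 D1"
        using local_expansion_nonzero[OF x0, of 0] r0(1) by auto
      have X: "(\<lambda>x. X \<sigma> (x0 + x) 0) has_fps_expansion A1 $ 0" and Y: "(\<lambda>x. Y \<sigma> (x0 + x) 0) has_fps_expansion B1 $ 0"
        using has_fps2_slice_0[OF 1(1)] has_fps2_slice_0[OF 1(2)] by simp_all
      have A1: "A1 $ 0 $ 0 \<noteq> 0"
        using has_fps_expansion_imp_nth_0[OF X] r0(2)[OF x0, of 0] r0(1) by simp
      have "(\<lambda>x. f_quot X Y k \<sigma> (x0 + x)) has_fps_expansion
          (fps_const (sg \<sigma> * delta X) * B1 $ 0 - fps_const (a_coeff X Y k \<sigma>) * (fps_const x0 + fps_X) ^ (2 * k \<sigma> - 1) * A1 $ 0)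
            / ((fps_const x0 + fps_X) ^ (2 * k \<sigma>) * A1 $ 0)"
        unfolding f_quot_def
        by (intro has_fps_expansion_divide' fps_expansion_intros X Y)
           (use False A1 in \<open>simp add: fps_power_zeroth\<close>)
      moreover have "eventually (\<lambda>x. f_quot X Y k \<sigma> (x0 + x) = f_fun X Y k \<sigma> (x0 + x)) (nhds 0)"
        unfolding eventually_nhds_metric f_fun_def
        using False by (intro exI[of _ "\<bar>x0\<bar>"]) (auto simp: dist_norm)
      ultimately show ?thesis by (intro exI) (rule has_fps_expansion_cong_real)
    qed
  qed
qed

abbreviation "y_fps i \<equiv> (vfield \<epsilon> \<eta> ^^ i) fps_X $ 0"

text \<open>The series on the right is E^(i - 1) \<eta> on y = 0, because E y = \<eta>. In the Faa
  di Bruno expansion, j = 0 contributes \<epsilon>^(i - 1) times the derivative of order i - 1 of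
  \<eta>(x, 0), the first summand of the recursion. For j \<ge> 1, coefficient j of \<eta> is
  coefficient j - 1 of g, and these terms make up G.\<close>

lemma y_fun_expansion: "i \<ge> 1 \<Longrightarrow> y_fun X Y k \<sigma> i has_fps_expansion y_fps i"
proof (induction i rule: less_induct)
  case (less i)
  define m where "m = i - 1"
  have i: "i = Suc m" using less.prems by (simp add: m_def)
  define V where "V = taylor \<epsilon> \<eta> fps_X"
  \<comment> \<open>The functions whose expansions are the coefficients of V; the one at index 0 is
    0 because the flow starts on y = 0.\<close>
  define v where "v p x = (if p = 0 then 0 else y_fun X Y k \<sigma> p x / fact p)" for p x
  have v: "v p has_fps_expansion V $ p" if "p \<le> m" for p
  proof (cases "p = 0")
    case True
    then show ?thesis by (simp add: V_def taylor_def v_def[abs_def])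
  next
    case False
    then have "y_fun X Y k \<sigma> p has_fps_expansion y_fps p" using less.IH[of p] that i by simp
    from has_fps_expansion_cmult_left[OF this, of "1 / fact p"] show ?thesis
      using False by (simp add: V_def taylor_def v_def[abs_def])
  qed
  have f: "(deriv ^^ n) (f_fun X Y k \<sigma>) has_fps_expansion (fps_deriv ^^ n) fs" for n
    by (rule has_fps_expansion_higher_deriv[OF f_fun_expansion])
  have G: "G_sum X Y \<sigma> (\<lambda>m. y_fun X Y k \<sigma> m x) i x = (\<Sum>l=1..m. \<Sum>j=1..l.
      (real j * real (m choose l) * \<epsilon> ^ (m - l) * (fact l / fact j)) * (Abs_fps (\<lambda>p. v p x) ^ j) $ l
        * pd (m - l) (j - 1) (g_fun X Y \<sigma>) x 0)" for x
    unfolding G_sum_def i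
  proof (intro sum.cong refl)
    fix l j assume "l \<in> {1..m}" "j \<in> {1..l}"
    then have "bell l j (\<lambda>m. y_fun X Y k \<sigma> m x) = fact l / fact j * (Abs_fps (\<lambda>p. v p x) ^ j) $ l"
      by (simp add: bell_eq v_def)
    then show "real j * real ((Suc m - 1) choose l) * (sg \<sigma> * delta X) ^ (Suc m - l - 1) * bell l j (\<lambda>m. y_fun X Y k \<sigma> m x)
         * pd (Suc m - l - 1) (j - 1) (g_fun X Y \<sigma>) x 0
      = (real j * real (m choose l) * \<epsilon> ^ (m - l) * (fact l / fact j)) * (Abs_fps (\<lambda>p. v p x) ^ j) $ l
        * pd (m - l) (j - 1) (g_fun X Y \<sigma>) x 0"
      by (simp add: \<epsilon>_def)
  qed auto
  have "(\<lambda>x. G_sum X Y \<sigma> (\<lambda>m. y_fun X Y k \<sigma> m x) i x) has_fps_expansion (\<Sum>l=1..m. \<Sum>j=1..l.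
      fps_const (real j * real (m choose l) * \<epsilon> ^ (m - l) * (fact l / fact j)) * (V ^ j) $ l
        * (fps_deriv ^^ (m - l)) (fps_const (fact (j - 1)) * gs $ (j - 1)))"
    unfolding G
    by (intro has_fps_expansion_sum has_fps_expansion_mult has_fps_expansion_const
          has_fps2_pd[OF g_fun_expansion] fps_family_power_expansion[where n = m]) (use v in auto)
  also have "(\<Sum>l=1..m. \<Sum>j=1..l.
      fps_const (real j * real (m choose l) * \<epsilon> ^ (m - l) * (fact l / fact j)) * (V ^ j) $ l
        * (fps_deriv ^^ (m - l)) (fps_const (fact (j - 1)) * gs $ (j - 1)))
    = (\<Sum>l=1..m. \<Sum>j\<le>l. of_nat (m choose l) * fps_const (\<epsilon> ^ (m - l))
      * (fps_deriv ^^ (m - l)) (\<eta> $ j) * (fps_const (fact l) * (V ^ j) $ l))"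
  proof (rule sum.cong[OF refl])
    fix l assume l: "l \<in> {1..m}"
    \<comment> \<open>V^0 = 1 has no coefficient at l \<ge> 1, so j = 0 drops out.\<close>
    have "(\<Sum>j\<le>l. of_nat (m choose l) * fps_const (\<epsilon> ^ (m - l)) * (fps_deriv ^^ (m - l)) (\<eta> $ j) * (fps_const (fact l) * (V ^ j) $ l))
        = (\<Sum>j=1..l. of_nat (m choose l) * fps_const (\<epsilon> ^ (m - l)) * (fps_deriv ^^ (m - l)) (\<eta> $ j) * (fps_const (fact l) * (V ^ j) $ l))"
    proof (rule sum.mono_neutral_right)
      show "\<forall>j\<in>{..l} - {1..l}. of_nat (m choose l) * fps_const (\<epsilon> ^ (m - l)) * (fps_deriv ^^ (m - l)) (\<eta> $ j) * (fps_const (fact l) * (V ^ j) $ l) = 0"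
      proof
        fix j assume "j \<in> {..l} - {1..l}"
        then have "j = 0" by auto
        then show "of_nat (m choose l) * fps_const (\<epsilon> ^ (m - l)) * (fps_deriv ^^ (m - l)) (\<eta> $ j) * (fps_const (fact l) * (V ^ j) $ l) = 0"
          using l by simp
      qed
    qed auto
    also have "\<dots> = (\<Sum>j=1..l. fps_const (real j * real (m choose l) * \<epsilon> ^ (m - l) * (fact l / fact j)) * (V ^ j) $ l
        * (fps_deriv ^^ (m - l)) (fps_const (fact (j - 1)) * gs $ (j - 1)))"
    proof (intro sum.cong refl)
      fix j assume j: "j \<in> {1..l}"
      have cmult: "(fps_deriv ^^ n) (fps_const c * u) = fps_const c * (fps_deriv ^^ n) u" for n c and u :: "real fps"
        by (induction n) simp_all
      have gs: "gs $ (j - 1) = \<eta> $ j" using j by (simp add: gs_def)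
      \<comment> \<open>The factor j in G and the (j - 1)! from the y-derivatives of g together
        cancel the j! in the denominator of the Bell polynomial.\<close>
      have "real j * fact (j - 1) / fact j = (1 :: real)"
        using j by (cases j) auto
      then have "real j * real (m choose l) * \<epsilon> ^ (m - l) * (fact l / fact j) * fact (j - 1) = real (m choose l) * \<epsilon> ^ (m - l) * fact l"
        using j by (simp add: field_simps)
      then have c: "fps_const (real j * real (m choose l) * \<epsilon> ^ (m - l) * (fact l / fact j)) * fps_const (fact (j - 1))
          = of_nat (m choose l) * fps_const (\<epsilon> ^ (m - l)) * fps_const (fact l)"
        by (simp add: fps_of_nat[symmetric])
      have "fps_const (real j * real (m choose l) * \<epsilon> ^ (m - l) * (fact l / fact j)) * (V ^ j) $ l
          * (fps_deriv ^^ (m - l)) (fps_const (fact (j - 1)) * gs $ (j - 1))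
        = (fps_const (real j * real (m choose l) * \<epsilon> ^ (m - l) * (fact l / fact j)) * fps_const (fact (j - 1)))
          * ((V ^ j) $ l * (fps_deriv ^^ (m - l)) (\<eta> $ j))"
        unfolding cmult gs by (simp only: mult_ac)
      also have "\<dots> = of_nat (m choose l) * fps_const (\<epsilon> ^ (m - l)) * (fps_deriv ^^ (m - l)) (\<eta> $ j) * (fps_const (fact l) * (V ^ j) $ l)"
        unfolding c by (simp only: mult_ac)
      finally show "of_nat (m choose l) * fps_const (\<epsilon> ^ (m - l)) * (fps_deriv ^^ (m - l)) (\<eta> $ j) * (fps_const (fact l) * (V ^ j) $ l)
          = fps_const (real j * real (m choose l) * \<epsilon> ^ (m - l) * (fact l / fact j)) * (V ^ j) $ l
          * (fps_deriv ^^ (m - l)) (fps_const (fact (j - 1)) * gs $ (j - 1))" by (rule sym)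
    qed
    finally show "(\<Sum>j=1..l. fps_const (real j * real (m choose l) * \<epsilon> ^ (m - l) * (fact l / fact j)) * (V ^ j) $ l
        * (fps_deriv ^^ (m - l)) (fps_const (fact (j - 1)) * gs $ (j - 1)))
      = (\<Sum>j\<le>l. of_nat (m choose l) * fps_const (\<epsilon> ^ (m - l)) * (fps_deriv ^^ (m - l)) (\<eta> $ j) * (fps_const (fact l) * (V ^ j) $ l))"
      by (rule sym)
  qed
  finally have G_exp: "(\<lambda>x. G_sum X Y \<sigma> (\<lambda>m. y_fun X Y k \<sigma> m x) i x) has_fps_expansion
    (\<Sum>l=1..m. \<Sum>j\<le>l. of_nat (m choose l) * fps_const (\<epsilon> ^ (m - l)) * (fps_deriv ^^ (m - l)) (\<eta> $ j) * (fps_const (fact l) * (V ^ j) $ l))"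
    (is "_ has_fps_expansion ?G") .

  have y_eq: "y_fps i = fps_const (\<epsilon> ^ m) * (fps_deriv ^^ m) (\<eta> $ 0) + ?G"
  proof -
    have "y_fps i = (vfield \<epsilon> \<eta> ^^ m) \<eta> $ 0"
      by (simp only: i funpow_Suc_right o_apply vfield_X)
    also have "\<dots> = (\<Sum>l=0..m. \<Sum>j\<le>l. of_nat (m choose l) * fps_const (\<epsilon> ^ (m - l))
        * (fps_deriv ^^ (m - l)) (\<eta> $ j) * (fps_const (fact l) * (V ^ j) $ l))"
      by (simp add: vfield_funpow_nth_0 V_def atLeast0AtMost)
    also have "\<dots> = fps_const (\<epsilon> ^ m) * (fps_deriv ^^ m) (\<eta> $ 0) + ?G"
      by (subst sum.atLeast_Suc_atMost) auto
    finally show ?thesis .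
  qed

  \<comment> \<open>Common form of the two cases of the recursion, without the factor
    \<epsilon>^m.\<close>
  define main where "main x = (if m \<le> K - 1 then a * (fact (K - 1) / fact (K - 1 - m)) * x ^ (K - 1 - m) else 0)
      + (\<Sum>l\<le>min m K. real (m choose l) * (fact K / fact (K - l)) * x ^ (K - l) * (deriv ^^ (m - l)) (f_fun X Y k \<sigma>) x)" for x
  have main: "main has_fps_expansion (fps_deriv ^^ m) (\<eta> $ 0)"
  proof -
    have 1: "(\<lambda>x. if m \<le> K - 1 then a * (fact (K - 1) / fact (K - 1 - m)) * x ^ (K - 1 - m) else 0) has_fps_expansion
        (if m \<le> K - 1 then fps_const (a * (fact (K - 1) / fact (K - 1 - m))) * fps_X ^ (K - 1 - m) else 0)"
    proof (cases "m \<le> K - 1")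
      case True
      show ?thesis
        unfolding if_P[OF True]
        by (intro has_fps_expansion_mult has_fps_expansion_const has_fps_expansion_fps_X_power)
    qed simp
    have 2: "(\<lambda>x. \<Sum>l\<le>min m K. real (m choose l) * (fact K / fact (K - l)) * x ^ (K - l) * (deriv ^^ (m - l)) (f_fun X Y k \<sigma>) x) has_fps_expansion
        (\<Sum>l\<le>min m K. fps_const (real (m choose l) * (fact K / fact (K - l))) * fps_X ^ (K - l) * (fps_deriv ^^ (m - l)) fs)"
      by (intro has_fps_expansion_sum has_fps_expansion_mult has_fps_expansion_const has_fps_expansion_fps_X_power f)
    show ?thesis
      unfolding \<eta>0 fps_higher_deriv_leading main_def[abs_def] by (rule has_fps_expansion_add[OF 1 2])
  qed
  have y_unfold: "y_fun X Y k \<sigma> i x = (if i = 0 then 0 else if i = 1 then a * x ^ (K - 1) + x ^ K * f_fun X Y k \<sigma> x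
     else if i \<le> K then
       \<epsilon> ^ (i - 1) * (a * (fact (K - 1) / fact (K - i)) * x ^ (K - i)
          + (\<Sum>l=0..i - 1. real ((i - 1) choose l) * (fact K / fact (K - l)) * x ^ (K - l)
               * (deriv ^^ (i - 1 - l)) (f_fun X Y k \<sigma>) x))
       + G_sum X Y \<sigma> (\<lambda>m. y_fun X Y k \<sigma> m x) i x
     else
       \<epsilon> ^ (i - 1) * (real ((i - 1) choose K) * fact K * (deriv ^^ (i - 1 - K)) (f_fun X Y k \<sigma>) x
          + (\<Sum>l=0..K - 1. real ((i - 1) choose l) * (fact K / fact (K - l)) * x ^ (K - l)
               * (deriv ^^ (i - 1 - l)) (f_fun X Y k \<sigma>) x))
       + G_sum X Y \<sigma> (\<lambda>m. y_fun X Y k \<sigma> m x) i x)" for x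
    by (subst y_fun.simps) (simp only: Let_def a_def K_def \<epsilon>_def)
  have "y_fun X Y k \<sigma> i x = \<epsilon> ^ m * main x + G_sum X Y \<sigma> (\<lambda>m. y_fun X Y k \<sigma> m x) i x" for x
  proof -
    consider "i = 1" | "1 < i" "i \<le> K" | "i > K" using i by linarith
    then show ?thesis
    proof cases
      case 1
      then have "m = 0" using i by simp
      then show ?thesis
        using 1 unfolding y_unfold by (simp add: G_sum_def main_def)
    next
      case 2
      then have mK: "m \<le> K - 1" "min m K = m" "K - i = K - 1 - m" "i - 1 = m" using i by auto
      show ?thesis
        using 2 mK unfolding main_def y_unfold by (simp add: atLeast0AtMost)
    next
      case 3
      then have mK: "\<not> m \<le> K - 1" "min m K = K" "i - 1 = m" using i K by auto
      \<comment> \<open>For l = K the power of x is 1; the definition of y_i writes this term apart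
        when i > K.\<close>
      have "(\<Sum>l\<le>K. real (m choose l) * (fact K / fact (K - l)) * x ^ (K - l) * (deriv ^^ (m - l)) (f_fun X Y k \<sigma>) x)
          = real (m choose K) * fact K * (deriv ^^ (m - K)) (f_fun X Y k \<sigma>) x
            + (\<Sum>l=0..K-1. real (m choose l) * (fact K / fact (K - l)) * x ^ (K - l) * (deriv ^^ (m - l)) (f_fun X Y k \<sigma>) x)"
        using K(4) by (cases K) (simp_all add: atLeast0AtMost)
      moreover have "\<not> i \<le> 1" "i \<noteq> 0" "i \<noteq> 1" "\<not> i \<le> K" using 3 K by auto
      ultimately show ?thesis
        using mK unfolding main_def y_unfold by simp
    qed
  qed
  then have "y_fun X Y k \<sigma> i = (\<lambda>x. \<epsilon> ^ m * main x + G_sum X Y \<sigma> (\<lambda>m. y_fun X Y k \<sigma> m x) i x)" by blast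
  moreover have "(\<lambda>x. \<epsilon> ^ m * main x + G_sum X Y \<sigma> (\<lambda>m. y_fun X Y k \<sigma> m x) i x) has_fps_expansion y_fps i"
    unfolding y_eq by (intro has_fps_expansion_add has_fps_expansion_cmult_left main G_exp)
  ultimately show ?case by simp
qed

lemma half_return:
  assumes \<phi>: "half_return_map \<sigma> U (X \<sigma>) (Y \<sigma>) \<phi>"
  shows "mu X Y k \<sigma> K \<noteq> 0"
    and "\<exists>\<alpha>. \<phi> has_fps_expansion Abs_fps \<alpha> \<and> \<alpha> 0 = 0 \<and> \<alpha> 1 = - 1 \<and>
       (\<forall>n\<ge>2. \<alpha> n = (p_poly (mu X Y k \<sigma>) n (k \<sigma>) \<alpha> - mu X Y k \<sigma> (n + K - 1)) / (2 * real (k \<sigma>) * mu X Y k \<sigma> K))"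
proof -
  have "fps2_conv (- F)"
    using F(3) by (simp add: fps2_conv_def)
  then obtain \<H> where H: "fps2_conv \<H>" "fps_deriv_inner \<H> = - F * fps_deriv \<H>"
    and H0: "\<And>j. \<H> $ j $ 0 = (if j = 1 then 1 else 0)"
    using first_integral_exists by metis
  define W where "W = \<H> $ 0"
  note lead = first_integral_leading[OF H(2) H0 F_low K(3), folded W_def]
  have WK: "real K * W $ K = - \<epsilon> * a" using lead(2) F_lead by simp
  have "sg \<sigma> * (real K * W $ K) > 0" using sign_a unfolding WK by (simp add: mult_ac)
  then have "real K * (sg \<sigma> * W $ K) > 0" by (simp only: mult_ac)
  then have sW: "sg \<sigma> * W $ K > 0" using K(4) by (simp add: zero_less_mult_iff)
  then have WK0: "W $ K \<noteq> 0" by auto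
  \<comment> \<open>\<open>mu\<close> carries derivatives at 0 where the Lie series has
    coefficients, and the binomial coefficient over m! converts between them. The index j = 0
    belongs to y itself, which vanishes on y = 0, so the sum may start at 1.\<close>
  have mu_W: "mu X Y k \<sigma> m = W $ m" for m
  proof -
    have EH: "vfield \<epsilon> \<eta> \<H> = 0"
      unfolding vfield_def \<eta>_def H(2) by (simp add: mult_ac)
    have "W $ m = (\<Sum>j\<le>m. (- \<epsilon>) ^ j / fact j * y_fps j $ (m - j))"
      unfolding W_def by (rule first_integral_nth[OF eps(1) EH H0])
    also have "\<dots> = (\<Sum>j=1..m. (- \<epsilon>) ^ j / fact j * y_fps j $ (m - j))"
    proof (rule sum.mono_neutral_right)
      show "\<forall>j\<in>{..m} - {1..m}. (- \<epsilon>) ^ j / fact j * y_fps j $ (m - j) = 0"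
      proof
        fix j assume "j \<in> {..m} - {1..m}"
        then have "j = 0" by auto
        then show "(- \<epsilon>) ^ j / fact j * y_fps j $ (m - j) = 0" by simp
      qed
    qed auto
    also have "\<dots> = mu X Y k \<sigma> m"
      unfolding mu_def sum_distrib_left
    proof (intro sum.cong refl)
      fix j assume j: "j \<in> {1..m}"
      have "(deriv ^^ (m - j)) (y_fun X Y k \<sigma> j) 0 = fact (m - j) * y_fps j $ (m - j)"
        using j by (intro has_fps_expansion_higher_deriv_0 y_fun_expansion) auto
      moreover have "real (m choose j) = fact m / (fact j * fact (m - j))"
        using j by (intro binomial_fact) auto
      ultimately show "(- \<epsilon>) ^ j / fact j * y_fps j $ (m - j)
          = 1 / fact m * ((- sg \<sigma> * delta X) ^ j * real (m choose j) * (deriv ^^ (m - j)) (y_fun X Y k \<sigma> j) 0)"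
        by (simp add: \<epsilon>_def)
    qed
    finally show ?thesis by simp
  qed
  show "mu X Y k \<sigma> K \<noteq> 0" using WK0 by (simp add: mu_W)
  have H': "fps_deriv_inner \<H> + F * fps_deriv \<H> = 0" "\<H> $ 1 $ 0 = 1" using H(2) H0[of 1] by simp_all
  have A00: "A $ 0 $ 0 \<noteq> 0" using A0 X0 by simp
  note level = half_return_level[OF A A00 B F(2,3) H(1) H' lead(1)[unfolded W_def] sW[unfolded W_def] K(2,4) \<phi>]
  have W_exp: "eval_fps W has_fps_expansion W" unfolding W_def by (rule fps2_conv_imp_inner[OF H(1)])
  have \<phi>0: "\<phi> 0 = 0" using \<phi> by (simp add: half_return_map_def)
  from analytic_involution[OF W_exp K(2,3) lead(1) WK0 \<phi>0 level(2) level(1)[folded W_def]]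
  obtain \<alpha> where \<alpha>: "\<phi> has_fps_expansion \<alpha>" "\<alpha> $ 0 = 0" "\<alpha> $ 1 = - 1" "W oo \<alpha> = W"
    by metis
  have [simp]: "Abs_fps (fps_nth \<alpha>) = \<alpha>" by (simp add: fps_eq_iff)
  have mu_fun: "mu X Y k \<sigma> = fps_nth W" using mu_W by blast
  have "\<alpha> $ n = (p_poly (fps_nth W) n (k \<sigma>) (fps_nth \<alpha>) - W $ (n + K - 1)) / (2 * real (k \<sigma>) * W $ K)"
    if n: "n \<ge> 2" for n
    unfolding K_def
    by (rule involution_coeff_recursion) (use \<alpha> lead(1) WK0 k1 n in \<open>auto simp: K_def\<close>)
  with \<alpha> show "\<exists>\<alpha>. \<phi> has_fps_expansion Abs_fps \<alpha> \<and> \<alpha> 0 = 0 \<and> \<alpha> 1 = - 1 \<and>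
       (\<forall>n\<ge>2. \<alpha> n = (p_poly (mu X Y k \<sigma>) n (k \<sigma>) \<alpha> - mu X Y k \<sigma> (n + K - 1)) / (2 * real (k \<sigma>) * mu X Y k \<sigma> K))"
    unfolding mu_fun by (intro exI[of _ "fps_nth \<alpha>"]) simp
qed

end

text \<open>Analyticity of \<open>\<phi> \<sigma>\<close> at 0 is part of the conclusion. The
  nonvanishing of the denominator is stated as well, so that the quotient is a genuine one and not
  the value 0 assigned to division by 0.\<close>

theorem theoremC:
  fixes X Y :: "side \<Rightarrow> real \<Rightarrow> real \<Rightarrow> real"
    and U :: "side \<Rightarrow> (real \<times> real) set"
    and k :: "side \<Rightarrow> nat"
    and \<phi> :: "side \<Rightarrow> real \<Rightarrow> real"
  assumes "\<And>\<sigma>. open (U \<sigma>)" and "\<And>\<sigma>. (0, 0) \<in> U \<sigma>"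
    and "\<And>\<sigma>. real_analytic2_on (X \<sigma>) (U \<sigma>)" and "\<And>\<sigma>. real_analytic2_on (Y \<sigma>) (U \<sigma>)"
    and "\<And>\<sigma>. k \<sigma> \<ge> 1"
    and "monodromic_tangential X Y k"
    and "\<And>\<sigma>. half_return_map \<sigma> (U \<sigma>) (X \<sigma>) (Y \<sigma>) (\<phi> \<sigma>)"
  shows "\<forall>\<sigma>.
    (\<exists>V. open V \<and> 0 \<in> V \<and> real_analytic_on (f_fun X Y k \<sigma>) V) \<and>
    (\<exists>V. open V \<and> (0, 0) \<in> V \<and> real_analytic2_on (g_fun X Y \<sigma>) V) \<and>
    mu X Y k \<sigma> (2 * k \<sigma>) \<noteq> 0 \<and>
    (\<exists>\<alpha>. \<phi> \<sigma> has_fps_expansion Abs_fps \<alpha> \<and> \<alpha> 0 = 0 \<and> \<alpha> 1 = - 1 \<and>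
       (\<forall>n\<ge>2. \<alpha> n =
          (p_poly (mu X Y k \<sigma>) n (k \<sigma>) \<alpha> - mu X Y k \<sigma> (n + 2 * k \<sigma> - 1))
            / (2 * real (k \<sigma>) * mu X Y k \<sigma> (2 * k \<sigma>))))"
proof
  fix \<sigma>
  interpret tangential_side X Y k \<sigma> "U \<sigma>"
    by unfold_locales (use assms in auto)
  note half = half_return[OF assms(7), unfolded K_def]
  show "(\<exists>V. open V \<and> 0 \<in> V \<and> real_analytic_on (f_fun X Y k \<sigma>) V) \<and>
    (\<exists>V. open V \<and> (0, 0) \<in> V \<and> real_analytic2_on (g_fun X Y \<sigma>) V) \<and>
    mu X Y k \<sigma> (2 * k \<sigma>) \<noteq> 0 \<and>
    (\<exists>\<alpha>. \<phi> \<sigma> has_fps_expansion Abs_fps \<alpha> \<and> \<alpha> 0 = 0 \<and> \<alpha> 1 = - 1 \<and>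
       (\<forall>n\<ge>2. \<alpha> n =
          (p_poly (mu X Y k \<sigma>) n (k \<sigma>) \<alpha> - mu X Y k \<sigma> (n + 2 * k \<sigma> - 1))
            / (2 * real (k \<sigma>) * mu X Y k \<sigma> (2 * k \<sigma>))))"
    by (intro conjI f_fun_analytic g_fun_analytic half)
qed

end
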